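(* Let $\Omega\subset\mathbb R^3$ be a bounded polyhedral domain, let $\mathcal T$ be a conforming tetrahedral triangulation of $\Omega$, and for every edge $e$ of $\mathcal T$ fix (globally, i.e. the same for all tetrahedra containing $e$) two linearly independent vectors $\gamma_e^0,\gamma_e^1\in e^\perp$. Let $Z_3^{\mathrm{sing}}(\mathcal T)$ be the global singular Zienkiewicz space, i.e. the space of all $z\in L^2(\Omega)$ such that $z|_T\in Z_3^{\mathrm{sing}}(T)$ for all $T\in\mathcal T$ and such that the following quantities are single-valued (they agree when computed from any two tetrahedra of $\mathcal T$ sharing the respective vertex or edge): the vertex values $z(v)$ and vertex gradients $\nabla z(v)$ for all vertices $v$, and the edge-gradient values $4\,\nabla z(\mathrm{mid}(e))\cdot\gamma_e^j$, $j=0,1$, for all edges $e$. Then $$Z_3^{\mathrm{sing}}(\mathcal T)\subset H^2(\Omega).$$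
   Context: Let $T=[v_0,v_1,v_2,v_3]\subset\mathbb R^3$ be a (nondegenerate) tetrahedron with barycentric coordinates $\lambda_0,\dots,\lambda_3$. Set $I=\{0,1,2,3\}$, $J_i=I\setminus\{i\}$. Let $f_i=\{\lambda_i=0\}$ be the face opposite to $v_i$, $\nu_i$ its outer unit normal, and $d_{ji}=\nabla\lambda_j\cdot\nu_i$. For $\ell\neq m$ let $e_{\ell m}=[v_\ell,v_m]$; for an edge $e$, $\mathrm{mid}(e)$ is its midpoint and $e^\perp=\{\nu\in\mathbb R^3:\nu\perp e\}$. $\mathcal P_k$ denotes polynomials of total degree at most $k$. Polynomial Zienkiewicz space: $Z_3^0(T)=\mathcal P_2(T)\oplus\mathrm{span}\{\lambda_i^2\lambda_j-\lambda_j^2\lambda_i:0\le i<j\le3\}$. Singular edge bubbles: for $0\le\ell<m\le3$ and $n\in I\setminus\{\ell,m\}$, $$E_{\ell m}^n=\frac{\lambda_n\lambda_\ell^2\lambda_m^2}{(\lambda_n+\lambda_\ell)(\lambda_n+\lambda_m)}.$$ Edge-enriched space: $Z_3^e(T)=Z_3^0(T)+\mathrm{span}\{E_{\ell m}^n:0\le\ell<m\le3,\ n\in I\setminus\{\ell,m\}\}$. On the face $f_i$ put $\mu_j=\lambda_j|_{f_i}$ for $j\in J_i$. For an edge $e_{\ell m}\subset f_i$ ($\ell<m$) with $\{n\}=I\setminus\{i,\ell,m\}$ set $$\Phi_{\ell m,\ell}^{n,i}=\frac{\mu_n\mu_\ell\mu_m^2(2\mu_n+\mu_\ell)}{(\mu_n+\mu_\ell)^2(\mu_n+\mu_m)},\quad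 \Phi_{\ell m,m}^{n,i}=\frac{\mu_n\mu_\ell^2\mu_m(2\mu_n+\mu_m)}{(\mu_n+\mu_\ell)(\mu_n+\mu_m)^2},$$ $$\Phi_{\ell m,n}^{n,i}=\frac{\mu_\ell^2\mu_m^2(\mu_\ell\mu_m-\mu_n^2)}{(\mu_n+\mu_\ell)^2(\mu_n+\mu_m)^2}-\mu_\ell\mu_m,$$ and let $Q_{\mathrm{edge}}(f_i)$ be the span of these functions over all edges $e_{\ell m}\subset f_i$. For $q\in Q_{\mathrm{edge}}(f_i)$ the canonical barycentric extension $\widetilde q$ to $T$ is obtained by replacing $\mu_j$ by $\lambda_j$ for all $j\in J_i$ in these formulas (extended linearly). The normal lift is $$L_iq=\frac{\lambda_i}{d_{ii}}\Theta_i\,\widetilde q,\qquad \Theta_i=\prod_{j\in J_i}\frac{\lambda_j}{\lambda_i+\lambda_j}.$$ Every $z\in Z_3^e(T)$ has on each face a unique decomposition $\partial_{\nu_i}z|_{f_i}=p_i(z)+q_i(z)$ with $p_i(z)\in\mathcal P_2(f_i)$, $q_i(z)\in Q_{\mathrm{edge}}(f_i)$. Set $\mathcal R_Tz=z-\sum_{i=0}^3L_iq_i(z)$ and $$Z_3^{\mathrm{sing}}(T)=\mathcal R_TZ_3^e(T).$$ Values and gradients at points of $\partial T$ are understood by continuous extension. *)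

theory Defs
  imports "HOL-Analysis.Analysis"
begin

type_synonym point = "real^3"

section \<open>Sobolev spaces\<close>

definition L2 :: "point set \<Rightarrow> (point \<Rightarrow> real) set" where
  "L2 \<Omega> = {f \<in> borel_measurable (lebesgue_on \<Omega>). integrable (lebesgue_on \<Omega>) (\<lambda>x. (f x)\<^sup>2)}"

definition partial_deriv :: "3 \<Rightarrow> (point \<Rightarrow> real) \<Rightarrow> point \<Rightarrow> real" where
  "partial_deriv i f x = frechet_derivative f (at x) (axis i 1)"

text \<open>A multi-index of order \<open>k\<close> is represented by a list of \<open>k\<close> coordinate directions.\<close>

definition iter_partial :: "3 list \<Rightarrow> (point \<Rightarrow> real) \<Rightarrow> point \<Rightarrow> real" where
  "iter_partial is f = foldr partial_deriv is f"

definition test_functions :: "point set \<Rightarrow> (point \<Rightarrow> real) set" where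
  "test_functions \<Omega> = {\<phi>. (\<forall>is x. iter_partial is \<phi> differentiable (at x)) \<and>
     compact (closure {x. \<phi> x \<noteq> 0}) \<and> closure {x. \<phi> x \<noteq> 0} \<subseteq> \<Omega>}"

definition has_weak_partial :: "point set \<Rightarrow> 3 list \<Rightarrow> (point \<Rightarrow> real) \<Rightarrow> (point \<Rightarrow> real) \<Rightarrow> bool" where
  "has_weak_partial \<Omega> is f g \<longleftrightarrow>
     (\<forall>\<phi>\<in>test_functions \<Omega>.
        (LINT x|lebesgue_on \<Omega>. f x * iter_partial is \<phi> x)
          = (- 1) ^ length is * (LINT x|lebesgue_on \<Omega>. g x * \<phi> x))"

definition sobolev_H :: "nat \<Rightarrow> point set \<Rightarrow> (point \<Rightarrow> real) set" where
  "sobolev_H k \<Omega> = {f \<in> L2 \<Omega>. \<forall>is. length is \<le> k \<longrightarrow> (\<exists>g \<in> L2 \<Omega>. has_weak_partial \<Omega> is f g)}"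

section \<open>Polynomials, gradients, continuous extension\<close>

definition lin_span :: "('a \<Rightarrow> real) set \<Rightarrow> ('a \<Rightarrow> real) set" where
  "lin_span B = {f. \<exists>A c. finite A \<and> A \<subseteq> B \<and> f = (\<lambda>x. \<Sum>b\<in>A. c b * b x)}"

definition polys :: "nat \<Rightarrow> (point \<Rightarrow> real) set" where
  "polys k = lin_span {(\<lambda>x. \<Prod>i\<in>UNIV. (x $ i) ^ a i) | a :: 3 \<Rightarrow> nat. (\<Sum>i\<in>UNIV. a i) \<le> k}"

definition grad :: "(point \<Rightarrow> real) \<Rightarrow> point \<Rightarrow> point" where
  "grad f x = (THE D. GDERIV f x :> D)"

text \<open>The value at \<open>p\<close> (a point of \<open>T\<close>, possibly on its boundary) of the continuous extension
  of \<open>g\<close> from the interior of \<open>T\<close>.\<close>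

definition cont_ext :: "point set \<Rightarrow> (point \<Rightarrow> 'b::t2_space) \<Rightarrow> point \<Rightarrow> 'b" where
  "cont_ext T g p = Lim (at p within interior T) g"

section \<open>The geometry of a tetrahedron\<close>

text \<open>A tetrahedron is given by its vertices \<open>v 0, \<dots>, v 3\<close>; the values of \<open>v\<close> at other
  arguments are irrelevant.\<close>

definition tet :: "(nat \<Rightarrow> point) \<Rightarrow> point set" where
  "tet v = convex hull (v ` {0..3})"

definition is_labelling :: "(nat \<Rightarrow> point) \<Rightarrow> point set \<Rightarrow> bool" where
  "is_labelling v T \<longleftrightarrow> inj_on v {0..3} \<and> \<not> affine_dependent (v ` {0..3}) \<and> T = tet v"

text \<open>\<open>bary v j\<close> is the affine function \<open>\<lambda>\<^sub>j\<close>, defined on the whole of space.\<close>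

definition bary :: "(nat \<Rightarrow> point) \<Rightarrow> nat \<Rightarrow> point \<Rightarrow> real" where
  "bary v j x =
     (THE u. (\<forall>k. k \<notin> {0..3} \<longrightarrow> u k = 0) \<and> (\<Sum>k\<in>{0..3}. u k) = 1 \<and>
             (\<Sum>k\<in>{0..3}. u k *\<^sub>R v k) = x) j"

definition face :: "(nat \<Rightarrow> point) \<Rightarrow> nat \<Rightarrow> point set" where
  "face v i = {x \<in> tet v. bary v i x = 0}"

definition outer_normal :: "(nat \<Rightarrow> point) \<Rightarrow> nat \<Rightarrow> point" where
  "outer_normal v i =
     (THE \<nu>. norm \<nu> = 1 \<and> (\<forall>x\<in>face v i. \<forall>y\<in>face v i. \<nu> \<bullet> (x - y) = 0) \<and>
             (\<forall>x\<in>face v i. \<nu> \<bullet> (v i - x) < 0))"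

text \<open>\<open>d\<^sub>j\<^sub>i = \<nabla>\<lambda>\<^sub>j \<bullet> \<nu>\<^sub>i\<close>; the gradient of \<open>\<lambda>\<^sub>j\<close> is constant, so the point at which it is
  evaluated does not matter.\<close>

definition dcoef :: "(nat \<Rightarrow> point) \<Rightarrow> nat \<Rightarrow> nat \<Rightarrow> real" where
  "dcoef v j i = grad (bary v j) (v i) \<bullet> outer_normal v i"

definition normal_deriv :: "(nat \<Rightarrow> point) \<Rightarrow> nat \<Rightarrow> (point \<Rightarrow> real) \<Rightarrow> point \<Rightarrow> real" where
  "normal_deriv v i z x = cont_ext (tet v) (grad z) x \<bullet> outer_normal v i"

section \<open>The local spaces\<close>

text \<open>The rational functions below have vanishing denominators on some edges of the tetrahedron or
  at some vertices of a face. The edge bubbles, the face functions and the normal lifts extend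
  continuously by \<open>0\<close> there, which is also the value given by the convention \<open>x / 0 = 0\<close>.\<close>

definition Z30 :: "(nat \<Rightarrow> point) \<Rightarrow> (point \<Rightarrow> real) set" where
  "Z30 v = {(\<lambda>x. p x + s x) | p s. p \<in> polys 2 \<and>
     s \<in> lin_span {(\<lambda>x. (bary v i x)\<^sup>2 * bary v j x - (bary v j x)\<^sup>2 * bary v i x) | i j.
                      i < j \<and> j \<le> 3}}"

definition edge_bubble :: "(nat \<Rightarrow> point) \<Rightarrow> nat \<Rightarrow> nat \<Rightarrow> nat \<Rightarrow> point \<Rightarrow> real" where
  "edge_bubble v l m n x =
     bary v n x * (bary v l x)\<^sup>2 * (bary v m x)\<^sup>2
       / ((bary v n x + bary v l x) * (bary v n x + bary v m x))"

definition Z3e :: "(nat \<Rightarrow> point) \<Rightarrow> (point \<Rightarrow> real) set" where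
  "Z3e v = {(\<lambda>x. z x + s x) | z s. z \<in> Z30 v \<and>
     s \<in> lin_span {edge_bubble v l m n | l m n. l < m \<and> m \<le> 3 \<and> n \<in> {0..3} - {l, m}}}"

text \<open>The functions \<open>\<Phi>\<close>, as expressions in the barycentric coordinates \<open>\<mu>\<close>.\<close>

definition Phi_l :: "nat \<Rightarrow> nat \<Rightarrow> nat \<Rightarrow> (nat \<Rightarrow> real) \<Rightarrow> real" where
  "Phi_l l m n \<mu> =
     \<mu> n * \<mu> l * (\<mu> m)\<^sup>2 * (2 * \<mu> n + \<mu> l) / ((\<mu> n + \<mu> l)\<^sup>2 * (\<mu> n + \<mu> m))"

definition Phi_m :: "nat \<Rightarrow> nat \<Rightarrow> nat \<Rightarrow> (nat \<Rightarrow> real) \<Rightarrow> real" where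
  "Phi_m l m n \<mu> =
     \<mu> n * (\<mu> l)\<^sup>2 * \<mu> m * (2 * \<mu> n + \<mu> m) / ((\<mu> n + \<mu> l) * (\<mu> n + \<mu> m)\<^sup>2)"

definition Phi_n :: "nat \<Rightarrow> nat \<Rightarrow> nat \<Rightarrow> (nat \<Rightarrow> real) \<Rightarrow> real" where
  "Phi_n l m n \<mu> =
     (\<mu> l)\<^sup>2 * (\<mu> m)\<^sup>2 * (\<mu> l * \<mu> m - (\<mu> n)\<^sup>2) / ((\<mu> n + \<mu> l)\<^sup>2 * (\<mu> n + \<mu> m)\<^sup>2) - \<mu> l * \<mu> m"

definition Phis :: "nat \<Rightarrow> ((nat \<Rightarrow> real) \<Rightarrow> real) set" where
  "Phis i = (\<Union>(l, m, n) \<in> {(l, m, n). l < m \<and> {l, m, n} = {0..3} - {i} \<and> n \<notin> {l, m}}.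
               {Phi_l l m n, Phi_m l m n, Phi_n l m n})"

definition Phi_space :: "(nat \<Rightarrow> point) \<Rightarrow> nat \<Rightarrow> (point \<Rightarrow> real) set" where
  "Phi_space v i = lin_span ((\<lambda>F x. F (\<lambda>j. bary v j x)) ` Phis i)"

text \<open>Functions on a face, and the extensions of elements of \<open>Q_edge\<close> to \<open>T\<close>, are extensional
  functions, so that they are uniquely determined by their values there.\<close>

definition Q_edge :: "(nat \<Rightarrow> point) \<Rightarrow> nat \<Rightarrow> (point \<Rightarrow> real) set" where
  "Q_edge v i = (\<lambda>g. restrict g (face v i)) ` Phi_space v i"

definition face_polys :: "nat \<Rightarrow> (nat \<Rightarrow> point) \<Rightarrow> nat \<Rightarrow> (point \<Rightarrow> real) set" where
  "face_polys k v i = (\<lambda>g. restrict g (face v i)) ` polys k"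

text \<open>The canonical extension takes \<open>\<Sum>c\<^sub>k \<Phi>\<^sub>k(\<mu>)\<close> to \<open>\<Sum>c\<^sub>k \<Phi>\<^sub>k(\<lambda>)\<close>. As the \<open>\<Phi>\<^sub>k\<close> are homogeneous of
  degree 2, a linear relation between them on the face persists on \<open>T\<close>, so the result
  is independent of the choice of coefficients.\<close>

definition bary_ext :: "(nat \<Rightarrow> point) \<Rightarrow> nat \<Rightarrow> (point \<Rightarrow> real) \<Rightarrow> point \<Rightarrow> real" where
  "bary_ext v i q =
     (THE qt. qt \<in> (\<lambda>g. restrict g (tet v)) ` Phi_space v i \<and> (\<forall>x\<in>face v i. qt x = q x))"

definition Theta :: "(nat \<Rightarrow> point) \<Rightarrow> nat \<Rightarrow> point \<Rightarrow> real" where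
  "Theta v i x = (\<Prod>j\<in>{0..3} - {i}. bary v j x / (bary v i x + bary v j x))"

definition normal_lift :: "(nat \<Rightarrow> point) \<Rightarrow> nat \<Rightarrow> (point \<Rightarrow> real) \<Rightarrow> point \<Rightarrow> real" where
  "normal_lift v i q x = bary v i x / dcoef v i i * Theta v i x * bary_ext v i q x"

definition q_part :: "(nat \<Rightarrow> point) \<Rightarrow> nat \<Rightarrow> (point \<Rightarrow> real) \<Rightarrow> point \<Rightarrow> real" where
  "q_part v i z =
     (THE q. q \<in> Q_edge v i \<and>
        (\<exists>p\<in>face_polys 2 v i. \<forall>x\<in>face v i. normal_deriv v i z x = p x + q x))"

definition R_op :: "(nat \<Rightarrow> point) \<Rightarrow> (point \<Rightarrow> real) \<Rightarrow> point \<Rightarrow> real" where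
  "R_op v z x = z x - (\<Sum>i\<in>{0..3}. normal_lift v i (q_part v i z) x)"

text \<open>The elements of \<open>Z3sing v\<close> are functions on the tetrahedron: their values outside of it carry
  no meaning and are never used.\<close>

definition Z3sing :: "(nat \<Rightarrow> point) \<Rightarrow> (point \<Rightarrow> real) set" where
  "Z3sing v = R_op v ` Z3e v"

section \<open>Triangulations and the global space\<close>

definition polyhedral_domain :: "point set \<Rightarrow> bool" where
  "polyhedral_domain \<Omega> \<longleftrightarrow> open \<Omega> \<and> connected \<Omega> \<and> \<Omega> \<noteq> {} \<and>
     (\<exists>P. finite P \<and> (\<forall>K\<in>P. polytope K \<and> aff_dim K = 2) \<and> frontier \<Omega> = \<Union>P)"

definition conforming_triangulation :: "point set set \<Rightarrow> point set \<Rightarrow> bool" where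
  "conforming_triangulation \<T> \<Omega> \<longleftrightarrow>
     triangulation \<T> \<and> (\<forall>T\<in>\<T>. 3 simplex T) \<and> \<Union>\<T> = closure \<Omega>"

definition edge_mid :: "point set \<Rightarrow> point" where
  "edge_mid e = (THE m. \<exists>a b. e = closed_segment a b \<and> m = midpoint a b)"

definition edge_perp :: "point set \<Rightarrow> point set" where
  "edge_perp e = {\<nu>. \<forall>x\<in>e. \<forall>y\<in>e. orthogonal \<nu> (x - y)}"

text \<open>As \<open>z\<close> stands for a class of functions in \<open>L\<^sup>2\<close>, its restriction to \<open>T\<close> is compared with the
  local function \<open>w T\<close> only almost everywhere. The values and gradients at vertices and
  midpoints are those of the continuous function \<open>w T\<close>, which is determined by \<open>z\<close>.\<close>

definition Z3sing_global ::
  "point set \<Rightarrow> point set set \<Rightarrow> (point set \<Rightarrow> nat \<Rightarrow> point) \<Rightarrow> (point set \<Rightarrow> nat \<Rightarrow> point) \<Rightarrow>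
   (point \<Rightarrow> real) set" where
  "Z3sing_global \<Omega> \<T> vert \<gamma> = {z \<in> L2 \<Omega>. \<exists>w.
     (\<forall>T\<in>\<T>. w T \<in> Z3sing (vert T) \<and> (AE x in lebesgue_on T. z x = w T x)) \<and>
     (\<forall>T\<in>\<T>. \<forall>T'\<in>\<T>. \<forall>p. p extreme_point_of T \<and> p extreme_point_of T' \<longrightarrow>
        cont_ext T (w T) p = cont_ext T' (w T') p \<and>
        cont_ext T (grad (w T)) p = cont_ext T' (grad (w T')) p) \<and>
     (\<forall>T\<in>\<T>. \<forall>T'\<in>\<T>. \<forall>e. e edge_of T \<and> e edge_of T' \<longrightarrow>
        (\<forall>j\<in>{0, 1}. 4 * (cont_ext T (grad (w T)) (edge_mid e) \<bullet> \<gamma> e j)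
                   = 4 * (cont_ext T' (grad (w T')) (edge_mid e) \<bullet> \<gamma> e j)))}"

end

theory Submission
  imports Defs
begin

text \<open>
  The singular functions are locally of class \<open>C\<^sup>1\<close> with Lipschitz gradient, up to the boundary of the
  tetrahedron, and the degrees of freedom shared by two tetrahedra determine value and gradient on the
  common face. Hence the elements of the global space are, almost everywhere, equal to a function \<open>U\<close>
  which together with its gradient is Lipschitz on each tetrahedron and well defined on the union. A function
  of this kind has bounded weak derivatives (\<open>weak_partial_U\<close>): multiplied by a test function it is
  Lipschitz on the whole space, and the derivative of a compactly supported Lipschitz function has integral
  0. This is applied to \<open>U\<close> and to the components of its gradient.

  Regularity. The bubbles and the lifts are rational functions of the barycentric coordinates whose
  denominators are sums \<open>\<lambda>\<^sub>a + \<lambda>\<^sub>b\<close>. At a given point let \<open>\<delta>\<close> be the least of these sums. A derivative of a ratio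
  \<open>\<lambda>\<^sub>a / (\<lambda>\<^sub>a + \<lambda>\<^sub>b)\<close> costs at most a factor \<open>1 / \<delta>\<close>, so the second derivatives of a product of such ratios and
  coordinates are bounded if two coordinates not exceeding \<open>\<delta>\<close> can be split off. The bubbles and the lifts
  have this property (\<open>C2_bounded_if_pairs_divide\<close>, \<open>C2_edge_bubble\<close>, \<open>C2_lift\<close>).

  Structure of the local space (\<open>Z3sing_local\<close>). The trace on a face lies in a space of dimension twelve,
  spanned by quadratics, three cubics and three bubbles; the gradient is quadratic along each edge. The
  normal derivative of an edge-enriched function on a face is a quadratic plus an element of \<open>Q_edge\<close>. The
  lifts have the gradients that remove the latter without disturbing traces on faces or gradients on edges,
  so the normal derivative of a singular function on a face is quadratic.

  Conformity (\<open>elements_agree_on_intersection\<close>). Along a common edge the difference of two elements is a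
  cubic with vanishing Hermite data, and its gradient is a quadratic that vanishes at the ends and at the
  midpoint, so both are 0. On a common face the trace of the difference then has no polynomial part, and its
  three bubble coefficients are derivatives at edge midpoints, so it is 0. The normal derivative is a quadratic
  that vanishes on the edges of a triangle, hence 0 as well.
\<close>

section \<open>Weak derivatives of piecewise Lipschitz functions\<close>

lemma integral_translate_lebesgue:
  fixes V :: "point \<Rightarrow> real"
  assumes "V \<in> borel_measurable borel"
  shows "integral\<^sup>L lebesgue (\<lambda>x. V (c + x)) = integral\<^sup>L lebesgue V"
proof -
  have m: "(\<lambda>x. V (c + x)) \<in> borel_measurable borel"
    using assms by measurable
  have "integral\<^sup>L lborel V = integral\<^sup>L (distr lborel borel ((+) c)) V"
    by (simp add: lborel_distr_plus)
  also have "\<dots> = integral\<^sup>L lborel (\<lambda>x. V (c + x))"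
    by (rule integral_distr) (use assms in auto)
  finally show ?thesis
    using assms m by (simp add: integral_completion)
qed

lemma has_derivative_difference_quotient:
  fixes f :: "point \<Rightarrow> real"
  assumes "(f has_derivative D) (at x)"
  shows "(\<lambda>n. (f (x + (1 / real (Suc n)) *\<^sub>R e) - f x) * real (Suc n)) \<longlonglongrightarrow> D e"
proof -
  have lin: "D (r *\<^sub>R e) = r * D e" for r
    using linear_scale[OF has_derivative_linear[OF assms]] by auto
  have "((\<lambda>t. f (x + t *\<^sub>R e)) has_derivative (\<lambda>t. D (t *\<^sub>R e))) (at 0)"
    by (rule has_derivative_compose[where f="\<lambda>t. x + t *\<^sub>R e" and g=f])
       (use assms in \<open>auto intro!: derivative_eq_intros\<close>)
  then have "((\<lambda>t. f (x + t *\<^sub>R e)) has_field_derivative D e) (at 0)"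
    by (simp add: has_field_derivative_def lin mult_commute_abs)
  then have h1: "((\<lambda>t. (f (x + t *\<^sub>R e) - f x) / t) \<longlongrightarrow> D e) (at 0)"
    by (simp add: DERIV_def)
  have h0: "filterlim (\<lambda>n. 1 / real (Suc n)) (at 0) sequentially"
    using LIMSEQ_Suc[OF lim_1_over_n] unfolding filterlim_at by simp
  have "(\<lambda>n. (f (x + (1 / real (Suc n)) *\<^sub>R e) - f x) / (1 / real (Suc n))) \<longlonglongrightarrow> D e"
    by (rule filterlim_compose[OF h1 h0])
  then show ?thesis by simp
qed

text \<open>By translation invariance every difference quotient of \<open>V\<close> has integral 0, and the Lipschitz bound
  dominates them all, so their limit has integral 0 too.\<close>

lemma integral_directional_derivative_zero:
  fixes V f :: "point \<Rightarrow> real"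
  assumes lip: "L-lipschitz_on UNIV V" and supp: "\<And>x. norm x > R \<Longrightarrow> V x = 0"
    and e: "norm e = 1" and f: "f \<in> borel_measurable lebesgue"
    and ae: "AE x in lebesgue. \<exists>D. (V has_derivative D) (at x) \<and> D e = f x"
  shows "integral\<^sup>L lebesgue f = 0"
proof -
  let ?q = "\<lambda>n x. (V (x + (1 / real (Suc n)) *\<^sub>R e) - V x) * real (Suc n)"
  have cont: "continuous_on UNIV V"
    using lip by (rule lipschitz_on_continuous_on)
  have Vm: "V \<in> borel_measurable borel"
    using cont by (rule borel_measurable_continuous_onI)
  have qm: "?q n \<in> borel_measurable borel" for n
    using Vm by measurable
  have qm': "?q n \<in> borel_measurable lebesgue" for n
    using qm[of n] by (simp add: measurable_completion)
  have Vint: "integrable lebesgue V"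
  proof -
    have "integrable lebesgue (\<lambda>x. indicator (cball 0 R) x *\<^sub>R V x)"
      using borel_integrable_compact[OF compact_cball continuous_on_subset[OF cont]]
      by (simp add: integrable_completion Vm)
    moreover have "(\<lambda>x. indicator (cball 0 R) x *\<^sub>R V x) = V"
      using supp by (auto simp: fun_eq_iff indicator_def not_le[symmetric])
    ultimately show ?thesis by simp
  qed
  have Vint': "integrable lebesgue (\<lambda>x. V (x + c))" for c
  proof -
    have c': "continuous_on UNIV (\<lambda>x. V (x + c))"
      by (rule continuous_on_compose2[OF cont]) (auto intro!: continuous_intros)
    then have m: "(\<lambda>x. V (x + c)) \<in> borel_measurable borel"
      by (rule borel_measurable_continuous_onI)
    have "integrable lebesgue (\<lambda>x. indicator (cball 0 (R + norm c)) x *\<^sub>R V (x + c))"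
      using borel_integrable_compact[OF compact_cball continuous_on_subset[OF c']]
      by (simp add: integrable_completion m)
    moreover have "(\<lambda>x. indicator (cball 0 (R + norm c)) x *\<^sub>R V (x + c)) = (\<lambda>x. V (x + c))"
    proof
      fix x
      have "norm x \<le> norm (x + c) + norm c" 
        by (metis add_diff_cancel_right' norm_triangle_ineq4)
      then show "indicator (cball 0 (R + norm c)) x *\<^sub>R V (x + c) = V (x + c)"
        using supp[of "x + c"] by (cases "norm (x + c) > R") (auto simp: indicator_def)
    qed
    ultimately show ?thesis by simp
  qed
  have q0: "integral\<^sup>L lebesgue (?q n) = 0" for n
  proof -
    define c where "c = (1 / real (Suc n)) *\<^sub>R e"
    have "integral\<^sup>L lebesgue (\<lambda>x. V (x + c) - V x) = 0"
      by (subst Bochner_Integration.integral_diff[OF Vint'[of c] Vint])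
        (use integral_translate_lebesgue[OF Vm, of c] in \<open>simp add: add.commute[of c]\<close>)
    then show ?thesis by (simp only: c_def[symmetric] Bochner_Integration.integral_mult_left_zero mult_zero_left)
  qed
  have L0: "L \<ge> 0" using lip by (rule lipschitz_on_nonneg)
  have bd: "norm (?q n x) \<le> L * indicator (cball 0 (R + 1)) x" for n x
  proof (cases "norm x \<le> R + 1")
    case True
    have "\<bar>V (x + (1 / real (Suc n)) *\<^sub>R e) - V x\<bar> \<le> L * (1 / real (Suc n))"
      using lipschitz_onD[OF lip, of "x + (1 / real (Suc n)) *\<^sub>R e" x] e
      by (simp add: dist_norm)
    then have "\<bar>V (x + (1 / real (Suc n)) *\<^sub>R e) - V x\<bar> * real (Suc n) \<le> L"
      by (simp add: field_simps)
    then show ?thesis using True by (simp add: abs_mult)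
  next
    case False
    have "norm x \<le> norm (x + (1 / real (Suc n)) *\<^sub>R e) + norm ((1 / real (Suc n)) *\<^sub>R e)"
      by (metis add_diff_cancel_right' norm_triangle_ineq4)
    moreover have "norm ((1 / real (Suc n)) *\<^sub>R e) \<le> 1"
      using e by simp
    ultimately have "norm (x + (1 / real (Suc n)) *\<^sub>R e) > R"
      using False by linarith
    then show ?thesis using False supp[of x] supp[of "x + (1 / real (Suc n)) *\<^sub>R e"]
      by simp
  qed
  have lim: "AE x in lebesgue. (\<lambda>n. ?q n x) \<longlonglongrightarrow> f x"
    using ae
  proof eventually_elim
    case (elim x)
    then obtain D where D: "(V has_derivative D) (at x)" "D e = f x" by blast
    show ?case using has_derivative_difference_quotient[OF D(1), of e] unfolding D(2) .
  qed
  have "integrable lebesgue (\<lambda>x::point. L * indicator (cball 0 (R + 1)) x :: real)"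
    by (intro integrable_mult_right integrable_real_indicator) (use emeasure_bounded_finite[OF bounded_cball[of "0::point" "R+1"]] in \<open>simp_all add: infinity_ennreal_def\<close>)
  then have "(\<lambda>n. integral\<^sup>L lebesgue (?q n)) \<longlonglongrightarrow> integral\<^sup>L lebesgue f"
    by (rule integral_dominated_convergence[rotated 2]) (use f qm' bd lim in auto)
  then show ?thesis unfolding q0 using LIMSEQ_unique tendsto_const by blast
qed

text \<open>On a segment the function is Lipschitz on each of finitely many closed pieces, with one constant.\<close>

lemma lipschitz_on_UNIV_closed_cover:
  fixes f :: "point \<Rightarrow> real"
  assumes "finite \<C>" "\<And>S. S \<in> \<C> \<Longrightarrow> closed S" "\<And>S. S \<in> \<C> \<Longrightarrow> \<exists>L. L-lipschitz_on S f"
    "\<Union>\<C> = UNIV"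
  obtains L where "L-lipschitz_on UNIV f"
proof -
  obtain L where L: "\<And>S. S \<in> \<C> \<Longrightarrow> (L S)-lipschitz_on S f"
    using assms(3) by metis
  define M where "M = (\<Sum>S\<in>\<C>. L S)"
  have L0: "L S \<ge> 0" if "S \<in> \<C>" for S using L[OF that] by (rule lipschitz_on_nonneg)
  have M0: "M \<ge> 0" unfolding M_def using L0 by (rule sum_nonneg)
  have LM: "M-lipschitz_on S f" if "S \<in> \<C>" for S
    using L[OF that] by (rule lipschitz_on_le) (auto simp: M_def that assms L0 intro!: member_le_sum)
  have "M-lipschitz_on UNIV f"
  proof (rule lipschitz_onI[OF _ M0])
    fix x y :: point
    define p where "p = (\<lambda>t. x + t *\<^sub>R (y - x))"
    have "(M * dist x y)-lipschitz_on {0..1} (f \<circ> p)"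
    proof (rule lipschitz_on_closed_Union[where I=\<C> and U="\<lambda>S. p -` S"])
      fix S assume S: "S \<in> \<C>"
      show "(M * dist x y)-lipschitz_on (p -` S) (f \<circ> p)"
      proof (rule lipschitz_onI)
        fix s t assume "s \<in> p -` S" "t \<in> p -` S"
        then have "dist (f (p s)) (f (p t)) \<le> M * dist (p s) (p t)"
          using lipschitz_onD[OF LM[OF S]] by auto
        also have "dist (p s) (p t) = dist x y * dist s t"
        proof -
          have "p s - p t = (s - t) *\<^sub>R (y - x)" by (simp add: p_def algebra_simps)
          then show ?thesis by (simp add: dist_norm norm_minus_commute mult.commute)
        qed
        finally show "dist ((f \<circ> p) s) ((f \<circ> p) t) \<le> M * dist x y * dist s t"
          by (simp add: mult.assoc)
      qed (use M0 in simp)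
      have "continuous_on UNIV p" unfolding p_def by (intro continuous_intros)
      then show "closed (p -` S)"
        using assms(2)[OF S] continuous_closed_vimage continuous_on_eq_continuous_at[of UNIV p] by auto
    next
      show "{0..1} \<subseteq> (\<Union>S\<in>\<C>. p -` S)" 
      proof
        fix t :: real
        have "p t \<in> \<Union>\<C>" unfolding assms(4) by (rule UNIV_I)
        then show "t \<in> (\<Union>S\<in>\<C>. p -` S)" by blast
      qed
      show "finite \<C>" by (rule assms(1))
      show "0 \<le> M * dist x y" using M0 by (rule mult_nonneg_nonneg) (rule zero_le_dist)
    qed
    from lipschitz_onD[OF this, of 0 1] show "dist (f x) (f y) \<le> M * dist x y"
      by (simp add: p_def)
  qed
  then show ?thesis by (rule that)
qed

lemma has_derivative_partials:
  assumes "f differentiable (at x)"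
  shows "(f has_derivative (\<lambda>h. \<Sum>j\<in>UNIV. h $ j * partial_deriv j f x)) (at x)"
proof -
  let ?D = "frechet_derivative f (at x)"
  have D: "(f has_derivative ?D) (at x)"
    using assms frechet_derivative_works by blast
  then have lin: "linear ?D" by (rule has_derivative_linear)
  have "?D h = (\<Sum>j\<in>UNIV. h $ j * partial_deriv j f x)" for h
  proof -
    have "?D h = ?D (\<Sum>j\<in>UNIV. (h $ j) *\<^sub>R axis j 1)"
      using basis_expansion[of h] by (simp add: scalar_mult_eq_scaleR)
    also have "\<dots> = (\<Sum>j\<in>UNIV. h $ j * partial_deriv j f x)"
      by (simp add: linear_sum[OF lin] linear_scale[OF lin] partial_deriv_def)
    finally show ?thesis .
  qed
  then have "?D = (\<lambda>h. \<Sum>j\<in>UNIV. h $ j * partial_deriv j f x)" by (rule ext)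
  then show ?thesis using D by simp
qed

lemma test_functions_differentiable:
  assumes "\<phi> \<in> test_functions \<Omega>"
  shows "\<phi> differentiable (at x)" "partial_deriv i \<phi> differentiable (at x)"
proof -
  have *: "iter_partial is \<phi> differentiable (at x)" for "is" using assms unfolding test_functions_def by blast
  show "\<phi> differentiable (at x)" using *[of "[]"] by (simp add: iter_partial_def)
  show "partial_deriv i \<phi> differentiable (at x)" using *[of "[i]"] by (simp add: iter_partial_def)
qed

lemma test_functions_vanish:
  assumes "\<phi> \<in> test_functions \<Omega>" "x \<notin> \<Omega>"
  shows "(\<phi> has_derivative (\<lambda>h. 0)) (at x)" "\<phi> x = 0" "\<forall>\<^sub>F y in nhds x. \<phi> y = 0"
proof -
  let ?S = "- closure {x. \<phi> x \<noteq> 0}"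
  have S: "open ?S" "x \<in> ?S" using assms unfolding test_functions_def by auto
  have z: "\<phi> y = 0" if "y \<in> ?S" for y using that subsetD[OF closure_subset, of y "{x. \<phi> x \<noteq> 0}"] by auto
  show "(\<phi> has_derivative (\<lambda>h. 0)) (at x)"
    by (rule has_derivative_transform_within_open[OF has_derivative_const[of 0] S]) (rule z[symmetric])
  show "\<phi> x = 0" using z S(2) by blast
  show "\<forall>\<^sub>F y in nhds x. \<phi> y = 0" unfolding eventually_nhds using S z by blast
qed

lemma test_functions_partial:
  assumes "\<phi> \<in> test_functions \<Omega>"
  shows "partial_deriv i \<phi> \<in> test_functions \<Omega>"
proof -
  have "iter_partial is (partial_deriv i \<phi>) = iter_partial (is @ [i]) \<phi>" for "is"
    by (simp add: iter_partial_def)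
  moreover have sub: "closure {x. partial_deriv i \<phi> x \<noteq> 0} \<subseteq> closure {x. \<phi> x \<noteq> 0}"
  proof (rule closure_minimal[OF subsetI closed_closure], rule ccontr)
    fix x assume x: "x \<in> {x. partial_deriv i \<phi> x \<noteq> 0}" "x \<notin> closure {x. \<phi> x \<noteq> 0}"
    have "\<phi> \<in> test_functions (closure {x. \<phi> x \<noteq> 0})"
      using assms unfolding test_functions_def by simp
    from test_functions_vanish(1)[OF this x(2)]
    have "frechet_derivative \<phi> (at x) = (\<lambda>h. 0)"
      by (metis frechet_derivative_at)
    then show False using x(1) by (simp add: partial_deriv_def)
  qed
  moreover have "compact (closure {x. partial_deriv i \<phi> x \<noteq> 0})"
  proof -
    have "compact (closure {x. \<phi> x \<noteq> 0})" using assms unfolding test_functions_def by blast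
    from compact_Int_closed[OF this closed_closure] have "compact (closure {x. \<phi> x \<noteq> 0} \<inter> closure {x. partial_deriv i \<phi> x \<noteq> 0})" .
    then show ?thesis using sub by (simp only: Int_absorb1)
  qed
  ultimately show ?thesis using assms unfolding test_functions_def by auto
qed

lemma test_functions_lipschitz:
  assumes "\<phi> \<in> test_functions \<Omega>" and "compact S" "convex S"
  obtains L where "L-lipschitz_on S \<phi>"
proof -
  have cont: "continuous_on S (\<lambda>x. \<Sum>j\<in>UNIV. \<bar>partial_deriv j \<phi> x\<bar>)"
    by (intro continuous_intros differentiable_imp_continuous_on)
       (simp add: differentiable_on_def differentiable_at_withinI test_functions_differentiable[OF assms(1)])
  obtain C where C: "\<And>x. x \<in> S \<Longrightarrow> (\<Sum>j\<in>UNIV. \<bar>partial_deriv j \<phi> x\<bar>) \<le> C"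
  proof (cases "S = {}")
    case True then show ?thesis using that by blast
  next
    case False
    from continuous_attains_sup[OF assms(2) False cont] that show ?thesis by blast
  qed
  have "\<bar>C\<bar>-lipschitz_on S \<phi>"
  proof (rule bounded_derivative_imp_lipschitz[OF _ assms(3)])
    fix x assume x: "x \<in> S"
    show "(\<phi> has_derivative (\<lambda>h. \<Sum>j\<in>UNIV. h $ j * partial_deriv j \<phi> x)) (at x within S)"
      by (rule has_derivative_at_withinI[OF has_derivative_partials])
         (rule test_functions_differentiable[OF assms(1)])
    show "onorm (\<lambda>h. \<Sum>j\<in>UNIV. h $ j * partial_deriv j \<phi> x) \<le> \<bar>C\<bar>"
    proof (rule onorm_bound)
      fix h :: point
      have "norm (\<Sum>j\<in>UNIV. h $ j * partial_deriv j \<phi> x) \<le> (\<Sum>j\<in>UNIV. \<bar>h $ j\<bar> * \<bar>partial_deriv j \<phi> x\<bar>)"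
        by (metis (no_types, lifting) abs_mult norm_sum real_norm_def sum.cong)
      also have "\<dots> \<le> (\<Sum>j\<in>UNIV. norm h * \<bar>partial_deriv j \<phi> x\<bar>)"
        by (intro sum_mono mult_right_mono component_le_norm_cart) auto
      also have "\<dots> \<le> norm h * \<bar>C\<bar>"
        unfolding sum_distrib_left[symmetric] using C[OF x] by (intro mult_left_mono) auto
      finally show "norm (\<Sum>j\<in>UNIV. h $ j * partial_deriv j \<phi> x) \<le> \<bar>C\<bar> * norm h"
        by (simp add: mult.commute)
    qed simp
  qed simp
  then show ?thesis by (rule that)
qed

text \<open>\<open>U\<close> is Lipschitz on each piece only, but as it has one value at each point of the union, it is
  continuous across the interfaces, and its weak derivative has no part concentrated there.\<close>

locale piecewise_lipschitz =
  fixes \<Omega> :: "point set" and \<T> :: "point set set" and U :: "point \<Rightarrow> real"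
  assumes fin: "finite \<T>" and comp: "T \<in> \<T> \<Longrightarrow> compact T" and conv: "T \<in> \<T> \<Longrightarrow> convex T"
    and opn: "open \<Omega>" and cover: "\<Omega> \<subseteq> \<Union>\<T>"
    and lip: "T \<in> \<T> \<Longrightarrow> \<exists>L. L-lipschitz_on T U"
    and diff: "T \<in> \<T> \<Longrightarrow> x \<in> interior T \<Longrightarrow> U differentiable (at x)"
begin

text \<open>The skeleton, where the value is set to 0, is a null set.\<close>

definition pd :: "3 \<Rightarrow> point \<Rightarrow> real" where
  "pd i x = (if x \<in> (\<Union>T\<in>\<T>. interior T) then partial_deriv i U x else 0)"

lemma negligible_skeleton: "negligible (\<Union>\<T> - (\<Union>T\<in>\<T>. interior T))"
proof (rule negligible_subset)
  show "negligible (\<Union>T\<in>\<T>. frontier T)"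
    using fin negligible_convex_frontier[OF conv] by (intro negligible_Union) auto
  show "\<Union>\<T> - (\<Union>T\<in>\<T>. interior T) \<subseteq> (\<Union>T\<in>\<T>. frontier T)"
  proof
    fix x assume x: "x \<in> \<Union>\<T> - (\<Union>T\<in>\<T>. interior T)"
    then obtain T where T: "T \<in> \<T>" "x \<in> T" by blast
    then have "x \<in> frontier T" using x closure_subset unfolding frontier_def by blast
    then show "x \<in> (\<Union>T\<in>\<T>. frontier T)" using T by blast
  qed
qed

lemma compact_Union: "compact (\<Union>\<T>)"
  using fin comp by (rule compact_Union)

lemma bounded_Omega: "bounded \<Omega>"
  using compact_Union cover by (meson bounded_subset compact_imp_bounded)

lemma continuous_U: "continuous_on (\<Union>\<T>) U"
proof -
  have "continuous_on (\<Union>T\<in>\<T>. T) U"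
    by (rule continuous_on_closed_Union[OF fin])
       (use comp compact_imp_closed lip lipschitz_on_continuous_on in blast)+
  then show ?thesis by simp
qed

lemma U_bounded: obtains B where "\<And>x. x \<in> \<Union>\<T> \<Longrightarrow> \<bar>U x\<bar> \<le> B" "B \<ge> 0"
proof -
  have "bounded (U ` \<Union>\<T>)"
    using compact_continuous_image[OF continuous_U compact_Union] compact_imp_bounded by blast
  then obtain B where "\<And>x. x \<in> \<Union>\<T> \<Longrightarrow> \<bar>U x\<bar> \<le> B" unfolding bounded_iff by auto
  then show ?thesis using that[of "\<bar>B\<bar>"] by force
qed

lemma deriv_bounded:
  obtains B where "\<And>x. x \<in> (\<Union>T\<in>\<T>. interior T) \<Longrightarrow> \<bar>partial_deriv i U x\<bar> \<le> B" "B \<ge> 0"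
proof -
  obtain L where L: "\<And>T. T \<in> \<T> \<Longrightarrow> (L T)-lipschitz_on T U" using lip by metis
  have L0: "L T \<ge> 0" if "T \<in> \<T>" for T using L[OF that] by (rule lipschitz_on_nonneg)
  have *: "\<bar>partial_deriv i U x\<bar> \<le> L T" if T: "T \<in> \<T>" and x: "x \<in> interior T" for T x
  proof -
    have D: "(U has_derivative frechet_derivative U (at x)) (at x)"
      using diff[OF T x] frechet_derivative_works by blast
    have lim: "(\<lambda>n. (U (x + (1 / real (Suc n)) *\<^sub>R axis i 1) - U x) * real (Suc n)) \<longlonglongrightarrow> partial_deriv i U x"
      using has_derivative_difference_quotient[OF D] by (simp add: partial_deriv_def)
    have "(\<lambda>n. x + (1 / real (Suc n)) *\<^sub>R axis i 1) \<longlonglongrightarrow> x + 0 *\<^sub>R axis i 1"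
      by (intro tendsto_intros LIMSEQ_Suc lim_1_over_n)
    then have ev: "\<forall>\<^sub>F n in sequentially. x + (1 / real (Suc n)) *\<^sub>R axis i 1 \<in> interior T"
      using topological_tendstoD open_interior x by fastforce
    have "\<forall>\<^sub>F n in sequentially. \<bar>(U (x + (1 / real (Suc n)) *\<^sub>R axis i 1) - U x) * real (Suc n)\<bar> \<le> L T"
      using ev
    proof eventually_elim
      case (elim n)
      then have "\<bar>U (x + (1 / real (Suc n)) *\<^sub>R axis i 1) - U x\<bar> \<le> L T * (1 / real (Suc n))"
        using lipschitz_onD[OF L[OF T], of "x + (1 / real (Suc n)) *\<^sub>R axis i 1" x] x interior_subset
        by (fastforce simp: dist_norm)
      then have "\<bar>U (x + (1 / real (Suc n)) *\<^sub>R axis i 1) - U x\<bar> * real (Suc n) \<le> L T"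
        by (simp add: field_simps)
      then show ?case unfolding abs_mult by simp
    qed
    then show ?thesis
      by (rule tendsto_upperbound[OF tendsto_rabs[OF lim]]) simp
  qed
  show ?thesis
  proof (rule that[of "\<Sum>T\<in>\<T>. L T"])
    fix x assume "x \<in> (\<Union>T\<in>\<T>. interior T)"
    then obtain T where T: "T \<in> \<T>" "x \<in> interior T" by blast
    have "L T \<le> (\<Sum>T\<in>\<T>. L T)" by (rule member_le_sum[OF T(1) _ fin]) (use L0 in auto)
    then show "\<bar>partial_deriv i U x\<bar> \<le> (\<Sum>T\<in>\<T>. L T)" using *[OF T] by linarith
  qed (use L0 in \<open>rule sum_nonneg\<close>)
qed

text \<open>The derivative is a pointwise limit of difference quotients of \<open>U\<close> extended by 0.\<close>

lemma pd_measurable: "pd i \<in> borel_measurable lebesgue"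
proof -
  let ?I = "\<Union>T\<in>\<T>. interior T"
  let ?U = "\<lambda>x. if x \<in> \<Union>\<T> then U x else 0"
  have cl: "closed (\<Union>\<T>)" using compact_Union by (rule compact_imp_closed)
  have U0: "?U \<in> borel_measurable borel"
    using borel_measurable_continuous_on_indicator[OF borel_closed[OF cl] continuous_U]
    by (rule measurable_cong[THEN iffD1, rotated]) (auto simp: indicator_def)
  have "(\<lambda>x. indicator ?I x * ((?U (x + (1 / real (Suc n)) *\<^sub>R axis i 1) - ?U x) * real (Suc n))) \<in> borel_measurable borel" for n
  proof -
    have "(\<lambda>x. ?U (x + (1 / real (Suc n)) *\<^sub>R axis i 1)) \<in> borel_measurable borel"
      by (rule measurable_compose[OF _ U0]) measurable
    moreover have "?I \<in> sets borel" by (intro borel_open open_UN) auto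
    ultimately show ?thesis using U0 by measurable
  qed
  then have "pd i \<in> borel_measurable borel"
  proof (rule borel_measurable_LIMSEQ_real[rotated])
    fix x :: point
    show "(\<lambda>n. indicator ?I x * ((?U (x + (1 / real (Suc n)) *\<^sub>R axis i 1) - ?U x) * real (Suc n))) \<longlonglongrightarrow> pd i x"
    proof (cases "x \<in> ?I")
      case True
      then obtain T where T: "T \<in> \<T>" "x \<in> interior T" by blast
      have D: "(U has_derivative frechet_derivative U (at x)) (at x)"
        using diff[OF T] frechet_derivative_works by blast
      have "(?U has_derivative frechet_derivative U (at x)) (at x)"
        by (rule has_derivative_transform_within_open[OF D open_interior T(2)])
           (use T(1) interior_subset in auto)
      from has_derivative_difference_quotient[OF this, of "axis i 1"] True
      show ?thesis by (simp add: pd_def partial_deriv_def)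
    next
      case False
      then show ?thesis by (simp add: pd_def)
    qed
  qed
  then show ?thesis by (simp add: measurable_completion)
qed

lemma Omega_lebesgue: "\<Omega> \<in> sets lebesgue"
  using opn by (simp add: borel_open sets_completionI_sets)

lemma finite_measure_Omega: "finite_measure (lebesgue_on \<Omega>)"
proof -
  have "\<Omega> \<in> lmeasurable" using bounded_Omega opn by (rule lmeasurable_open)
  then show ?thesis by (rule finite_measure_lebesgue_on)
qed

lemma bounded_in_L2:
  assumes "f \<in> borel_measurable (lebesgue_on \<Omega>)" "\<And>x. x \<in> \<Omega> \<Longrightarrow> \<bar>f x\<bar> \<le> B"
  shows "f \<in> L2 \<Omega>" "integrable (lebesgue_on \<Omega>) f"
proof -
  interpret finite_measure "lebesgue_on \<Omega>" by (rule finite_measure_Omega)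
  have "(\<lambda>x. (f x)\<^sup>2) \<in> borel_measurable (lebesgue_on \<Omega>)" using assms(1) by measurable
  then have "integrable (lebesgue_on \<Omega>) (\<lambda>x. (f x)\<^sup>2)"
  proof (rule integrable_const_bound[where B="B\<^sup>2", rotated], intro AE_I2)
    fix x assume "x \<in> space (lebesgue_on \<Omega>)"
    then have "\<bar>f x\<bar> \<le> B" using assms(2) by simp
    then show "norm ((f x)\<^sup>2) \<le> B\<^sup>2" by (simp add: abs_le_square_iff[symmetric])
  qed
  then show "f \<in> L2 \<Omega>" using assms(1) by (simp add: L2_def)
  show "integrable (lebesgue_on \<Omega>) f"
    by (rule integrable_const_bound[where B=B]) (use assms in auto)
qed

lemma U_measurable: "U \<in> borel_measurable (lebesgue_on \<Omega>)"
  using continuous_imp_measurable_on_sets_lebesgue[OF continuous_on_subset[OF continuous_U cover] Omega_lebesgue] .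

lemma pd_measurable_Omega: "pd i \<in> borel_measurable (lebesgue_on \<Omega>)"
  using pd_measurable by (rule measurable_restrict_space1)

lemma pd_bounded: obtains B where "\<And>x. \<bar>pd i x\<bar> \<le> B"
proof -
  obtain B where "\<And>x. x \<in> (\<Union>T\<in>\<T>. interior T) \<Longrightarrow> \<bar>partial_deriv i U x\<bar> \<le> B" "B \<ge> 0"
    using deriv_bounded[of i] by blast
  then show ?thesis using that[of B] by (auto simp: pd_def)
qed

lemma pd_L2: "pd i \<in> L2 \<Omega>"
  using pd_bounded bounded_in_L2(1)[OF pd_measurable_Omega] by metis

lemma test_function_measurable_bounded:
  assumes "\<phi> \<in> test_functions \<Omega>"
  shows "\<phi> \<in> borel_measurable lebesgue" "\<exists>B. \<forall>x. \<bar>\<phi> x\<bar> \<le> B"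
proof -
  have c: "continuous_on UNIV \<phi>"
    by (intro differentiable_imp_continuous_on)
       (simp add: differentiable_on_def differentiable_at_withinI test_functions_differentiable[OF assms])
  then have "\<phi> \<in> borel_measurable borel" by (rule borel_measurable_continuous_onI)
  then show "\<phi> \<in> borel_measurable lebesgue" by (simp add: measurable_completion)
  have "compact (\<phi> ` closure {x. \<phi> x \<noteq> 0})"
    by (rule compact_continuous_image[OF continuous_on_subset[OF c]])
       (use assms in \<open>auto simp: test_functions_def\<close>)
  then obtain B where B: "\<And>x. x \<in> closure {x. \<phi> x \<noteq> 0} \<Longrightarrow> \<bar>\<phi> x\<bar> \<le> B"
    using compact_imp_bounded[of "\<phi> ` closure {x. \<phi> x \<noteq> 0}"] unfolding bounded_iff by auto
  have "\<bar>\<phi> x\<bar> \<le> \<bar>B\<bar>" for x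
    using B[of x] closure_subset[of "{x. \<phi> x \<noteq> 0}"] by (cases "\<phi> x = 0") force+
  then show "\<exists>B. \<forall>x. \<bar>\<phi> x\<bar> \<le> B" by blast
qed

text \<open>The product \<open>U \<phi>\<close> is Lipschitz on the whole space, because it is Lipschitz on each piece and vanishes on
  the closed set outside \<open>\<Omega>\<close>. Hence its derivative \<open>U \<partial>\<^sub>i \<phi> + \<partial>\<^sub>i U \<phi>\<close> has integral 0.\<close>

lemma weak_partial_U: "has_weak_partial \<Omega> [i] U (pd i)"
  unfolding has_weak_partial_def
proof
  fix \<phi> assume \<phi>: "\<phi> \<in> test_functions \<Omega>"
  let ?d = "partial_deriv i \<phi>"
  have d: "?d \<in> test_functions \<Omega>" using \<phi> by (rule test_functions_partial)
  define V where "V = (\<lambda>x. U x * \<phi> x)"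
  define f where "f = (\<lambda>x. if x \<in> \<Omega> then U x * ?d x + pd i x * \<phi> x else 0)"
  obtain B where B: "\<And>x. x \<in> \<Union>\<T> \<Longrightarrow> \<bar>U x\<bar> \<le> B" using U_bounded by blast
  have "\<exists>L. L-lipschitz_on S V" if "S \<in> insert (- \<Omega>) \<T>" for S
  proof (cases "S = - \<Omega>")
    case True
    have "0-lipschitz_on S V"
      by (rule lipschitz_onI) (use test_functions_vanish(2)[OF \<phi>] True in \<open>auto simp: V_def\<close>)
    then show ?thesis by blast
  next
    case False
    then have S: "S \<in> \<T>" using that by blast
    obtain L where L: "L-lipschitz_on S U" using lip[OF S] by blast
    obtain M where M: "M-lipschitz_on S \<phi>" using test_functions_lipschitz[OF \<phi> comp[OF S] conv[OF S]] .
    obtain C where C: "\<And>x. \<bar>\<phi> x\<bar> \<le> C" using test_function_measurable_bounded(2)[OF \<phi>] by blast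
    have C0: "C \<ge> 0" using C[of 0] by linarith
    have "(\<bar>B\<bar> * M + C * L)-lipschitz_on S V"
    proof (rule lipschitz_onI)
      fix x y assume xy: "x \<in> S" "y \<in> S"
      have Bx: "\<bar>U x\<bar> \<le> \<bar>B\<bar>" using B[of x] xy S by force
      have "V x - V y = U x * (\<phi> x - \<phi> y) + \<phi> y * (U x - U y)"
        by (simp add: V_def algebra_simps)
      then have "dist (V x) (V y) \<le> \<bar>U x\<bar> * dist (\<phi> x) (\<phi> y) + \<bar>\<phi> y\<bar> * dist (U x) (U y)"
        by (simp add: dist_real_def abs_mult[symmetric] abs_triangle_ineq)
      also have "\<dots> \<le> \<bar>B\<bar> * (M * dist x y) + C * (L * dist x y)"
        using xy Bx by (intro add_mono mult_mono lipschitz_onD[OF L] lipschitz_onD[OF M] C) 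
          (auto simp: C0)
      finally show "dist (V x) (V y) \<le> (\<bar>B\<bar> * M + C * L) * dist x y" by (simp add: algebra_simps)
    qed (use C0 lipschitz_on_nonneg[OF L] lipschitz_on_nonneg[OF M] in simp)
    then show ?thesis by blast
  qed
  moreover have "\<Union>(insert (- \<Omega>) \<T>) = UNIV" using cover by auto
  moreover have "closed S" if "S \<in> insert (- \<Omega>) \<T>" for S
    using that opn comp compact_imp_closed by blast
  ultimately obtain L where L: "L-lipschitz_on UNIV V"
    using lipschitz_on_UNIV_closed_cover[of "insert (- \<Omega>) \<T>" V] fin by blast
  obtain R where R: "\<And>x. x \<in> \<Omega> \<Longrightarrow> norm x \<le> R" using bounded_Omega bounded_iff by blast
  have "integral\<^sup>L lebesgue f = 0"
  proof (rule integral_directional_derivative_zero[OF L])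
    show "V x = 0" if "norm x > R" for x
      using R[of x] that test_functions_vanish(2)[OF \<phi>, of x] by (force simp: V_def)
    show "norm (axis i 1 :: point) = 1" by simp
    have "(\<lambda>x. U x * ?d x + pd i x * \<phi> x) \<in> borel_measurable (lebesgue_on \<Omega>)"
      using U_measurable pd_measurable_Omega[of i]
        measurable_restrict_space1[OF test_function_measurable_bounded(1)[OF d]]
        measurable_restrict_space1[OF test_function_measurable_bounded(1)[OF \<phi>]]
      by measurable
    then show "f \<in> borel_measurable lebesgue"
      unfolding f_def by (rule borel_measurable_if_I) (rule Omega_lebesgue)
    have "\<exists>D. (V has_derivative D) (at x) \<and> D (axis i 1) = f x" if "x \<notin> \<Union>\<T> - (\<Union>T\<in>\<T>. interior T)" for x
    proof (cases "x \<in> \<Omega>")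
      case False
      obtain S where S: "open S" "x \<in> S" "\<And>y. y \<in> S \<Longrightarrow> \<phi> y = 0"
        using test_functions_vanish(3)[OF \<phi> False] unfolding eventually_nhds by blast
      have "(V has_derivative (\<lambda>h. 0)) (at x)"
        by (rule has_derivative_transform_within_open[OF has_derivative_const[of 0] S(1,2)])
           (use S(3) in \<open>auto simp: V_def\<close>)
      then show ?thesis using False by (auto simp: f_def)
    next
      case True
      then have "x \<in> \<Union>\<T>" using cover by (rule subsetD[rotated])
      with that have "x \<in> (\<Union>T\<in>\<T>. interior T)" by auto
      then obtain T where T: "T \<in> \<T>" "x \<in> interior T" by (rule UN_E)
      have DU: "(U has_derivative frechet_derivative U (at x)) (at x)"
        using diff[OF T] frechet_derivative_works by blast
      have Dp: "(\<phi> has_derivative frechet_derivative \<phi> (at x)) (at x)"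
        using test_functions_differentiable(1)[OF \<phi>] frechet_derivative_works by blast
      have "pd i x = partial_deriv i U x" using T by (auto simp: pd_def)
      then have e1: "U x * frechet_derivative \<phi> (at x) (axis i 1) + frechet_derivative U (at x) (axis i 1) * \<phi> x = f x"
        using True by (simp add: f_def partial_deriv_def)
      show ?thesis unfolding V_def
        by (rule exI, rule conjI[OF has_derivative_mult[OF DU Dp] e1])
    qed
    then have "{x. \<not> (\<exists>D. (V has_derivative D) (at x) \<and> D (axis i 1) = f x)} \<subseteq> \<Union>\<T> - (\<Union>T\<in>\<T>. interior T)"
      by blast
    then show "AE x in lebesgue. \<exists>D. (V has_derivative D) (at x) \<and> D (axis i 1) = f x"
      using negligible_skeleton unfolding negligible_iff_null_sets
      by (intro AE_I'[where N="\<Union>\<T> - (\<Union>T\<in>\<T>. interior T)"]) auto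
  qed
  moreover have "integral\<^sup>L lebesgue f = (LINT x|lebesgue_on \<Omega>. U x * ?d x + pd i x * \<phi> x)"
  proof -
    have "f = (\<lambda>x. indicator \<Omega> x *\<^sub>R (U x * ?d x + pd i x * \<phi> x))"
      by (auto simp: f_def indicator_def)
    then show ?thesis by (simp only: integral_restrict_space[of \<Omega> lebesgue] Omega_lebesgue sets.Int_space_eq2)
  qed
  moreover have "integrable (lebesgue_on \<Omega>) (\<lambda>x. U x * ?d x)"
  proof -
    obtain C where C: "\<And>x. \<bar>?d x\<bar> \<le> C" using test_function_measurable_bounded(2)[OF d] by blast
    have "\<bar>U x * ?d x\<bar> \<le> \<bar>B\<bar> * \<bar>C\<bar>" if "x \<in> \<Omega>" for x
    proof -
      have "\<bar>U x\<bar> \<le> \<bar>B\<bar>" using B[of x] subsetD[OF cover that] by linarith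
      moreover have "\<bar>?d x\<bar> \<le> \<bar>C\<bar>" using C[of x] by linarith
      ultimately show ?thesis unfolding abs_mult by (intro mult_mono) auto
    qed
    then show ?thesis
      using U_measurable measurable_restrict_space1[OF test_function_measurable_bounded(1)[OF d]]
      by (intro bounded_in_L2(2)[where B="\<bar>B\<bar> * \<bar>C\<bar>"]) measurable
  qed
  moreover have "integrable (lebesgue_on \<Omega>) (\<lambda>x. pd i x * \<phi> x)"
  proof -
    obtain C where C: "\<And>x. \<bar>\<phi> x\<bar> \<le> C" using test_function_measurable_bounded(2)[OF \<phi>] by blast
    obtain B' where B': "\<And>x. \<bar>pd i x\<bar> \<le> B'" using pd_bounded by blast
    have "\<bar>pd i x * \<phi> x\<bar> \<le> \<bar>B'\<bar> * \<bar>C\<bar>" for x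
      unfolding abs_mult using B'[of x] C[of x] by (intro mult_mono) auto
    then show ?thesis
      using pd_measurable_Omega[of i] measurable_restrict_space1[OF test_function_measurable_bounded(1)[OF \<phi>]]
      by (intro bounded_in_L2(2)[where B="\<bar>B'\<bar> * \<bar>C\<bar>"]) measurable
  qed
  ultimately show "(LINT x|lebesgue_on \<Omega>. U x * iter_partial [i] \<phi> x) =
      (- 1) ^ length [i] * (LINT x|lebesgue_on \<Omega>. pd i x * \<phi> x)"
    by (simp add: iter_partial_def)
qed

end

section \<open>Barycentric coordinates\<close>

lemma sum_four:
  fixes f :: "nat \<Rightarrow> 'a::comm_monoid_add"
  assumes "{i, l, m, n} = {0..3}"
  shows "(\<Sum>k\<in>{0..3}. f k) = f i + (f l + (f m + f n))"
proof -
  have "card {i, l, m, n} = 4" using assms by simp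
  then have d: "i \<noteq> l" "i \<noteq> m" "i \<noteq> n" "l \<noteq> m" "l \<noteq> n" "m \<noteq> n"
    by (auto simp: card_insert_if split: if_splits)
  show ?thesis unfolding assms[symmetric] using d by simp
qed


locale tetrahedron =
  fixes v :: "nat \<Rightarrow> point"
  assumes inj: "inj_on v {0..3}" and indep: "\<not> affine_dependent (v ` {0..3})"
begin

lemma card_vertices: "card (v ` {0..3}) = 4"
  using card_image[OF inj] by simp

lemma affine_hull_vertices: "affine hull (v ` {0..3}) = UNIV"
  by (rule affine_hull_UNIV) (use indep card_vertices in \<open>simp add: affine_independent_iff_card\<close>)

lemma bary_exists: "\<exists>u. (\<forall>k. k \<notin> {0..3} \<longrightarrow> u k = 0) \<and> (\<Sum>k\<in>{0..3}. u k) = 1 \<and>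
             (\<Sum>k\<in>{0..3}. u k *\<^sub>R v k) = x"
proof -
  have "x \<in> affine hull (v ` {0..3})" using affine_hull_vertices by simp
  then obtain w where w: "sum w (v ` {0..3}) = 1" "sum (\<lambda>y. w y *\<^sub>R y) (v ` {0..3}) = x"
    by (auto simp: affine_hull_finite)
  then have "(\<Sum>k\<in>{0..3}. w (v k)) = 1" "(\<Sum>k\<in>{0..3}. w (v k) *\<^sub>R v k) = x"
    by (simp_all add: sum.reindex[OF inj] o_def)
  then show ?thesis
    by (intro exI[where x="\<lambda>k. if k \<in> {0..3} then w (v k) else 0"]) (simp cong: sum.cong_simp)
qed

lemma bary_coefficients_zero:
  assumes "(\<Sum>k\<in>{0..3}. u k) = 0" "(\<Sum>k\<in>{0..3}. u k *\<^sub>R v k) = 0" "k \<in> {0..3}"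
  shows "u k = 0"
proof (rule ccontr)
  assume k: "u k \<noteq> 0"
  define w where "w = (\<lambda>y. u (inv_into {0..3} v y))"
  have w: "w (v k) = u k" if "k \<in> {0..3}" for k using inv_into_f_f[OF inj that] by (simp add: w_def)
  have "sum w (v ` {0..3}) = 0" using assms(1) w by (simp add: sum.reindex[OF inj] o_def cong: sum.cong_simp)
  moreover have "sum (\<lambda>y. w y *\<^sub>R y) (v ` {0..3}) = 0"
    using assms(2) w by (simp add: sum.reindex[OF inj] o_def cong: sum.cong_simp)
  moreover have "v k \<in> v ` {0..3}" "w (v k) \<noteq> 0" using assms(3) k w by auto
  ultimately show False using indep affine_dependent_explicit_finite[of "v ` {0..3}"] by blast
qed

lemma bary_eqI:
  assumes "(\<Sum>k\<in>{0..3}. u k) = 1" "(\<Sum>k\<in>{0..3}. u k *\<^sub>R v k) = x" "k \<in> {0..3}"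
  shows "bary v k x = u k"
proof -
  define u' where "u' = (\<lambda>k. if k \<in> {0..3} then u k else 0)"
  have u': "(\<forall>k. k \<notin> {0..3} \<longrightarrow> u' k = 0) \<and> (\<Sum>k\<in>{0..3}. u' k) = 1 \<and> (\<Sum>k\<in>{0..3}. u' k *\<^sub>R v k) = x"
    using assms by (simp add: u'_def cong: sum.cong_simp)
  have "(THE u. (\<forall>k. k \<notin> {0..3} \<longrightarrow> u k = 0) \<and> (\<Sum>k\<in>{0..3}. u k) = 1 \<and> (\<Sum>k\<in>{0..3}. u k *\<^sub>R v k) = x) = u'"
  proof (rule the_equality)
    show "(\<forall>k. k \<notin> {0..3} \<longrightarrow> u' k = 0) \<and> (\<Sum>k\<in>{0..3}. u' k) = 1 \<and> (\<Sum>k\<in>{0..3}. u' k *\<^sub>R v k) = x" by (rule u')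
  next
    fix w assume w: "(\<forall>k. k \<notin> {0..3} \<longrightarrow> w k = 0) \<and> (\<Sum>k\<in>{0..3}. w k) = 1 \<and> (\<Sum>k\<in>{0..3}. w k *\<^sub>R v k) = x"
    show "w = u'"
    proof
      fix k
      show "w k = u' k"
      proof (cases "k \<in> {0..3}")
        case True
        have s: "(\<Sum>k\<in>{0..3}. w k - u' k) = 0" "(\<Sum>k\<in>{0..3}. (w k - u' k) *\<^sub>R v k) = 0"
          by (simp_all only: sum_subtractf scaleR_diff_left diff_self
              conjunct1[OF conjunct2[OF w]] conjunct2[OF conjunct2[OF w]]
              conjunct1[OF conjunct2[OF u']] conjunct2[OF conjunct2[OF u']])
        have "w k - u' k = 0" by (rule bary_coefficients_zero[OF s True])
        then show ?thesis by simp
      next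
        case False
        then have "w k = 0" using w by blast
        then show ?thesis using False by (simp add: u'_def)
      qed
    qed
  qed
  then show ?thesis using assms(3) unfolding bary_def by (simp add: u'_def)
qed

lemma bary_sum: "(\<Sum>k\<in>{0..3}. bary v k x) = 1"
  and bary_point: "(\<Sum>k\<in>{0..3}. bary v k x *\<^sub>R v k) = x"
proof -
  obtain u where u: "(\<Sum>k\<in>{0..3}. u k) = 1" "(\<Sum>k\<in>{0..3}. u k *\<^sub>R v k) = x"
    using bary_exists[of x] by blast
  have "bary v k x = u k" if "k \<in> {0..3}" for k by (rule bary_eqI[OF u that])
  then show "(\<Sum>k\<in>{0..3}. bary v k x) = 1" "(\<Sum>k\<in>{0..3}. bary v k x *\<^sub>R v k) = x"
    using u by (simp_all cong: sum.cong_simp)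
qed

lemma bary_affine:
  assumes "a + b = 1" "k \<in> {0..3}"
  shows "bary v k (a *\<^sub>R x + b *\<^sub>R y) = a * bary v k x + b * bary v k y"
proof (rule bary_eqI[OF _ _ assms(2)])
  show "(\<Sum>k\<in>{0..3}. a * bary v k x + b * bary v k y) = 1"
    using assms(1) by (simp add: sum.distrib sum_distrib_left[symmetric] bary_sum del: sum_distrib_left)
  have "(\<Sum>k\<in>{0..3}. (a * bary v k x + b * bary v k y) *\<^sub>R v k) =
      a *\<^sub>R (\<Sum>k\<in>{0..3}. bary v k x *\<^sub>R v k) + b *\<^sub>R (\<Sum>k\<in>{0..3}. bary v k y *\<^sub>R v k)"
    by (simp only: sum.distrib scaleR_add_left scaleR_sum_right scaleR_scaleR)
  then show "(\<Sum>k\<in>{0..3}. (a * bary v k x + b * bary v k y) *\<^sub>R v k) = a *\<^sub>R x + b *\<^sub>R y"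
    by (simp only: bary_point)
qed

text \<open>The gradient of \<open>\<lambda>\<^sub>k\<close>.\<close>

definition gl :: "nat \<Rightarrow> point" where
  "gl k = (\<chi> j. bary v k (axis j 1) - bary v k 0)"

lemma bary_linear:
  assumes "k \<in> {0..3}"
  shows "bary v k x = bary v k 0 + gl k \<bullet> x"
proof -
  define L where "L = (\<lambda>x. bary v k x - bary v k 0)"
  have "linear L"
  proof (rule linearI)
    fix x y
    have "bary v k (2 *\<^sub>R ((1/2) *\<^sub>R x + (1/2) *\<^sub>R y) + (-1) *\<^sub>R 0)
        = 2 * ((1/2) * bary v k x + (1/2) * bary v k y) + (-1) * bary v k 0"
      using assms by (simp only: bary_affine)
    then show "L (x + y) = L x + L y" by (simp add: L_def scaleR_add_right)
  next
    fix c x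
    have "bary v k (c *\<^sub>R x + (1 - c) *\<^sub>R 0) = c * bary v k x + (1 - c) * bary v k 0"
      using assms by (intro bary_affine) auto
    then show "L (c *\<^sub>R x) = c *\<^sub>R L x" by (simp add: L_def algebra_simps)
  qed
  have "L x = L (\<Sum>j\<in>UNIV. (x $ j) *\<^sub>R axis j 1)"
    using basis_expansion[of x] by (simp add: scalar_mult_eq_scaleR)
  also have "\<dots> = (\<Sum>j\<in>UNIV. x $ j * L (axis j 1))"
    by (simp add: linear_sum[OF \<open>linear L\<close>] linear_scale[OF \<open>linear L\<close>])
  also have "\<dots> = gl k \<bullet> x"
    by (simp add: gl_def inner_vec_def L_def mult.commute)
  finally show ?thesis by (simp add: L_def)
qed

lemma bary_diff: "k \<in> {0..3} \<Longrightarrow> bary v k y - bary v k x = gl k \<bullet> (y - x)"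
  using bary_linear[of k x] bary_linear[of k y] by (simp add: inner_diff_right)

lemma bary_line: "k \<in> {0..3} \<Longrightarrow> bary v k (x + t *\<^sub>R h) = bary v k x + t * (gl k \<bullet> h)"
  using bary_diff[of k "x + t *\<^sub>R h" x] by simp

lemma bary_has_derivative:
  assumes "k \<in> {0..3}"
  shows "(bary v k has_derivative (\<lambda>h. gl k \<bullet> h)) (at x within S)"
proof -
  have "((\<lambda>x. bary v k 0 + gl k \<bullet> x) has_derivative (\<lambda>h. gl k \<bullet> h)) (at x within S)"
    by (auto intro!: derivative_eq_intros)
  moreover have eq: "bary v k = (\<lambda>x. bary v k 0 + gl k \<bullet> x)" by (rule ext) (rule bary_linear[OF assms])
  ultimately show ?thesis by (subst eq)
qed

lemma bary_GDERIV: "k \<in> {0..3} \<Longrightarrow> GDERIV (bary v k) x :> gl k"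
  using bary_has_derivative[of k x UNIV] by (simp add: gderiv_def inner_commute)

lemma bary_continuous: "k \<in> {0..3} \<Longrightarrow> continuous_on S (bary v k)"
  by (rule has_derivative_continuous_on[where f'="\<lambda>_ h. gl k \<bullet> h"]) (rule bary_has_derivative)

lemma sum_gl: "(\<Sum>k\<in>{0..3}. gl k) = 0"
proof -
  have "(\<Sum>k\<in>{0..3}. gl k) \<bullet> h = 0" for h
  proof -
    have "(\<Sum>k\<in>{0..3}. gl k) \<bullet> h = (\<Sum>k\<in>{0..3}. bary v k (0 + h) - bary v k 0)"
      by (simp add: inner_sum_left bary_diff)
    then show ?thesis by (simp only: sum_subtractf bary_sum)
  qed
  from this[of "\<Sum>k\<in>{0..3}. gl k"] show ?thesis by simp
qed

text \<open>The derivative of the representation of points by barycentric coordinates, in direction \<open>h\<close>.\<close>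

lemma dual_expansion: "(\<Sum>k\<in>{0..3}. (gl k \<bullet> h) *\<^sub>R v k) = h"
proof -
  have "(\<Sum>k\<in>{0..3}. (gl k \<bullet> h) *\<^sub>R v k) = (\<Sum>k\<in>{0..3}. (bary v k (0 + h) - bary v k 0) *\<^sub>R v k)"
    by (rule sum.cong) (simp_all add: bary_diff)
  also have "\<dots> = h" by (simp only: scaleR_diff_left sum_subtractf bary_point) simp
  finally show ?thesis .
qed

lemma bary_vertex: "j \<in> {0..3} \<Longrightarrow> k \<in> {0..3} \<Longrightarrow> bary v k (v j) = (if k = j then 1 else 0)"
proof (rule bary_eqI)
  assume "j \<in> {0..3}"
  then show "(\<Sum>k\<in>{0..3}. if k = j then 1 else 0) = (1::real)" by simp
  show "(\<Sum>k\<in>{0..3}. (if k = j then 1 else 0) *\<^sub>R v k) = v j"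
    using \<open>j \<in> {0..3}\<close> by (simp add: if_distrib[where f="\<lambda>c. c *\<^sub>R _"] cong: if_cong)
qed

lemma tet_iff: "x \<in> tet v \<longleftrightarrow> (\<forall>k\<in>{0..3}. 0 \<le> bary v k x)"
proof
  assume "x \<in> tet v"
  then obtain w where w: "\<forall>y\<in>v ` {0..3}. 0 \<le> w y" "sum w (v ` {0..3}) = 1" "sum (\<lambda>y. w y *\<^sub>R y) (v ` {0..3}) = x"
    unfolding tet_def by (auto simp: convex_hull_finite)
  then have "bary v k x = w (v k)" if "k \<in> {0..3}" for k
    using that by (intro bary_eqI) (simp_all add: sum.reindex[OF inj] o_def)
  then show "\<forall>k\<in>{0..3}. 0 \<le> bary v k x" using w(1) by auto
next
  assume "\<forall>k\<in>{0..3}. 0 \<le> bary v k x"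
  then have "(\<Sum>k\<in>{0..3}. bary v k x *\<^sub>R v k) \<in> tet v"
    unfolding tet_def by (intro convex_sum) (auto simp: bary_sum intro: hull_inc)
  then show "x \<in> tet v" by (simp only: bary_point)
qed

lemma interior_iff: "x \<in> interior (tet v) \<longleftrightarrow> (\<forall>k\<in>{0..3}. 0 < bary v k x)"
proof -
  have eq: "interior (tet v) = {y. \<exists>u. (\<forall>x \<in> v ` {0..3}. 0 < u x) \<and> sum u (v ` {0..3}) = 1 \<and> (\<Sum>x\<in>v ` {0..3}. u x *\<^sub>R x) = y}"
    unfolding tet_def interior_convex_hull_explicit_minimal[OF indep] card_vertices by simp
  show ?thesis
  proof
    assume "x \<in> interior (tet v)"
    then obtain w where w: "\<forall>y\<in>v ` {0..3}. 0 < w y" "sum w (v ` {0..3}) = 1" "sum (\<lambda>y. w y *\<^sub>R y) (v ` {0..3}) = x"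
      unfolding eq by blast
    then have "bary v k x = w (v k)" if "k \<in> {0..3}" for k
      using that by (intro bary_eqI) (simp_all add: sum.reindex[OF inj] o_def)
    then show "\<forall>k\<in>{0..3}. 0 < bary v k x" using w(1) by auto
  next
    assume pos: "\<forall>k\<in>{0..3}. 0 < bary v k x"
    define w where "w = (\<lambda>y. bary v (inv_into {0..3} v y) x)"
    have w: "w (v k) = bary v k x" if "k \<in> {0..3}" for k using inv_into_f_f[OF inj that] by (simp add: w_def)
    have "sum w (v ` {0..3}) = 1" using bary_sum[of x] w by (simp add: sum.reindex[OF inj] o_def cong: sum.cong_simp)
    moreover have "sum (\<lambda>y. w y *\<^sub>R y) (v ` {0..3}) = x"
      using bary_point[of x] w by (simp add: sum.reindex[OF inj] o_def cong: sum.cong_simp)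
    moreover have "\<forall>y\<in>v ` {0..3}. 0 < w y" using pos w by auto
    ultimately show "x \<in> interior (tet v)" unfolding eq by blast
  qed
qed

lemma tet_compact: "compact (tet v)" and tet_convex: "convex (tet v)" and tet_closed: "closed (tet v)"
proof -
  show c: "compact (tet v)" unfolding tet_def by (intro compact_convex_hull finite_imp_compact) simp
  show "convex (tet v)" unfolding tet_def by (rule convex_convex_hull)
  show "closed (tet v)" using c by (rule compact_imp_closed)
qed

definition centroid :: point where "centroid = (\<Sum>k\<in>{0..3}. (1/4) *\<^sub>R v k)"

lemma bary_centroid: "k \<in> {0..3} \<Longrightarrow> bary v k centroid = 1/4"
  by (rule bary_eqI[where u="\<lambda>k. 1/4"]) (auto simp: centroid_def)

lemma centroid_interior: "centroid \<in> interior (tet v)"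
  by (simp add: interior_iff bary_centroid)

lemma closure_interior: "closure (interior (tet v)) = tet v"
  using convex_closure_interior[OF tet_convex] centroid_interior closure_closed[OF tet_closed] by blast

lemma segment_interior:
  assumes "x \<in> tet v" "y \<in> interior (tet v)" "0 < t" "t \<le> 1"
  shows "x + t *\<^sub>R (y - x) \<in> interior (tet v)"
  unfolding interior_iff
proof
  fix k :: nat assume k: "k \<in> {0..3}"
  have "x + t *\<^sub>R (y - x) = (1 - t) *\<^sub>R x + t *\<^sub>R y" by (simp add: algebra_simps)
  then have "bary v k (x + t *\<^sub>R (y - x)) = (1 - t) * bary v k x + t * bary v k y"
    using bary_affine[of "1 - t" t k x y] k by simp
  moreover have "(1 - t) * bary v k x \<ge> 0" using assms k by (auto simp: tet_iff)
  moreover have "t * bary v k y > 0" using assms k by (auto simp: interior_iff)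
  ultimately show "0 < bary v k (x + t *\<^sub>R (y - x))" by linarith
qed

lemma bary_le_one:
  assumes "x \<in> tet v" "k \<in> {0..3}"
  shows "bary v k x \<le> 1"
proof -
  have "bary v k x \<le> (\<Sum>k\<in>{0..3}. bary v k x)"
    by (rule member_le_sum) (use assms in \<open>auto simp: tet_iff\<close>)
  then show ?thesis by (simp add: bary_sum)
qed

lemma gl_nonzero: assumes "k \<in> {0..3}" shows "gl k \<noteq> 0"
proof
  assume z: "gl k = 0"
  define j where "j = (if k = 0 then 1 else 0 :: nat)"
  have "j \<in> {0..3}" "j \<noteq> k" by (auto simp: j_def)
  then show False using bary_diff[OF assms, of "v k" "v j"] z assms by (simp add: bary_vertex)
qed


text \<open>In the expansion of a vector along the differences \<open>v k - v p\<close>, only the coefficient of \<open>v i - v p\<close>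
  contributes to the inner product with \<open>\<nu>\<close>.\<close>

lemma orthogonal_to_face:
  assumes i: "i \<in> {0..3}" and p: "p \<in> {0..3} - {i}"
    and orth: "\<And>k. k \<in> {0..3} - {i} \<Longrightarrow> \<nu> \<bullet> (v k - v p) = 0"
  shows "\<nu> = (\<nu> \<bullet> (v i - v p)) *\<^sub>R gl i"
proof -
  have "\<nu> \<bullet> h = ((\<nu> \<bullet> (v i - v p)) *\<^sub>R gl i) \<bullet> h" for h
  proof -
    have "h = (\<Sum>k\<in>{0..3}. (gl k \<bullet> h) *\<^sub>R (v k - v p))"
      using dual_expansion[of h] sum_gl
      by (simp add: scaleR_diff_right sum_subtractf scaleR_sum_left[symmetric] inner_sum_left[symmetric])
    then have "\<nu> \<bullet> h = (\<Sum>k\<in>{0..3}. (gl k \<bullet> h) * (\<nu> \<bullet> (v k - v p)))"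
      by (metis (no_types, lifting) inner_scaleR_right inner_sum_right sum.cong)
    also have "\<dots> = (\<Sum>k\<in>{i}. (gl k \<bullet> h) * (\<nu> \<bullet> (v k - v p)))"
      by (rule sum.mono_neutral_right) (use i orth in auto)
    finally show ?thesis by simp
  qed
  then have "\<forall>h. \<nu> \<bullet> h = ((\<nu> \<bullet> (v i - v p)) *\<^sub>R gl i) \<bullet> h" by (rule allI)
  then show ?thesis by (rule vector_eq_rdot[THEN iffD1])
qed

lemma vertex_in_tet: "j \<in> {0..3} \<Longrightarrow> v j \<in> tet v"
  by (auto simp: tet_iff bary_vertex)

lemma vertex_in_face: "j \<in> {0..3} \<Longrightarrow> i \<in> {0..3} \<Longrightarrow> j \<noteq> i \<Longrightarrow> v j \<in> face v i"
  by (simp add: face_def vertex_in_tet bary_vertex)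

lemma outer_normal_eq:
  assumes i: "i \<in> {0..3}"
  shows "outer_normal v i = - (1 / norm (gl i)) *\<^sub>R gl i"
proof -
  let ?\<nu> = "- (1 / norm (gl i)) *\<^sub>R gl i"
  have g: "norm (gl i) > 0" using gl_nonzero[OF i] by simp
  define p where "p = (if i = 0 then 1 else 0 :: nat)"
  have p: "p \<in> {0..3} - {i}" by (auto simp: p_def)
  show ?thesis unfolding outer_normal_def
  proof (rule the_equality)
    have "?\<nu> \<bullet> (x - y) = - (1 / norm (gl i)) * (bary v i x - bary v i y)" for x y
      using bary_diff[OF i, of x y] by simp
    then show "norm ?\<nu> = 1 \<and> (\<forall>x\<in>face v i. \<forall>y\<in>face v i. ?\<nu> \<bullet> (x - y) = 0) \<and> (\<forall>x\<in>face v i. ?\<nu> \<bullet> (v i - x) < 0)"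
      using g i by (auto simp: face_def bary_vertex)
  next
    fix \<nu> :: point
    assume \<nu>: "norm \<nu> = 1 \<and> (\<forall>x\<in>face v i. \<forall>y\<in>face v i. \<nu> \<bullet> (x - y) = 0) \<and> (\<forall>x\<in>face v i. \<nu> \<bullet> (v i - x) < 0)"
    define c where "c = \<nu> \<bullet> (v i - v p)"
    have eq: "\<nu> = c *\<^sub>R gl i" unfolding c_def
      by (rule orthogonal_to_face[OF i p]) (use \<nu> p i vertex_in_face in auto)
    have "c < 0" using \<nu> p i vertex_in_face unfolding c_def by auto
    moreover have "\<bar>c\<bar> * norm (gl i) = 1" using \<nu> eq by (metis norm_scaleR)
    ultimately have "c = - (1 / norm (gl i))" using g by (simp add: field_simps)
    then show "\<nu> = ?\<nu>" using eq by simp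
  qed
qed

lemma grad_eqI:
  assumes "GDERIV f x :> D" shows "grad f x = D"
  unfolding grad_def
proof (rule the_equality[where P="\<lambda>D. GDERIV f x :> D", OF assms])
  fix D' assume "GDERIV f x :> D'"
  then have "(\<lambda>h. h \<bullet> D') = (\<lambda>h. h \<bullet> D)"
    using assms unfolding gderiv_def by (rule has_derivative_unique)
  then have "\<forall>h. h \<bullet> D' = h \<bullet> D" by (simp add: fun_eq_iff)
  then show "D' = D" by (rule vector_eq_ldot[THEN iffD1])
qed

lemma dcoef_eq: "i \<in> {0..3} \<Longrightarrow> dcoef v i i = - norm (gl i)"
  using grad_eqI[OF bary_GDERIV, of i] gl_nonzero[of i]
  by (simp add: dcoef_def outer_normal_eq dot_square_norm power2_eq_square)

lemma dcoef_nonzero: "i \<in> {0..3} \<Longrightarrow> dcoef v i i \<noteq> 0"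
  using gl_nonzero by (simp add: dcoef_eq)

end

section \<open>Functions with controlled singularities\<close>

text \<open>Here \<open>f'\<close> and \<open>f''\<close> are the derivatives of \<open>f\<close> on \<open>I\<close>. On the part \<open>D\<close> the function behaves like one of size
  \<open>m\<close> that varies on the length scale \<open>\<delta>\<close>: each derivative costs at most a factor \<open>1 / \<delta>\<close>. The estimates may
  degenerate where \<open>\<delta>\<close> tends to 0, which is how the singular functions below are controlled.\<close>

definition symbol_data where
  "symbol_data I D \<delta> m f f' f'' C \<longleftrightarrow>
     (\<forall>x\<in>I. (f has_derivative f' x) (at x)) \<and>
     (\<forall>x\<in>I. \<forall>h. ((\<lambda>y. f' y h) has_derivative f'' x h) (at x)) \<and> 0 \<le> C \<and>
     (\<forall>x\<in>D. \<bar>f x\<bar> \<le> C * m x) \<and> (\<forall>x\<in>D. \<forall>h. \<bar>f' x h\<bar> \<le> C * (m x / \<delta> x) * norm h) \<and>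
     (\<forall>x\<in>D. \<forall>h k. \<bar>f'' x h k\<bar> \<le> C * (m x / (\<delta> x)\<^sup>2) * (norm h * norm k))"
  for I D :: "point set" and \<delta> m f :: "point \<Rightarrow> real"

definition symbol ::
  "point set \<Rightarrow> point set \<Rightarrow> (point \<Rightarrow> real) \<Rightarrow> (point \<Rightarrow> real) \<Rightarrow> (point \<Rightarrow> real) \<Rightarrow> bool" where
  "symbol I D \<delta> m f \<longleftrightarrow> (\<exists>f' f'' C. symbol_data I D \<delta> m f f' f'' C)"

lemma symbolI:
  assumes "\<And>x. x \<in> I \<Longrightarrow> (f has_derivative f' x) (at x)"
    and "\<And>x h. x \<in> I \<Longrightarrow> ((\<lambda>y. f' y h) has_derivative f'' x h) (at x)"
    and "0 \<le> C"
    and "\<And>x. x \<in> D \<Longrightarrow> \<bar>f x\<bar> \<le> C * m x"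
    and "\<And>x h. x \<in> D \<Longrightarrow> \<bar>f' x h\<bar> \<le> C * (m x / \<delta> x) * norm h"
    and "\<And>x h k. x \<in> D \<Longrightarrow> \<bar>f'' x h k\<bar> \<le> C * (m x / (\<delta> x)\<^sup>2) * (norm h * norm k)"
  shows "symbol I D \<delta> m f"
proof -
  have "symbol_data I D \<delta> m f f' f'' C"
    unfolding symbol_data_def
  proof (intro conjI ballI allI)
    show "(f has_derivative f' x) (at x)" if "x \<in> I" for x by (rule assms(1)[OF that])
    show "((\<lambda>y. f' y h) has_derivative f'' x h) (at x)" if "x \<in> I" for x h by (rule assms(2)[OF that])
    show "0 \<le> C" by (rule assms(3))
    show "\<bar>f x\<bar> \<le> C * m x" if "x \<in> D" for x by (rule assms(4)[OF that])
    show "\<bar>f' x h\<bar> \<le> C * (m x / \<delta> x) * norm h" if "x \<in> D" for x h by (rule assms(5)[OF that])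
    show "\<bar>f'' x h k\<bar> \<le> C * (m x / (\<delta> x)\<^sup>2) * (norm h * norm k)" if "x \<in> D" for x h k
      by (rule assms(6)[OF that])
  qed
  then show ?thesis unfolding symbol_def by (intro exI)
qed

lemma symbol_dataD:
  assumes "symbol_data I D \<delta> m f f' f'' C"
  shows
    "\<And>x. x \<in> I \<Longrightarrow> (f has_derivative f' x) (at x)"
    "\<And>x h. x \<in> I \<Longrightarrow> ((\<lambda>y. f' y h) has_derivative f'' x h) (at x)"
    "0 \<le> C"
    "\<And>x. x \<in> D \<Longrightarrow> \<bar>f x\<bar> \<le> C * m x"
    "\<And>x h. x \<in> D \<Longrightarrow> \<bar>f' x h\<bar> \<le> C * (m x / \<delta> x) * norm h"
    "\<And>x h k. x \<in> D \<Longrightarrow> \<bar>f'' x h k\<bar> \<le> C * (m x / (\<delta> x)\<^sup>2) * (norm h * norm k)"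
proof -
  note a = assms[unfolded symbol_data_def]
  note a1 = conjunct1[OF a] and a2 = conjunct2[OF a]
  note b1 = conjunct1[OF a2] and b2 = conjunct2[OF a2]
  note c1 = conjunct1[OF b2] and c2 = conjunct2[OF b2]
  note d1 = conjunct1[OF c2] and d2 = conjunct2[OF c2]
  show "(f has_derivative f' x) (at x)" if "x \<in> I" for x by (rule bspec[OF a1 that])
  show "((\<lambda>y. f' y h) has_derivative f'' x h) (at x)" if "x \<in> I" for x h
    by (rule spec[OF bspec[OF b1 that]])
  show "0 \<le> C" by (rule c1)
  show "\<bar>f x\<bar> \<le> C * m x" if "x \<in> D" for x by (rule bspec[OF d1 that])
  show "\<bar>f' x h\<bar> \<le> C * (m x / \<delta> x) * norm h" if "x \<in> D" for x h
    by (rule spec[OF bspec[OF conjunct1[OF d2] that]])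
  show "\<bar>f'' x h k\<bar> \<le> C * (m x / (\<delta> x)\<^sup>2) * (norm h * norm k)" if "x \<in> D" for x h k
    by (rule spec[OF spec[OF bspec[OF conjunct2[OF d2] that]]])
qed

lemma symbolE:
  assumes "symbol I D \<delta> m f"
  obtains f' f'' C where "symbol_data I D \<delta> m f f' f'' C"
  using assms unfolding symbol_def by (elim exE)

lemma symbol_const: "(\<And>x. x \<in> D \<Longrightarrow> m x = 1) \<Longrightarrow> (\<And>x. x \<in> D \<Longrightarrow> 0 < \<delta> x) \<Longrightarrow> symbol I D \<delta> m (\<lambda>x. c)"
  by (rule symbolI[where f'="\<lambda>_ _. 0" and f''="\<lambda>_ _ _. 0" and C="\<bar>c\<bar>"]) (auto simp: less_imp_le)

text \<open>By Leibniz' rule each derivative costs a factor \<open>1 / \<delta>\<close>, whichever factor it hits.\<close>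

lemma symbol_mult:
  assumes f: "symbol I D \<delta> m f" and g: "symbol I D \<delta> k g" and \<delta>: "\<And>x. x \<in> D \<Longrightarrow> 0 < \<delta> x"
  shows "symbol I D \<delta> (\<lambda>x. m x * k x) (\<lambda>x. f x * g x)"
proof -
  obtain f' f'' C where fD: "symbol_data I D \<delta> m f f' f'' C"
    using f by (rule symbolE)
  note f = symbol_dataD[OF fD]
  obtain g' g'' B where gD: "symbol_data I D \<delta> k g g' g'' B"
    using g by (rule symbolE)
  note g = symbol_dataD[OF gD]
  show ?thesis
  proof (rule symbolI[where f'="\<lambda>x h. f x * g' x h + f' x h * g x" and C="4 * (C * B)" and
        f''="\<lambda>x h j. (f x * g'' x h j + f' x j * g' x h) + (f' x h * g' x j + f'' x h j * g x)"])
    fix x assume x: "x \<in> I"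
    show "((\<lambda>x. f x * g x) has_derivative (\<lambda>h. f x * g' x h + f' x h * g x)) (at x)"
      by (rule has_derivative_mult[OF f(1)[OF x] g(1)[OF x]])
    fix h
    show "((\<lambda>y. f y * g' y h + f' y h * g y) has_derivative
        (\<lambda>j. (f x * g'' x h j + f' x j * g' x h) + (f' x h * g' x j + f'' x h j * g x))) (at x)"
      by (intro has_derivative_add has_derivative_mult f(1,2) g(1,2) x)
  next
    show "0 \<le> 4 * (C * B)" using f(3) g(3) by simp
  next
    fix x assume x: "x \<in> D"
    note d = \<delta>[OF x]
    have f4: "\<bar>f x\<bar> \<le> C * m x" and g4: "\<bar>g x\<bar> \<le> B * k x" using f(4) g(4) x by auto
    have n: "0 \<le> C * m x" "0 \<le> B * k x" using f4 g4 by linarith+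
    have n': "0 \<le> C * (m x / \<delta> x) * norm h" "0 \<le> B * (k x / \<delta> x) * norm h" 
      "0 \<le> C * (m x / (\<delta> x)\<^sup>2) * (norm h * norm j)" "0 \<le> B * (k x / (\<delta> x)\<^sup>2) * (norm h * norm j)" for h j :: point
    proof -
      have "C * (m x / \<delta> x) * norm h = (C * m x) * (norm h / \<delta> x)"
        "B * (k x / \<delta> x) * norm h = (B * k x) * (norm h / \<delta> x)"
        "C * (m x / (\<delta> x)\<^sup>2) * (norm h * norm j) = (C * m x) * (norm h * norm j / (\<delta> x)\<^sup>2)"
        "B * (k x / (\<delta> x)\<^sup>2) * (norm h * norm j) = (B * k x) * (norm h * norm j / (\<delta> x)\<^sup>2)"
        by simp_all
      then show "0 \<le> C * (m x / \<delta> x) * norm h" "0 \<le> B * (k x / \<delta> x) * norm h" 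
        "0 \<le> C * (m x / (\<delta> x)\<^sup>2) * (norm h * norm j)" "0 \<le> B * (k x / (\<delta> x)\<^sup>2) * (norm h * norm j)"
        using n d by (simp_all only: mult_nonneg_nonneg divide_nonneg_pos norm_ge_zero zero_less_power)
    qed
    have fg: "\<bar>f x * g x\<bar> \<le> (C * m x) * (B * k x)"
      unfolding abs_mult by (rule mult_mono[OF f4 g4 n(1)]) simp
    show "\<bar>f x * g x\<bar> \<le> 4 * (C * B) * (m x * k x)"
      using fg mult_nonneg_nonneg[OF n] by (simp add: mult_ac)
    fix h :: point
    have 1: "\<bar>f x * g' x h\<bar> \<le> (C * m x) * (B * (k x / \<delta> x) * norm h)"
      unfolding abs_mult by (rule mult_mono[OF f4 g(5)[OF x] n(1)]) simp
    have 2: "\<bar>f' x h * g x\<bar> \<le> (C * (m x / \<delta> x) * norm h) * (B * k x)"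
      unfolding abs_mult by (rule mult_mono[OF f(5)[OF x] g4 n'(1)]) simp
    have e: "(C * m x) * (B * (k x / \<delta> x) * norm h) = C * B * (m x * k x / \<delta> x) * norm h"
      "(C * (m x / \<delta> x) * norm h) * (B * k x) = C * B * (m x * k x / \<delta> x) * norm h" by simp_all
    have z: "0 \<le> C * B * (m x * k x / \<delta> x) * norm h"
      using mult_nonneg_nonneg[OF n(1) n'(2)[of h]] unfolding e .
    show "\<bar>f x * g' x h + f' x h * g x\<bar> \<le> 4 * (C * B) * (m x * k x / \<delta> x) * norm h"
      using abs_triangle_ineq[of "f x * g' x h" "f' x h * g x"] 1 2 z unfolding e by linarith
    fix j :: point
    define E where "E = C * B * (m x * k x / (\<delta> x)\<^sup>2) * (norm h * norm j)"
    have 1: "\<bar>f x * g'' x h j\<bar> \<le> (C * m x) * (B * (k x / (\<delta> x)\<^sup>2) * (norm h * norm j))"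
      unfolding abs_mult by (rule mult_mono[OF f4 g(6)[OF x] n(1)]) simp
    have 2: "\<bar>f'' x h j * g x\<bar> \<le> (C * (m x / (\<delta> x)\<^sup>2) * (norm h * norm j)) * (B * k x)"
      unfolding abs_mult by (rule mult_mono[OF f(6)[OF x] g4 n'(3)]) simp
    have 3: "\<bar>f' x j * g' x h\<bar> \<le> (C * (m x / \<delta> x) * norm j) * (B * (k x / \<delta> x) * norm h)"
      unfolding abs_mult by (rule mult_mono[OF f(5)[OF x] g(5)[OF x] n'(1)]) simp
    have 4: "\<bar>f' x h * g' x j\<bar> \<le> (C * (m x / \<delta> x) * norm h) * (B * (k x / \<delta> x) * norm j)"
      unfolding abs_mult by (rule mult_mono[OF f(5)[OF x] g(5)[OF x] n'(1)]) simp
    have e: "(C * m x) * (B * (k x / (\<delta> x)\<^sup>2) * (norm h * norm j)) = E"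
      "(C * (m x / (\<delta> x)\<^sup>2) * (norm h * norm j)) * (B * k x) = E"
      "(C * (m x / \<delta> x) * norm j) * (B * (k x / \<delta> x) * norm h) = E"
      "(C * (m x / \<delta> x) * norm h) * (B * (k x / \<delta> x) * norm j) = E"
      by (simp_all add: E_def power2_eq_square)
    have "\<bar>(f x * g'' x h j + f' x j * g' x h) + (f' x h * g' x j + f'' x h j * g x)\<bar> \<le> 4 * E"
      using 1 2 3 4 unfolding e by linarith
    then show "\<bar>(f x * g'' x h j + f' x j * g' x h) + (f' x h * g' x j + f'' x h j * g x)\<bar>
       \<le> 4 * (C * B) * (m x * k x / (\<delta> x)\<^sup>2) * (norm h * norm j)"
      by (simp add: E_def)
  qed
qed

lemma symbol_add:
  assumes f: "symbol I D \<delta> m f" and g: "symbol I D \<delta> m g"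
  shows "symbol I D \<delta> m (\<lambda>x. f x + g x)"
proof -
  obtain f' f'' C where fD: "symbol_data I D \<delta> m f f' f'' C"
    using f by (rule symbolE)
  note f = symbol_dataD[OF fD]
  obtain g' g'' B where gD: "symbol_data I D \<delta> m g g' g'' B"
    using g by (rule symbolE)
  note g = symbol_dataD[OF gD]
  show ?thesis
  proof (rule symbolI[where f'="\<lambda>x h. f' x h + g' x h" and C="C + B" and f''="\<lambda>x h j. f'' x h j + g'' x h j"])
    fix x assume x: "x \<in> I"
    show "((\<lambda>x. f x + g x) has_derivative (\<lambda>h. f' x h + g' x h)) (at x)"
      by (rule has_derivative_add[OF f(1)[OF x] g(1)[OF x]])
    show "((\<lambda>y. f' y h + g' y h) has_derivative (\<lambda>j. f'' x h j + g'' x h j)) (at x)" for h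
      by (rule has_derivative_add[OF f(2)[OF x] g(2)[OF x]])
  next
    show "0 \<le> C + B" using f(3) g(3) by simp
  next
    fix x assume x: "x \<in> D"
    show "\<bar>f x + g x\<bar> \<le> (C + B) * m x"
      using f(4)[OF x] g(4)[OF x] unfolding distrib_right by linarith
    show "\<bar>f' x h + g' x h\<bar> \<le> (C + B) * (m x / \<delta> x) * norm h" for h
      using f(5)[OF x, of h] g(5)[OF x, of h] unfolding distrib_right by linarith
    show "\<bar>f'' x h j + g'' x h j\<bar> \<le> (C + B) * (m x / (\<delta> x)\<^sup>2) * (norm h * norm j)" for h j
      using f(6)[OF x, of h j] g(6)[OF x, of h j] unfolding distrib_right by linarith
  qed
qed

lemma symbol_mono:
  assumes f: "symbol I D \<delta> m f" and m: "\<And>x. x \<in> D \<Longrightarrow> m x \<le> k x" and \<delta>: "\<And>x. x \<in> D \<Longrightarrow> 0 < \<delta> x"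
  shows "symbol I D \<delta> k f"
proof -
  obtain f' f'' C where fD: "symbol_data I D \<delta> m f f' f'' C"
    using f by (rule symbolE)
  note f = symbol_dataD[OF fD]
  show ?thesis
  proof (rule symbolI[where f'=f' and C=C and f''=f'', OF f(1,2,3)])
    fix x assume x: "x \<in> D"
    show "\<bar>f x\<bar> \<le> C * k x"
      using f(4)[OF x] mult_left_mono[OF m[OF x] f(3)] by linarith
    have "C * (m x / \<delta> x) \<le> C * (k x / \<delta> x)" "C * (m x / (\<delta> x)\<^sup>2) \<le> C * (k x / (\<delta> x)\<^sup>2)"
      using \<delta>[OF x] m[OF x] f(3) by (intro mult_left_mono divide_right_mono; simp)+
    note e = mult_right_mono[OF this(1) norm_ge_zero] mult_right_mono[OF this(2) mult_nonneg_nonneg[OF norm_ge_zero norm_ge_zero]]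
    show "\<bar>f' x h\<bar> \<le> C * (k x / \<delta> x) * norm h" for h
      using f(5)[OF x, of h] e(1)[of h] by linarith
    show "\<bar>f'' x h j\<bar> \<le> C * (k x / (\<delta> x)\<^sup>2) * (norm h * norm j)" for h j
      using f(6)[OF x, of h j] e(2)[of h j] by linarith
  qed
qed

lemma symbol_cong:
  assumes f: "symbol I D \<delta> m f" and I: "open I" "D \<subseteq> I" and eq: "\<And>x. x \<in> I \<Longrightarrow> f x = g x"
  shows "symbol I D \<delta> m g"
proof -
  obtain f' f'' C where fD: "symbol_data I D \<delta> m f f' f'' C"
    using f by (rule symbolE)
  note f = symbol_dataD[OF fD]
  show ?thesis
  proof (rule symbolI[where f'=f' and C=C and f''=f'', OF _ f(2,3)])
    fix x assume "x \<in> I"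
    then show "(g has_derivative f' x) (at x)"
      using has_derivative_transform_within_open[OF f(1) I(1)] eq by simp
  next
    fix x assume "x \<in> D" then show "\<bar>g x\<bar> \<le> C * m x" using f(4) eq I(2) by (metis subsetD)
  qed (use f(5,6) in auto)
qed

lemma symbol_affine:
  assumes d: "\<And>x. (f has_derivative (\<lambda>h. a \<bullet> h)) (at x)"
    and m: "\<And>x. x \<in> D \<Longrightarrow> \<bar>f x\<bar> \<le> m x" "\<And>x. x \<in> D \<Longrightarrow> \<delta> x \<le> m x"
    and \<delta>: "\<And>x. x \<in> D \<Longrightarrow> 0 < \<delta> x"
  shows "symbol I D \<delta> m f"
proof (rule symbolI[where f'="\<lambda>x h. a \<bullet> h" and f''="\<lambda>_ _ _. 0" and C="1 + norm a"])
  fix x assume x: "x \<in> D"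
  have m0: "0 \<le> m x" using m(1)[OF x] by linarith
  then have "1 * m x \<le> (1 + norm a) * m x" by (intro mult_right_mono) auto
  then show "\<bar>f x\<bar> \<le> (1 + norm a) * m x" using m(1)[OF x] by linarith
  have "1 \<le> m x / \<delta> x" using m(2)[OF x] \<delta>[OF x] by simp
  then have "norm a * 1 \<le> (1 + norm a) * (m x / \<delta> x)" by (intro mult_mono) auto
  then have "norm a * norm h \<le> (1 + norm a) * (m x / \<delta> x) * norm h" for h by (intro mult_right_mono) auto
  then show "\<bar>a \<bullet> h\<bar> \<le> (1 + norm a) * (m x / \<delta> x) * norm h" for h
    using Cauchy_Schwarz_ineq2[of a h] order_trans by blast
  show "\<bar>0\<bar> \<le> (1 + norm a) * (m x / (\<delta> x)\<^sup>2) * (norm h * norm k)" for h k :: point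
    using m0 by simp
qed (use d in auto)

text \<open>A derivative of \<open>1 / s\<close> costs a factor \<open>1 / s\<close>, hence at most \<open>1 / \<delta>\<close>.\<close>

lemma symbol_inverse_affine:
  assumes d: "\<And>x. (s has_derivative (\<lambda>h. a \<bullet> h)) (at x)"
    and pos: "\<And>x. x \<in> I \<Longrightarrow> 0 < s x" and DI: "D \<subseteq> I"
    and \<delta>: "\<And>x. x \<in> D \<Longrightarrow> 0 < \<delta> x" "\<And>x. x \<in> D \<Longrightarrow> \<delta> x \<le> s x"
  shows "symbol I D \<delta> (\<lambda>x. 1 / s x) (\<lambda>x. 1 / s x)"
proof (rule symbolI[where f'="\<lambda>x h. - (a \<bullet> h) / (s x)\<^sup>2" and f''="\<lambda>x h k. 2 * (a \<bullet> h) * (a \<bullet> k) / (s x) ^ 3"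
      and C="1 + norm a + 2 * (norm a)\<^sup>2"])
  fix x assume x: "x \<in> I"
  have s: "s x \<noteq> 0" using pos[OF x] by simp
  show "((\<lambda>x. 1 / s x) has_derivative (\<lambda>h. - (a \<bullet> h) / (s x)\<^sup>2)) (at x)"
    by (rule has_derivative_eq_rhs[OF has_derivative_divide[OF has_derivative_const d s]])
      (use s in \<open>auto simp: divide_simps power2_eq_square\<close>)
  fix h
  have "((\<lambda>y. - (a \<bullet> h) / (s y * s y)) has_derivative
      (\<lambda>k. 2 * (a \<bullet> h) * (a \<bullet> k) / (s x) ^ 3)) (at x)"
    by (rule has_derivative_eq_rhs[OF has_derivative_divide[OF has_derivative_const has_derivative_mult[OF d d]]])
      (use s in \<open>auto simp: divide_simps power2_eq_square power3_eq_cube\<close>)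
  then show "((\<lambda>y. - (a \<bullet> h) / (s y)\<^sup>2) has_derivative (\<lambda>k. 2 * (a \<bullet> h) * (a \<bullet> k) / (s x) ^ 3)) (at x)"
    by (simp add: power2_eq_square)
next
  show "0 \<le> 1 + norm a + 2 * (norm a)\<^sup>2" by simp
next
  fix x assume x: "x \<in> D"
  have s: "0 < s x" using pos DI x by blast
  note dx = \<delta>(1)[OF x] and ds = \<delta>(2)[OF x]
  let ?C = "1 + norm a + 2 * (norm a)\<^sup>2"
  have C: "1 \<le> ?C" "norm a \<le> ?C" "2 * (norm a)\<^sup>2 \<le> ?C" by simp_all
  show "\<bar>1 / s x\<bar> \<le> ?C * (1 / s x)"
    using mult_right_mono[OF C(1), of "1 / s x"] s by simp
  fix h :: point
  have ah: "\<bar>a \<bullet> h\<bar> \<le> norm a * norm h" by (rule Cauchy_Schwarz_ineq2)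
  have "\<bar>- (a \<bullet> h) / (s x)\<^sup>2\<bar> = \<bar>a \<bullet> h\<bar> * (1 / s x) * (1 / s x)"
    using s by (simp add: power2_eq_square abs_mult)
  also have "\<dots> \<le> (norm a * norm h) * (1 / s x) * (1 / \<delta> x)"
    using s dx ds ah by (intro mult_mono divide_left_mono) auto
  also have "\<dots> = norm a * ((1 / s x / \<delta> x) * norm h)" by simp
  also have "\<dots> \<le> ?C * ((1 / s x / \<delta> x) * norm h)"
    using s dx by (intro mult_right_mono[OF C(2)]) simp
  finally show "\<bar>- (a \<bullet> h) / (s x)\<^sup>2\<bar> \<le> ?C * (1 / s x / \<delta> x) * norm h" by (simp only: mult.assoc)
  fix k :: point
  have ak: "\<bar>a \<bullet> k\<bar> \<le> norm a * norm k" by (rule Cauchy_Schwarz_ineq2)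
  have "\<bar>2 * (a \<bullet> h) * (a \<bullet> k) / (s x) ^ 3\<bar> = 2 * \<bar>a \<bullet> h\<bar> * \<bar>a \<bullet> k\<bar> * (1 / s x) * (1 / s x) * (1 / s x)"
    using s by (simp add: power3_eq_cube abs_mult)
  also have "\<dots> \<le> 2 * (norm a * norm h) * (norm a * norm k) * (1 / s x) * (1 / \<delta> x) * (1 / \<delta> x)"
    using s dx ds ah ak by (intro mult_mono divide_left_mono) auto
  also have "\<dots> = (2 * (norm a)\<^sup>2) * ((1 / s x / (\<delta> x)\<^sup>2) * (norm h * norm k))" 
    by (simp add: power2_eq_square mult_ac)
  also have "\<dots> \<le> ?C * ((1 / s x / (\<delta> x)\<^sup>2) * (norm h * norm k))"
    using s dx by (intro mult_right_mono[OF C(3)]) simp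
  finally show "\<bar>2 * (a \<bullet> h) * (a \<bullet> k) / (s x) ^ 3\<bar> \<le> ?C * (1 / s x / (\<delta> x)\<^sup>2) * (norm h * norm k)"
    by (simp only: mult.assoc)
qed

text \<open>A symbol of size \<open>\<delta>\<^sup>2\<close> has bounded second derivatives, however small \<open>\<delta>\<close> becomes. As derivatives are
  unique, the estimates on the parts are estimates for the same derivatives.\<close>

lemma symbol_glue:
  assumes fin: "finite V" and ne: "V \<noteq> {}" and I: "open I" "I = (\<Union>p\<in>V. D p)"
    and f: "\<And>p. p \<in> V \<Longrightarrow> symbol I (D p) (\<delta> p) (\<lambda>x. (\<delta> p x)\<^sup>2) f"
    and \<delta>: "\<And>p x. p \<in> V \<Longrightarrow> x \<in> D p \<Longrightarrow> 0 < \<delta> p x" "\<And>p x. p \<in> V \<Longrightarrow> x \<in> D p \<Longrightarrow> \<delta> p x \<le> 1"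
  shows "symbol I I (\<lambda>_. 1) (\<lambda>_. 1) f"
proof -
  obtain p0 where p0: "p0 \<in> V" using ne by blast
  obtain f' f'' C0 where f'D: "symbol_data I (D p0) (\<delta> p0) (\<lambda>x. (\<delta> p0 x)\<^sup>2) f f' f'' C0"
    using f[OF p0] by (rule symbolE)
  note f' = symbol_dataD(1,2)[OF f'D]
  have "\<exists>C\<ge>0. \<forall>x\<in>D p. \<bar>f x\<bar> \<le> C \<and> (\<forall>h. \<bar>f' x h\<bar> \<le> C * norm h) \<and> (\<forall>h k. \<bar>f'' x h k\<bar> \<le> C * (norm h * norm k))"
    if p: "p \<in> V" for p
  proof -
    obtain g' g'' C where gD: "symbol_data I (D p) (\<delta> p) (\<lambda>x. (\<delta> p x)\<^sup>2) f g' g'' C"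
    using f[OF p] by (rule symbolE)
  note g = symbol_dataD[OF gD]
    have e1: "g' x = f' x" if "x \<in> I" for x
      using g(1)[OF that] f'(1)[OF that] by (rule has_derivative_unique)
    have e2: "g'' x h = f'' x h" if "x \<in> I" for x h
    proof -
      have "((\<lambda>y. f' y h) has_derivative g'' x h) (at x)"
        by (rule has_derivative_transform_within_open[OF g(2)[OF that] I(1) that]) (simp add: e1)
      then show ?thesis using f'(2)[OF that] by (rule has_derivative_unique)
    qed
    show ?thesis
    proof (intro exI[of _ C] conjI ballI allI)
      fix x assume x: "x \<in> D p"
      have xI: "x \<in> I" using x p I(2) by blast
      note d = \<delta>[OF p x]
      have d2: "(\<delta> p x)\<^sup>2 \<le> 1" using d by (simp add: power_le_one)
      show "\<bar>f x\<bar> \<le> C" using g(4)[OF x] mult_left_mono[OF d2 g(3)] by linarith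
      fix h :: point
      have "C * ((\<delta> p x)\<^sup>2 / \<delta> p x) * norm h \<le> C * 1 * norm h"
        using d g(3) by (intro mult_right_mono mult_left_mono) (auto simp: power2_eq_square)
      then show "\<bar>f' x h\<bar> \<le> C * norm h" using g(5)[OF x, of h] by (simp add: e1[OF xI])
      fix k :: point
      show "\<bar>f'' x h k\<bar> \<le> C * (norm h * norm k)" using g(6)[OF x, of h k] d by (simp add: e2[OF xI])
    qed (rule g(3))
  qed
  then obtain C where C: "\<And>p. p \<in> V \<Longrightarrow> 0 \<le> C p \<and> (\<forall>x\<in>D p. \<bar>f x\<bar> \<le> C p \<and> (\<forall>h. \<bar>f' x h\<bar> \<le> C p * norm h) \<and> (\<forall>h k. \<bar>f'' x h k\<bar> \<le> C p * (norm h * norm k)))"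
    by metis
  define M where "M = (\<Sum>p\<in>V. C p)"
  have CM: "C p \<le> M" if "p \<in> V" for p
    unfolding M_def using that fin C by (intro member_le_sum) auto
  have *: "\<bar>f x\<bar> \<le> M \<and> (\<forall>h. \<bar>f' x h\<bar> \<le> M * norm h) \<and> (\<forall>h k. \<bar>f'' x h k\<bar> \<le> M * (norm h * norm k))" if x: "x \<in> I" for x
  proof -
    obtain p where p: "p \<in> V" "x \<in> D p" using x I(2) by blast
    note c = C[OF p(1), THEN conjunct2, THEN bspec, OF p(2)]
    show ?thesis
    proof (intro conjI allI)
      show "\<bar>f x\<bar> \<le> M" using c CM[OF p(1)] by linarith
      show "\<bar>f' x h\<bar> \<le> M * norm h" for h
        using c mult_right_mono[OF CM[OF p(1)], of "norm h"] by (meson norm_ge_zero order_trans)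
      show "\<bar>f'' x h k\<bar> \<le> M * (norm h * norm k)" for h k
        using c mult_right_mono[OF CM[OF p(1)], of "norm h * norm k"] 
        by (meson norm_ge_zero mult_nonneg_nonneg order_trans)
    qed
  qed
  have M0: "0 \<le> M" unfolding M_def using C by (intro sum_nonneg) auto
  show ?thesis
    by (rule symbolI[where f'=f' and f''=f'' and C=M]) (use f' * M0 in simp_all)
qed

abbreviation C2_bounded :: "point set \<Rightarrow> (point \<Rightarrow> real) \<Rightarrow> bool" where
  "C2_bounded I \<equiv> symbol I I (\<lambda>_. 1) (\<lambda>_. 1)"

lemma C2_bounded_scale: "C2_bounded I f \<Longrightarrow> C2_bounded I (\<lambda>x. c * f x)"
  using symbol_mult[OF symbol_const, of I "\<lambda>_. 1" "\<lambda>_. 1" I "\<lambda>_. 1" f c] by simp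

lemma C2_bounded_mult: "C2_bounded I f \<Longrightarrow> C2_bounded I g \<Longrightarrow> C2_bounded I (\<lambda>x. f x * g x)"
  using symbol_mult[of I I "\<lambda>_. 1" "\<lambda>_. 1" f "\<lambda>_. 1" g] by simp

section \<open>Extension to the closed tetrahedron\<close>

context tetrahedron
begin

abbreviation "T \<equiv> tet v"
abbreviation "I \<equiv> interior (tet v)"
abbreviation val :: "(point \<Rightarrow> real) \<Rightarrow> point \<Rightarrow> real" where "val f \<equiv> cont_ext (tet v) f"
abbreviation grd :: "(point \<Rightarrow> real) \<Rightarrow> point \<Rightarrow> point" where "grd f \<equiv> cont_ext (tet v) (grad f)"

lemma I_subset: "x \<in> I \<Longrightarrow> x \<in> T" using interior_subset by blast

lemma convex_I: "convex I" by (rule convex_interior[OF tet_convex])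

lemma at_within_interior_nontrivial:
  assumes "x \<in> T" shows "at x within I \<noteq> bot"
proof -
  have "x islimpt I"
  proof (cases "x \<in> I")
    case True then show ?thesis using interior_limit_point[of x I] by simp
  next
    case False
    have "x \<in> closure I" using assms closure_interior by simp
    then show ?thesis using False by (simp add: closure_def)
  qed
  then show ?thesis using trivial_limit_within by blast
qed

lemma cont_ext_eqI:
  fixes F :: "point \<Rightarrow> 'b::t2_space"
  assumes c: "continuous_on T F" and eq: "\<And>x. x \<in> I \<Longrightarrow> f x = F x" and x: "x \<in> T"
  shows "cont_ext T f x = F x"
proof -
  have "(F \<longlongrightarrow> F x) (at x within T)" using c x by (auto simp: continuous_on_def)
  then have "(F \<longlongrightarrow> F x) (at x within I)" using interior_subset by (rule tendsto_within_subset)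
  then have "(f \<longlongrightarrow> F x) (at x within I)"
    by (rule Lim_transform_eventually) (simp add: eventually_at_filter eq)
  then show ?thesis unfolding cont_ext_def by (rule tendsto_Lim[OF at_within_interior_nontrivial[OF x]])
qed

lemma orthogonal_to_interior:
  assumes "\<And>y. y \<in> I \<Longrightarrow> u \<bullet> (y - x) = 0"
  shows "u = 0"
proof -
  obtain e where e: "e > 0" "ball centroid e \<subseteq> I"
    using centroid_interior open_interior open_contains_ball by metis
  \<comment> \<open>The addend 1 avoids division by 0; the point \<open>centroid + c u\<close> lies in the ball.\<close>
  define c where "c = e / (2 * (norm u + 1))"
  have n: "norm u + 1 > 0" by (simp add: add_nonneg_pos)
  have c: "c > 0" using e n by (simp add: c_def)
  have "c * norm u < e"
  proof -
    have "c * norm u \<le> c * (norm u + 1)" using c by simp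
    also have "\<dots> = e / 2" using n by (simp add: c_def field_simps)
    finally show ?thesis using e by simp
  qed
  then have "centroid + c *\<^sub>R u \<in> I" using c by (intro subsetD[OF e(2)]) (simp add: dist_norm)
  from assms[OF this] assms[OF centroid_interior] have "u \<bullet> (c *\<^sub>R u) = 0"
    by (simp add: inner_diff_right inner_add_right)
  then show ?thesis using c by simp
qed

text \<open>Bounded second derivatives make the gradient Lipschitz, so the function and its gradient
  extend to the closed tetrahedron; Taylor's formula survives the passage to the boundary, where it
  yields one-sided derivatives along segments.\<close>

lemma C2_bounded_extension:
  assumes "C2_bounded I f"
  shows C2_val_lipschitz: "\<exists>L. L-lipschitz_on T (val f)"
    and C2_grd_lipschitz: "\<exists>L. L-lipschitz_on T (grd f)"
    and C2_val_interior: "\<And>x. x \<in> I \<Longrightarrow> val f x = f x"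
    and C2_GDERIV: "\<And>x. x \<in> I \<Longrightarrow> GDERIV f x :> grd f x"
    and C2_grd_differentiable: "\<And>x i. x \<in> I \<Longrightarrow> (\<lambda>y. grd f y $ i) differentiable (at x)"
    and C2_segment: "\<And>x y. x \<in> T \<Longrightarrow> y \<in> T \<Longrightarrow>
      ((\<lambda>t. val f (x + t *\<^sub>R (y - x))) has_real_derivative grd f x \<bullet> (y - x)) (at 0 within {0..1})"
proof -
  obtain f' f'' C where D: "symbol_data I I (\<lambda>_. 1) (\<lambda>_. 1) f f' f'' C"
    using assms by (rule symbolE)
  note d = symbol_dataD[OF D, simplified]
  define g where "g = (\<lambda>x. \<chi> i. f' x (axis i 1))"
  have f'g: "f' x h = h \<bullet> g x" if x: "x \<in> I" for x h
  proof -
    have lin: "linear (f' x)" using d(1)[OF x] by (rule has_derivative_linear)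
    have "f' x h = f' x (\<Sum>j\<in>UNIV. (h $ j) *\<^sub>R axis j 1)"
      using basis_expansion[of h] by (simp add: scalar_mult_eq_scaleR)
    then show ?thesis
      by (simp add: linear_sum[OF lin] linear_scale[OF lin] g_def inner_vec_def)
  qed
  have gd: "GDERIV f x :> g x" if x: "x \<in> I" for x
  proof -
    have "f' x = (\<lambda>h. h \<bullet> g x)" using f'g[OF x] by (rule ext)
    then show ?thesis using d(1)[OF x] by (simp add: gderiv_def)
  qed
  have lipf: "C-lipschitz_on I f"
  proof (rule bounded_derivative_imp_lipschitz[OF _ convex_I _ d(3)])
    fix x assume x: "x \<in> I"
    show "(f has_derivative f' x) (at x within I)" using d(1)[OF x] by (rule has_derivative_at_withinI)
    show "onorm (f' x) \<le> C" by (rule onorm_bound[OF d(3)]) (use d(5)[OF x] in simp)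
  qed
  have lipf': "(C * norm h)-lipschitz_on I (\<lambda>x. f' x h)" for h
  proof (rule bounded_derivative_imp_lipschitz[OF _ convex_I])
    fix x assume x: "x \<in> I"
    show "((\<lambda>x. f' x h) has_derivative f'' x h) (at x within I)" using d(2)[OF x] by (rule has_derivative_at_withinI)
    show "onorm (f'' x h) \<le> C * norm h"
      by (rule onorm_bound) (use d(3) d(6)[OF x, of h] in \<open>simp_all add: mult.assoc\<close>)
  qed (use d(3) in simp)
  have lipg: "(3 * C)-lipschitz_on I g"
  proof (rule lipschitz_onI)
    fix x y assume xy: "x \<in> I" "y \<in> I"
    have "norm (g x - g y) \<le> (\<Sum>i\<in>UNIV. \<bar>(g x - g y) $ i\<bar>)" by (rule norm_le_l1_cart)
    also have "\<dots> \<le> (\<Sum>i\<in>(UNIV::3 set). C * dist x y)"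
    proof (rule sum_mono)
      fix i :: 3
      show "\<bar>(g x - g y) $ i\<bar> \<le> C * dist x y"
        using lipschitz_onD[OF lipf'[of "axis i 1"] xy] by (simp add: g_def dist_real_def)
    qed
    finally show "dist (g x) (g y) \<le> 3 * C * dist x y" by (simp add: dist_norm)
  qed (use d(3) in simp)
  obtain F where F: "C-lipschitz_on T F" "\<And>x. x \<in> I \<Longrightarrow> F x = f x"
    using lipschitz_extend_closure[OF lipf] unfolding closure_interior by blast
  obtain G where G: "(3 * C)-lipschitz_on T G" "\<And>x. x \<in> I \<Longrightarrow> G x = g x"
    using lipschitz_extend_closure[OF lipg] unfolding closure_interior by blast
  have cF: "continuous_on T F" using F(1) by (rule lipschitz_on_continuous_on)
  have cG: "continuous_on T G" using G(1) by (rule lipschitz_on_continuous_on)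
  have vF: "val f x = F x" if "x \<in> T" for x
    by (rule cont_ext_eqI[OF cF _ that]) (simp add: F(2))
  have gG: "grd f x = G x" if "x \<in> T" for x
    by (rule cont_ext_eqI[OF cG _ that]) (simp add: G(2) grad_eqI[OF gd])
  show "\<exists>L. L-lipschitz_on T (val f)" using lipschitz_on_transform[OF F(1)] vF by metis
  show "\<exists>L. L-lipschitz_on T (grd f)" using lipschitz_on_transform[OF G(1)] gG by metis
  show "val f x = f x" if "x \<in> I" for x using F(2)[OF that] vF[OF I_subset[OF that]] by simp
  show "GDERIV f x :> grd f x" if "x \<in> I" for x
    using gd[OF that] G(2)[OF that] gG[OF I_subset[OF that]] by simp
  show "(\<lambda>y. grd f y $ i) differentiable (at x)" if x: "x \<in> I" for x i
  proof -
    have "((\<lambda>y. grd f y $ i) has_derivative f'' x (axis i 1)) (at x)"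
      by (rule has_derivative_transform_within_open[OF d(2)[OF x] open_interior x])
        (simp add: gG[OF I_subset] G(2) g_def)
    then show ?thesis by (rule differentiableI)
  qed
  have taylor_I: "\<bar>F y - F x - G x \<bullet> (y - x)\<bar> \<le> 3 * C * (norm (y - x))\<^sup>2" if xy: "x \<in> I" "y \<in> I" for x y
  proof -
    let ?S = "I \<inter> cball x (norm (y - x))"
    let ?k = "\<lambda>z. f z - g x \<bullet> z"
    have S: "convex ?S" by (intro convex_Int convex_I convex_cball)
    have "norm (?k y - ?k x) \<le> (3 * C * norm (y - x)) * norm (y - x)"
    proof (rule differentiable_bound[OF S])
      fix z assume z: "z \<in> ?S"
      show "(?k has_derivative (\<lambda>h. (g z - g x) \<bullet> h)) (at z within ?S)"
      proof -
        have "(f has_derivative (\<lambda>h. h \<bullet> g z)) (at z within ?S)"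
          by (rule has_derivative_at_withinI[OF gd[unfolded gderiv_def]]) (use z in blast)
        then have "(?k has_derivative (\<lambda>h. h \<bullet> g z - g x \<bullet> h)) (at z within ?S)"
          by (rule has_derivative_diff) (intro has_derivative_inner_right has_derivative_ident)
        then show ?thesis by (simp add: inner_diff_left inner_diff_right inner_commute)
      qed
      have "norm (g z - g x) \<le> 3 * C * norm (z - x)"
        using lipschitz_onD[OF lipg, of z x] z xy by (simp add: dist_norm)
      also have "\<dots> \<le> 3 * C * norm (y - x)"
        using z d(3) by (intro mult_left_mono) (auto simp: dist_norm norm_minus_commute)
      finally have b: "norm (g z - g x) \<le> 3 * C * norm (y - x)" .
      show "onorm (\<lambda>h. (g z - g x) \<bullet> h) \<le> 3 * C * norm (y - x)"
      proof (rule onorm_bound)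
        show "0 \<le> 3 * C * norm (y - x)" using d(3) by simp
        show "norm ((g z - g x) \<bullet> h) \<le> 3 * C * norm (y - x) * norm h" for h
          using Cauchy_Schwarz_ineq2[of "g z - g x" h] mult_right_mono[OF b, of "norm h"] by simp
      qed
    qed (use xy in \<open>auto simp: dist_norm norm_minus_commute\<close>)
    then show ?thesis using xy F(2) G(2) by (simp add: inner_diff_right power2_eq_square algebra_simps)
  qed
  have taylor: "\<bar>F y - F x - G x \<bullet> (y - x)\<bar> \<le> 3 * C * (norm (y - x))\<^sup>2" if xy: "x \<in> T" "y \<in> T" for x y
  proof -
    let ?h = "\<lambda>p. \<bar>F (snd p) - F (fst p) - G (fst p) \<bullet> (snd p - fst p)\<bar> - 3 * C * (norm (snd p - fst p))\<^sup>2"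
    have cl: "closure (I \<times> I) = T \<times> T" by (simp add: closure_Times closure_interior)
    have "continuous_on (T \<times> T) ?h"
      by (intro continuous_intros continuous_on_compose2[OF cF] continuous_on_compose2[OF cG]) auto
    then have "?h (x, y) \<le> 0"
      by (intro continuous_le_on_closure[of "I \<times> I" ?h "(x, y)" 0]) (use xy taylor_I in \<open>auto simp: cl\<close>)
    then show ?thesis by simp
  qed
  show "((\<lambda>t. val f (x + t *\<^sub>R (y - x))) has_real_derivative grd f x \<bullet> (y - x)) (at 0 within {0..1})"
    if xy: "x \<in> T" "y \<in> T" for x y
  proof -
    have inT: "x + t *\<^sub>R (y - x) \<in> T" if "t \<in> {0..1}" for t
    proof -
      have "(1 - t) *\<^sub>R x + t *\<^sub>R y \<in> T" using that by (intro convexD[OF tet_convex xy]) auto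
      then show ?thesis by (simp add: algebra_simps)
    qed
    have "((\<lambda>t. (val f (x + t *\<^sub>R (y - x)) - val f x) / t - grd f x \<bullet> (y - x)) \<longlongrightarrow> 0) (at 0 within {0..1})"
    proof (rule Lim_null_comparison)
      show "\<forall>\<^sub>F t in at 0 within {0..1}. norm ((val f (x + t *\<^sub>R (y - x)) - val f x) / t - grd f x \<bullet> (y - x))
          \<le> 3 * C * (norm (y - x))\<^sup>2 * t"
        unfolding eventually_at_filter
      proof (intro always_eventually allI impI)
        fix t :: real assume t: "t \<noteq> 0" "t \<in> {0..1}"
        have "\<bar>val f (x + t *\<^sub>R (y - x)) - val f x - t * (grd f x \<bullet> (y - x))\<bar> \<le> 3 * C * (t * norm (y - x))\<^sup>2"
          using taylor[OF xy(1) inT[OF t(2)]] t vF[OF inT[OF t(2)]] vF[OF xy(1)] gG[OF xy(1)] by simp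
        then have "\<bar>val f (x + t *\<^sub>R (y - x)) - val f x - t * (grd f x \<bullet> (y - x))\<bar> / t \<le> 3 * C * (t * norm (y - x))\<^sup>2 / t"
          using t by (intro divide_right_mono) auto
        also have "3 * C * (t * norm (y - x))\<^sup>2 / t = 3 * C * (norm (y - x))\<^sup>2 * t"
          using t by (simp add: power2_eq_square)
        also have "\<bar>val f (x + t *\<^sub>R (y - x)) - val f x - t * (grd f x \<bullet> (y - x))\<bar> / t
           = norm ((val f (x + t *\<^sub>R (y - x)) - val f x) / t - grd f x \<bullet> (y - x))"
        proof -
          have "(val f (x + t *\<^sub>R (y - x)) - val f x) / t - grd f x \<bullet> (y - x)
             = (val f (x + t *\<^sub>R (y - x)) - val f x - t * (grd f x \<bullet> (y - x))) / t"
            using t by (simp add: diff_divide_distrib)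
          then show ?thesis using t by simp
        qed
        finally show "norm ((val f (x + t *\<^sub>R (y - x)) - val f x) / t - grd f x \<bullet> (y - x))
          \<le> 3 * C * (norm (y - x))\<^sup>2 * t" .
      qed
      show "((\<lambda>t. 3 * C * (norm (y - x))\<^sup>2 * t) \<longlongrightarrow> 0) (at 0 within {0..1})"
        by (rule tendsto_eq_intros refl | simp)+
    qed
    then have "((\<lambda>t. (val f (x + t *\<^sub>R (y - x)) - val f x) / t) \<longlongrightarrow> grd f x \<bullet> (y - x)) (at 0 within {0..1})"
      by (rule Lim_null[THEN iffD2])
    then show ?thesis by (simp add: has_field_derivative_iff)
  qed
qed

lemma C2_val_continuous: "C2_bounded I f \<Longrightarrow> continuous_on T (val f)"
  and C2_grd_continuous: "C2_bounded I f \<Longrightarrow> continuous_on T (grd f)"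
  by (use C2_val_lipschitz lipschitz_on_continuous_on in fast, use C2_grd_lipschitz lipschitz_on_continuous_on in fast)

lemma segment_derivative_unique:
  assumes "(f has_real_derivative a) (at 0 within {0..1})" "(f has_real_derivative b) (at 0 within {0..1})"
  shows "a = b"
proof -
  have "at (0::real) within {0..1} \<noteq> bot"
    by (simp add: trivial_limit_within islimpt_Icc)
  from tendsto_unique[OF this assms[unfolded has_field_derivative_iff]] show ?thesis .
qed

lemma C2_linear:
  assumes "C2_bounded I f" "C2_bounded I g" "x \<in> T"
  shows C2_val_add: "val (\<lambda>x. f x + g x) x = val f x + val g x"
    and C2_grd_add: "grd (\<lambda>x. f x + g x) x = grd f x + grd g x"
  by (rule cont_ext_eqI[where F="\<lambda>x. val f x + val g x"],
      use assms in \<open>auto intro!: continuous_intros C2_val_continuous simp: C2_val_interior\<close>)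
     (rule cont_ext_eqI[where F="\<lambda>x. grd f x + grd g x"],
      use assms in \<open>auto intro!: continuous_intros C2_grd_continuous GDERIV_add grad_eqI C2_GDERIV\<close>)

lemma C2_scale:
  assumes "C2_bounded I f" "x \<in> T"
  shows C2_val_scale: "val (\<lambda>x. c * f x) x = c * val f x"
    and C2_grd_scale: "grd (\<lambda>x. c * f x) x = c *\<^sub>R grd f x"
proof -
  show "val (\<lambda>x. c * f x) x = c * val f x"
    by (rule cont_ext_eqI[where F="\<lambda>x. c * val f x"])
      (use assms in \<open>auto intro!: continuous_intros C2_val_continuous simp: C2_val_interior\<close>)
  show "grd (\<lambda>x. c * f x) x = c *\<^sub>R grd f x"
  proof (rule cont_ext_eqI[where F="\<lambda>x. c *\<^sub>R grd f x"])
    fix x assume x: "x \<in> I"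
    have "GDERIV (\<lambda>x. c * f x) x :> c *\<^sub>R grd f x"
      using C2_GDERIV[OF assms(1) x] unfolding gderiv_def
      by (auto intro!: derivative_eq_intros)
    then show "grad (\<lambda>x. c * f x) x = c *\<^sub>R grd f x" by (rule grad_eqI)
  qed (use assms in \<open>auto intro!: continuous_intros C2_grd_continuous\<close>)
qed

text \<open>On a segment from \<open>x\<close> into the interior, \<open>\<lambda>\<^sub>i\<close> grows linearly from 0, so the one-sided derivative of
  \<open>\<lambda>\<^sub>i K\<close> is \<open>k\<close> times the slope of \<open>\<lambda>\<^sub>i\<close>. The directions into the interior span the space and thus
  determine the gradient at \<open>x\<close>.\<close>

lemma C2_grd_at_face:
  assumes f: "C2_bounded I f" and i: "i \<in> {0..3}" and x: "x \<in> T" "bary v i x = 0"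
    and eq: "\<And>y. y \<in> I \<Longrightarrow> f y = bary v i y * K y" and K: "(K \<longlongrightarrow> k) (at x within I)"
  shows "val f x = 0" "grd f x = k *\<^sub>R gl i"
proof -
  have path: "filterlim (\<lambda>t. x + t *\<^sub>R (y - x)) (at x within I) (at 0 within {0..1})" if y: "y \<in> I" for y
    unfolding filterlim_at
  proof
    show "\<forall>\<^sub>F t in at 0 within {0..1}. x + t *\<^sub>R (y - x) \<in> I \<and> x + t *\<^sub>R (y - x) \<noteq> x"
      unfolding eventually_at_filter
    proof (intro always_eventually allI impI)
      fix t :: real assume t: "t \<noteq> 0" "t \<in> {0..1}"
      have "0 < bary v i y" using y i interior_iff by blast
      then have "y \<noteq> x" using x by auto
      then show "x + t *\<^sub>R (y - x) \<in> I \<and> x + t *\<^sub>R (y - x) \<noteq> x"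
        using t segment_interior[OF x(1) y, of t] by auto
    qed
    show "((\<lambda>t. x + t *\<^sub>R (y - x)) \<longlongrightarrow> x) (at 0 within {0..1})"
      by (rule tendsto_eq_intros refl | simp)+
  qed
  have Kp: "((\<lambda>t. K (x + t *\<^sub>R (y - x))) \<longlongrightarrow> k) (at 0 within {0..1})" if y: "y \<in> I" for y
    using K path[OF y] by (rule filterlim_compose)
  have fp: "val f (x + t *\<^sub>R (y - x)) = t * (gl i \<bullet> (y - x)) * K (x + t *\<^sub>R (y - x))"
    if "y \<in> I" "t \<noteq> 0" "t \<in> {0..1}" for y t
  proof -
    have "x + t *\<^sub>R (y - x) \<in> I" using segment_interior[OF x(1) that(1), of t] that by auto
    then show ?thesis using C2_val_interior[OF f] eq bary_line[OF i, of x t "y - x"] x(2) by simp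
  qed
  have nb: "at (0::real) within {0..1} \<noteq> bot" by (simp add: trivial_limit_within islimpt_Icc)
  show v0: "val f x = 0"
  proof (rule tendsto_unique[OF nb])
    let ?p = "\<lambda>t. x + t *\<^sub>R (centroid - x)"
    have "(val f \<longlongrightarrow> val f x) (at x within I)"
      using C2_val_continuous[OF f] x(1) interior_subset tendsto_within_subset unfolding continuous_on_def by metis
    then show "((\<lambda>t. val f (?p t)) \<longlongrightarrow> val f x) (at 0 within {0..1})"
      using path[OF centroid_interior] by (rule filterlim_compose)
    have "((\<lambda>t. t * (gl i \<bullet> (centroid - x)) * K (?p t)) \<longlongrightarrow> 0 * (gl i \<bullet> (centroid - x)) * k) (at 0 within {0..1})"
      by (intro tendsto_intros Kp centroid_interior)
    then have "((\<lambda>t. t * (gl i \<bullet> (centroid - x)) * K (?p t)) \<longlongrightarrow> 0) (at 0 within {0..1})" by simp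
    then show "((\<lambda>t. val f (?p t)) \<longlongrightarrow> 0) (at 0 within {0..1})"
      by (rule Lim_transform_eventually) (simp add: eventually_at_filter fp centroid_interior)
  qed
  have "(grd f x - k *\<^sub>R gl i) \<bullet> (y - x) = 0" if y: "y \<in> I" for y
  proof -
    have "((\<lambda>t. val f (x + t *\<^sub>R (y - x)) / t) \<longlongrightarrow> grd f x \<bullet> (y - x)) (at 0 within {0..1})"
      using C2_segment[OF f x(1) I_subset[OF y]] v0 by (simp add: has_field_derivative_iff)
    then have "((\<lambda>t. (gl i \<bullet> (y - x)) * K (x + t *\<^sub>R (y - x))) \<longlongrightarrow> grd f x \<bullet> (y - x)) (at 0 within {0..1})"
      by (rule Lim_transform_eventually) (simp add: eventually_at_filter fp y)
    moreover have "((\<lambda>t. (gl i \<bullet> (y - x)) * K (x + t *\<^sub>R (y - x))) \<longlongrightarrow> (gl i \<bullet> (y - x)) * k) (at 0 within {0..1})"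
      by (intro tendsto_intros Kp y)
    ultimately have "grd f x \<bullet> (y - x) = (gl i \<bullet> (y - x)) * k" by (rule tendsto_unique[OF nb])
    then show ?thesis by (simp add: inner_diff_left)
  qed
  then have "grd f x - k *\<^sub>R gl i = 0" by (rule orthogonal_to_interior)
  then show "grd f x = k *\<^sub>R gl i" by simp
qed

end

section \<open>Linear spans, edge bubbles and face functions\<close>

lemma lin_span_base: "b \<in> B \<Longrightarrow> b \<in> lin_span B"
  unfolding lin_span_def
  by (rule CollectI, rule exI[where x="{b}"], rule exI[where x="\<lambda>_. 1"]) auto

lemma lin_span_zero: "(\<lambda>x. 0) \<in> lin_span B"
  unfolding lin_span_def by (rule CollectI, rule exI[where x="{}"]) auto

lemma lin_span_scale:
  assumes "f \<in> lin_span B" shows "(\<lambda>x. a * f x) \<in> lin_span B"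
proof -
  obtain A c where "finite A" "A \<subseteq> B" "f = (\<lambda>x. \<Sum>b\<in>A. c b * b x)"
    using assms unfolding lin_span_def by auto
  then show ?thesis unfolding lin_span_def
    by (intro CollectI exI[where x=A] exI[where x="\<lambda>b. a * c b"]) (auto simp: sum_distrib_left mult.assoc)
qed

lemma lin_span_add:
  assumes "f \<in> lin_span B" "g \<in> lin_span B" shows "(\<lambda>x. f x + g x) \<in> lin_span B"
proof -
  obtain A c where A: "finite A" "A \<subseteq> B" "f = (\<lambda>x. \<Sum>b\<in>A. c b * b x)"
    using assms(1) unfolding lin_span_def by auto
  obtain A' c' where A': "finite A'" "A' \<subseteq> B" "g = (\<lambda>x. \<Sum>b\<in>A'. c' b * b x)"
    using assms(2) unfolding lin_span_def by auto
  have "f x = (\<Sum>b\<in>A \<union> A'. (if b \<in> A then c b else 0) * b x)" for x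
    unfolding A(3) by (rule sum.mono_neutral_cong_left) (use A(1) A'(1) in auto)
  moreover have "g x = (\<Sum>b\<in>A \<union> A'. (if b \<in> A' then c' b else 0) * b x)" for x
    unfolding A'(3) by (rule sum.mono_neutral_cong_left) (use A(1) A'(1) in auto)
  ultimately have "(\<lambda>x. f x + g x) =
      (\<lambda>x. \<Sum>b\<in>A \<union> A'. ((if b \<in> A then c b else 0) + (if b \<in> A' then c' b else 0)) * b x)"
    by (simp only: distrib_right sum.distrib)
  then show ?thesis unfolding lin_span_def using A(1,2) A'(1,2)
    by (intro CollectI exI[where x="A \<union> A'"] exI[where x="\<lambda>b. (if b \<in> A then c b else 0) + (if b \<in> A' then c' b else 0)"]) simp
qed

lemma lin_span_induct:
  assumes f: "f \<in> lin_span B" and zero: "P (\<lambda>x. 0)"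
    and step: "\<And>b c g. b \<in> B \<Longrightarrow> P g \<Longrightarrow> P (\<lambda>x. c * b x + g x)"
  shows "P f"
proof -
  obtain A c where A: "finite A" "A \<subseteq> B" "f = (\<lambda>x. \<Sum>b\<in>A. c b * b x)"
    using f unfolding lin_span_def by auto
  from A(1,2) have "P (\<lambda>x. \<Sum>b\<in>A. c b * b x)"
  proof (induction A rule: finite_induct)
    case empty then show ?case using zero by simp
  next
    case (insert b A)
    then show ?case using step[of b "\<lambda>x. \<Sum>b\<in>A. c b * b x" "c b"] by simp
  qed
  then show ?thesis using A(3) by simp
qed

context tetrahedron
begin

lemma C2_bary: "k \<in> {0..3} \<Longrightarrow> C2_bounded I (bary v k)"
  by (rule symbol_affine[OF bary_has_derivative]) 
    (use bary_le_one I_subset in \<open>auto simp: interior_iff abs_of_pos\<close>)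

lemma C2_const: "C2_bounded I (\<lambda>x. c)"
  by (rule symbol_const) auto

definition pair_sum :: "nat \<times> nat \<Rightarrow> point \<Rightarrow> real" where
  "pair_sum p x = bary v (fst p) x + bary v (snd p) x"

text \<open>These parts cover the interior. On each of them the sum of the two coordinates in \<open>p\<close> serves as the
  length scale.\<close>

definition least_pair :: "(nat \<times> nat) set \<Rightarrow> nat \<times> nat \<Rightarrow> point set" where
  "least_pair V p = {x \<in> I. \<forall>q\<in>V. pair_sum p x \<le> pair_sum q x}"

definition all_pairs :: "(nat \<times> nat) set" where
  "all_pairs = {(a, b). a \<in> {0..3} \<and> b \<in> {0..3} \<and> a \<noteq> b}"

lemma finite_all_pairs: "finite all_pairs"
  by (rule finite_subset[of _ "{0..3} \<times> {0..3}"]) (auto simp: all_pairs_def)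

lemma pair_sum_bounds:
  assumes "p \<in> all_pairs" "x \<in> I"
  shows "0 < pair_sum p x" "pair_sum p x \<le> 1"
proof -
  obtain a b where p: "p = (a, b)" "a \<in> {0..3}" "b \<in> {0..3}" "a \<noteq> b"
    using assms(1) by (auto simp: all_pairs_def)
  have pos: "0 < bary v k x" if "k \<in> {0..3}" for k using assms(2) that interior_iff by blast
  show "0 < pair_sum p x" using pos[of a] pos[of b] p by (simp add: pair_sum_def)
  have "(\<Sum>k\<in>{a, b}. bary v k x) \<le> (\<Sum>k\<in>{0..3}. bary v k x)"
    by (rule sum_mono2) (use p pos in \<open>auto intro: less_imp_le\<close>)
  then show "pair_sum p x \<le> 1" using p by (simp add: pair_sum_def bary_sum)
qed

abbreviation bounded_symbol :: "(nat \<times> nat) set \<Rightarrow> nat \<times> nat \<Rightarrow> (point \<Rightarrow> real) \<Rightarrow> bool" where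
  "bounded_symbol V p \<equiv> symbol I (least_pair V p) (pair_sum p) (\<lambda>_. 1)"

context
  fixes V :: "(nat \<times> nat) set" and p :: "nat \<times> nat"
  assumes V: "V \<subseteq> all_pairs" and p: "p \<in> V"
begin

lemma least_pair_subset: "x \<in> least_pair V p \<Longrightarrow> x \<in> I" by (simp add: least_pair_def)

lemma pair_sum_pos: "x \<in> least_pair V p \<Longrightarrow> 0 < pair_sum p x"
  using pair_sum_bounds(1) V p least_pair_subset by blast

lemma bsym_const: "bounded_symbol V p (\<lambda>x. c)"
  by (rule symbol_const) (simp_all add: pair_sum_pos)

lemma bsym_mult: "bounded_symbol V p f \<Longrightarrow> bounded_symbol V p g \<Longrightarrow> bounded_symbol V p (\<lambda>x. f x * g x)"
  using symbol_mult[of I "least_pair V p" "pair_sum p" "\<lambda>_. 1" f "\<lambda>_. 1" g] pair_sum_pos by simp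

lemma bsym_add: "bounded_symbol V p f \<Longrightarrow> bounded_symbol V p g \<Longrightarrow> bounded_symbol V p (\<lambda>x. f x + g x)"
  by (rule symbol_add)

lemma bsym_diff: "bounded_symbol V p f \<Longrightarrow> bounded_symbol V p g \<Longrightarrow> bounded_symbol V p (\<lambda>x. f x - g x)"
  using bsym_add[OF _ bsym_mult[OF bsym_const], of f g "-1"] by simp

lemma bsym_bary: "k \<in> {0..3} \<Longrightarrow> bounded_symbol V p (bary v k)"
proof (rule symbol_affine[OF bary_has_derivative])
  fix x assume k: "k \<in> {0..3}" and x: "x \<in> least_pair V p"
  have xI: "x \<in> I" using x by (rule least_pair_subset)
  show "\<bar>bary v k x\<bar> \<le> 1" using bary_le_one[OF I_subset[OF xI] k] interior_iff[of x] xI k by force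
  show "pair_sum p x \<le> 1" "0 < pair_sum p x" using pair_sum_bounds[OF _ xI] V p by blast+
qed

text \<open>Where \<open>p\<close> is the least pair, \<open>pair_sum p\<close> is at most the denominator.\<close>

lemma bsym_ratio:
  assumes q: "(c, d) \<in> V \<or> (d, c) \<in> V"
  shows "bounded_symbol V p (\<lambda>x. bary v c x / (bary v c x + bary v d x))"
    and "bounded_symbol V p (\<lambda>x. bary v c x / (bary v d x + bary v c x))"
proof -
  let ?s = "\<lambda>x. bary v c x + bary v d x"
  have cd: "c \<in> {0..3}" "d \<in> {0..3}" using q V by (auto simp: all_pairs_def)
  have s: "(?s has_derivative (\<lambda>h. (gl c + gl d) \<bullet> h)) (at x)" for x
    using has_derivative_add[OF bary_has_derivative[OF cd(1)] bary_has_derivative[OF cd(2)]]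
    by (simp add: inner_add_left)
  have pos: "0 < bary v c x" "0 < bary v d x" if "x \<in> I" for x using that cd interior_iff by blast+
  have le: "pair_sum p x \<le> ?s x" if x: "x \<in> least_pair V p" for x
  proof -
    have "pair_sum p x \<le> pair_sum (c, d) x \<or> pair_sum p x \<le> pair_sum (d, c) x"
      using x q unfolding least_pair_def by blast
    then show ?thesis by (auto simp: pair_sum_def)
  qed
  have 1: "symbol I (least_pair V p) (pair_sum p) ?s (bary v c)"
  proof (rule symbol_affine[OF bary_has_derivative[OF cd(1)]])
    fix x assume x: "x \<in> least_pair V p"
    show "\<bar>bary v c x\<bar> \<le> ?s x" using pos[OF least_pair_subset[OF x]] by simp
  qed (rule le pair_sum_pos; assumption)+
  have 2: "symbol I (least_pair V p) (pair_sum p) (\<lambda>x. 1 / ?s x) (\<lambda>x. 1 / ?s x)"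
    by (rule symbol_inverse_affine[OF s])
      (use pos least_pair_subset le pair_sum_pos in \<open>auto simp: add_pos_pos\<close>)
  have "bounded_symbol V p (\<lambda>x. bary v c x * (1 / ?s x))"
  proof (rule symbol_mono[OF symbol_mult[OF 1 2 pair_sum_pos] _ pair_sum_pos])
    show "?s x * (1 / ?s x) \<le> 1" for x by simp
  qed
  then show "bounded_symbol V p (\<lambda>x. bary v c x / (bary v c x + bary v d x))"
    "bounded_symbol V p (\<lambda>x. bary v c x / (bary v d x + bary v c x))" by (simp_all add: add.commute)
qed

end

text \<open>The second derivatives of \<open>f\<close> can blow up only where some pair sum occurring in a
  denominator is small. If that pair of barycentric coordinates divides \<open>f\<close>, the blow-up is
  compensated, since both coordinates are at most the pair sum.\<close>

lemma C2_bounded_if_pairs_divide: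
  assumes V: "V \<subseteq> all_pairs" "V \<noteq> {}"
    and f: "\<And>a b. (a, b) \<in> V \<Longrightarrow> \<exists>h. bounded_symbol V (a, b) h \<and> (\<forall>x\<in>I. f x = bary v a x * bary v b x * h x)"
  shows "C2_bounded I f"
proof (rule symbol_glue[where V=V and D="least_pair V" and \<delta>=pair_sum])
  show fin: "finite V" using V(1) finite_all_pairs finite_subset by blast
  show "V \<noteq> {}" by (rule V(2))
  show "open I" by simp
  have "x \<in> (\<Union>p\<in>V. least_pair V p)" if "x \<in> I" for x
  proof -
    have "Min ((\<lambda>q. pair_sum q x) ` V) \<in> (\<lambda>q. pair_sum q x) ` V" using fin V(2) by (intro Min_in) auto
    then obtain p where "p \<in> V" "pair_sum p x = Min ((\<lambda>q. pair_sum q x) ` V)" by auto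
    then have "x \<in> least_pair V p" using that fin by (auto simp: least_pair_def intro: Min_le)
    then show ?thesis using \<open>p \<in> V\<close> by blast
  qed
  then show "I = (\<Union>p\<in>V. least_pair V p)" by (auto simp: least_pair_def)
  fix q assume q: "q \<in> V"
  obtain a b where ab: "q = (a, b)" "a \<in> {0..3}" "b \<in> {0..3}" using q V(1) by (auto simp: all_pairs_def)
  obtain h where h: "bounded_symbol V q h" "\<And>x. x \<in> I \<Longrightarrow> f x = bary v a x * bary v b x * h x"
    using f[of a b] q ab(1) by blast
  note pos = pair_sum_pos[OF V(1) q]
  have sub: "least_pair V q \<subseteq> I" by (auto simp: least_pair_def)
  have b: "symbol I (least_pair V q) (pair_sum q) (pair_sum q) (bary v k)" if "k = a \<or> k = b" for k
  proof (rule symbol_affine[OF bary_has_derivative])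
    fix x assume x: "x \<in> least_pair V q"
    have "0 < bary v a x" "0 < bary v b x" using x sub ab interior_iff by blast+
    then show "\<bar>bary v k x\<bar> \<le> pair_sum q x" using that ab by (auto simp: pair_sum_def)
    show "0 < pair_sum q x" using x by (rule pos)
  qed (use that ab in auto)
  have "symbol I (least_pair V q) (pair_sum q) (\<lambda>x. pair_sum q x * pair_sum q x * 1) (\<lambda>x. bary v a x * bary v b x * h x)"
    by (intro symbol_mult b h(1) pos) auto
  then have "symbol I (least_pair V q) (pair_sum q) (\<lambda>x. pair_sum q x * pair_sum q x * 1) f"
    by (rule symbol_cong) (use sub h(2) in auto)
  then show "symbol I (least_pair V q) (pair_sum q) (\<lambda>x. (pair_sum q x)\<^sup>2) f"
    by (simp add: power2_eq_square)
next
  fix q x assume q: "q \<in> V" and x: "x \<in> least_pair V q"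
  show "0 < pair_sum q x" "pair_sum q x \<le> 1"
    using pair_sum_bounds[of q x] q x V(1) by (auto simp: least_pair_def)
qed

text \<open>The denominators are the sums of the pairs \<open>(n, l)\<close> and \<open>(n, m)\<close>, and both pairs divide the bubble.\<close>

lemma C2_edge_bubble:
  assumes "l \<in> {0..3}" "m \<in> {0..3}" "n \<in> {0..3}" "n \<noteq> l" "n \<noteq> m"
  shows "C2_bounded I (edge_bubble v l m n)"
proof (rule C2_bounded_if_pairs_divide[where V="{(n, l), (n, m)}"])
  let ?V = "{(n, l), (n, m)}"
  let ?r = "\<lambda>a x. bary v a x / (bary v n x + bary v a x)"
  show V: "?V \<subseteq> all_pairs" using assms by (auto simp: all_pairs_def)
  fix a b assume ab: "(a, b) \<in> ?V"
  define c where "c = (if b = l then m else l)"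
  have c: "c \<in> {0..3}" using assms by (auto simp: c_def)
  have "bounded_symbol ?V (a, b) (\<lambda>x. ?r l x * ?r m x * bary v c x)"
    by (intro bsym_mult[OF V ab] bsym_ratio(2)[OF V ab] bsym_bary[OF V ab] c) auto
  moreover have "edge_bubble v l m n x = bary v a x * bary v b x * (?r l x * ?r m x * bary v c x)" for x
    using ab by (auto simp: edge_bubble_def c_def power2_eq_square)
  ultimately show "\<exists>h. bounded_symbol ?V (a, b) h \<and> (\<forall>x\<in>I. edge_bubble v l m n x = bary v a x * bary v b x * h x)"
    by blast
qed simp

end

text \<open>\<open>Phi_m\<close> is \<open>Phi_l\<close> with \<open>l\<close> and \<open>m\<close> exchanged.\<close>

lemma PhisE:
  assumes "F \<in> Phis i"
  obtains l m n where "{l, m, n} = {0..3} - {i}" "l \<noteq> m" "n \<noteq> l" "n \<noteq> m" "F = Phi_l l m n \<or> F = Phi_n l m n"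
proof -
  obtain l m n where a: "l < m" "{l, m, n} = {0..3} - {i}" "n \<notin> {l, m}"
    and F: "F = Phi_l l m n \<or> F = Phi_m l m n \<or> F = Phi_n l m n"
    using assms unfolding Phis_def by auto
  have "Phi_m l m n = Phi_l m l n" by (auto simp: Phi_m_def Phi_l_def mult_ac)
  then show ?thesis using that[of l m n] that[of m l n] a F by (auto simp: insert_commute)
qed

text \<open>Ratios of the form \<open>\<mu> a / (\<mu> a + \<mu> b)\<close> stay bounded. Where a denominator is 0, both sides are 0.\<close>

lemma Phi_l_factor:
  assumes "0 \<le> \<mu> l" "0 \<le> \<mu> m" "0 \<le> \<mu> n"
  shows "Phi_l l m n \<mu> = \<mu> l * (\<mu> m * (1 + \<mu> n / (\<mu> n + \<mu> l)) * (\<mu> n / (\<mu> n + \<mu> l)) * (\<mu> m / (\<mu> n + \<mu> m)))"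
    and "Phi_l l m n \<mu> = \<mu> n * (\<mu> m * (1 + \<mu> n / (\<mu> n + \<mu> l)) * (\<mu> l / (\<mu> n + \<mu> l)) * (\<mu> m / (\<mu> n + \<mu> m)))"
proof -
  show "Phi_l l m n \<mu> = \<mu> l * (\<mu> m * (1 + \<mu> n / (\<mu> n + \<mu> l)) * (\<mu> n / (\<mu> n + \<mu> l)) * (\<mu> m / (\<mu> n + \<mu> m)))"
  proof (cases "\<mu> n + \<mu> l = 0 \<or> \<mu> n + \<mu> m = 0")
    case True then show ?thesis using assms by (auto simp: Phi_l_def)
  next
    case False
    then have "1 + \<mu> n / (\<mu> n + \<mu> l) = (2 * \<mu> n + \<mu> l) / (\<mu> n + \<mu> l)" by (simp add: divide_simps)
    then show ?thesis by (simp add: Phi_l_def power2_eq_square mult_ac)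
  qed
  then show "Phi_l l m n \<mu> = \<mu> n * (\<mu> m * (1 + \<mu> n / (\<mu> n + \<mu> l)) * (\<mu> l / (\<mu> n + \<mu> l)) * (\<mu> m / (\<mu> n + \<mu> m)))"
    by simp
qed

text \<open>The two terms of \<open>Phi_n\<close> cancel for \<open>\<mu> n = 0\<close>; the factor \<open>1 - P Q\<close> makes this visible, as both
  \<open>1 - P\<close> and \<open>1 - Q\<close> contain \<open>\<mu> n\<close>.\<close>

lemma Phi_n_factor:
  assumes "0 \<le> \<mu> l" "0 \<le> \<mu> m" "0 \<le> \<mu> n"
  defines "P \<equiv> \<mu> l / (\<mu> n + \<mu> l)" and "R \<equiv> \<mu> n / (\<mu> n + \<mu> l)" and "Q \<equiv> \<mu> m / (\<mu> n + \<mu> m)"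
  shows "Phi_n l m n \<mu> = \<mu> l * (P * P * Q * Q * \<mu> m - P * R * \<mu> n * Q * Q - \<mu> m)"
    and "Phi_n l m n \<mu> = \<mu> n * (0 - (1 + P * Q) * (\<mu> m * P + \<mu> l * P * Q) - P * P * Q * Q * \<mu> n)"
proof -
  have eq: "Phi_n l m n \<mu> = P * P * Q * Q * (\<mu> l * \<mu> m - \<mu> n * \<mu> n) - \<mu> l * \<mu> m"
    by (simp add: Phi_n_def P_def Q_def power2_eq_square mult_ac)
  have 1: "P * \<mu> n = R * \<mu> l" by (simp add: P_def R_def)
  have "P * P * Q * Q * (\<mu> l * \<mu> m - \<mu> n * \<mu> n) - \<mu> l * \<mu> m
      = P * P * Q * Q * \<mu> l * \<mu> m - P * (P * \<mu> n) * \<mu> n * Q * Q - \<mu> l * \<mu> m" by (simp add: algebra_simps)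
  also have "\<dots> = \<mu> l * (P * P * Q * Q * \<mu> m - P * R * \<mu> n * Q * Q - \<mu> m)"
    unfolding 1 by (simp add: algebra_simps)
  finally show "Phi_n l m n \<mu> = \<mu> l * (P * P * Q * Q * \<mu> m - P * R * \<mu> n * Q * Q - \<mu> m)"
    using eq by simp
  have 2: "\<mu> l * \<mu> m * (1 - P * Q) = \<mu> n * (\<mu> m * P + \<mu> l * P * Q)"
  proof (cases "\<mu> n + \<mu> l = 0 \<or> \<mu> n + \<mu> m = 0")
    case True
    then have "\<mu> n = 0 \<and> \<mu> l = 0 \<or> \<mu> n = 0 \<and> \<mu> m = 0" using assms(1-3) by linarith
    then show ?thesis by (auto simp: P_def Q_def)
  next
    case False
    then have "P * (\<mu> n + \<mu> l) = \<mu> l" "Q * (\<mu> n + \<mu> m) = \<mu> m" by (simp_all add: P_def Q_def)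
    then have "\<mu> l * \<mu> m = P * (\<mu> n + \<mu> l) * \<mu> m" "P * \<mu> l * \<mu> m = P * \<mu> l * (Q * (\<mu> n + \<mu> m))" by simp_all
    then show ?thesis by (simp add: algebra_simps)
  qed
  have "P * P * Q * Q * (\<mu> l * \<mu> m - \<mu> n * \<mu> n) - \<mu> l * \<mu> m
      = - (1 + P * Q) * (\<mu> l * \<mu> m * (1 - P * Q)) - P * P * Q * Q * \<mu> n * \<mu> n" by (simp add: algebra_simps)
  then show "Phi_n l m n \<mu> = \<mu> n * (0 - (1 + P * Q) * (\<mu> m * P + \<mu> l * P * Q) - P * P * Q * Q * \<mu> n)"
    unfolding eq 2 by (simp add: algebra_simps)
qed

lemma abs_mult_le_one: "\<bar>a\<bar> \<le> 1 \<Longrightarrow> \<bar>b\<bar> \<le> (1::real) \<Longrightarrow> \<bar>a * b\<bar> \<le> 1"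
  unfolding abs_mult by (rule mult_le_one) auto

lemma three_abs: "\<bar>a\<bar> \<le> 1 \<Longrightarrow> \<bar>b\<bar> \<le> 1 \<Longrightarrow> \<bar>c\<bar> \<le> 1 \<Longrightarrow> \<bar>a - b - c\<bar> \<le> (5::real)"
  by linarith

lemma ratio_le_one: "0 \<le> a \<Longrightarrow> 0 \<le> b \<Longrightarrow> \<bar>a / (a + b)\<bar> \<le> (1::real)" "0 \<le> a \<Longrightarrow> 0 \<le> b \<Longrightarrow> \<bar>a / (b + a)\<bar> \<le> (1::real)"
  by (cases "a + b = 0"; simp add: divide_le_eq_1 add.commute)+

context tetrahedron
begin

text \<open>Each of the three coordinates of a face function divides it, and the quotient is a bounded symbol. It is
  a sum of at most five monomials in coordinates and ratios, whence the bound 5.\<close>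

lemma Phi_factor:
  assumes F: "F \<in> Phis i" and j: "j \<in> {0..3} - {i}"
  shows "\<exists>h. (\<forall>\<mu>. (\<forall>k\<in>{0..3}. 0 \<le> \<mu> k) \<longrightarrow> F \<mu> = \<mu> j * h \<mu>) \<and>
    (\<forall>\<mu>. (\<forall>k\<in>{0..3}. 0 \<le> \<mu> k \<and> \<mu> k \<le> 1) \<longrightarrow> \<bar>h \<mu>\<bar> \<le> 5) \<and>
    (\<forall>p\<in>all_pairs. bounded_symbol all_pairs p (\<lambda>x. h (\<lambda>k. bary v k x)))"
proof -
  have *: "\<exists>h. (\<forall>\<mu>. (\<forall>k\<in>{0..3}. 0 \<le> \<mu> k) \<longrightarrow> F \<mu> = \<mu> j * h \<mu>) \<and>
    (\<forall>\<mu>. (\<forall>k\<in>{0..3}. 0 \<le> \<mu> k \<and> \<mu> k \<le> 1) \<longrightarrow> \<bar>h \<mu>\<bar> \<le> 5) \<and>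
    (\<forall>p\<in>all_pairs. bounded_symbol all_pairs p (\<lambda>x. h (\<lambda>k. bary v k x)))"
    if lmn: "l \<in> {0..3}" "m \<in> {0..3}" "n \<in> {0..3}" "l \<noteq> m" "n \<noteq> l" "n \<noteq> m"
      and F: "F = Phi_l l m n \<and> j = m \<or> (F = Phi_l l m n \<or> F = Phi_n l m n) \<and> (j = l \<or> j = n)" for l m n F
  proof -
    let ?P = "\<lambda>\<mu>. \<mu> l / (\<mu> n + \<mu> l)" and ?R = "\<lambda>\<mu>. \<mu> n / (\<mu> n + \<mu> l)" and ?Q = "\<lambda>\<mu>. \<mu> m / (\<mu> n + \<mu> m)"
    have ap: "(l, n) \<in> all_pairs" "(n, l) \<in> all_pairs" "(m, n) \<in> all_pairs" using lmn by (auto simp: all_pairs_def)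
    note S = bsym_mult[OF order_refl] bsym_add[OF order_refl] bsym_diff[OF order_refl] bsym_const[OF order_refl]
      bsym_ratio[OF order_refl] bsym_bary[OF order_refl]
    have bd: "\<bar>\<mu> l\<bar> \<le> 1 \<and> \<bar>\<mu> m\<bar> \<le> 1 \<and> \<bar>\<mu> n\<bar> \<le> 1 \<and> \<bar>?P \<mu>\<bar> \<le> 1 \<and> \<bar>?R \<mu>\<bar> \<le> 1 \<and> \<bar>?Q \<mu>\<bar> \<le> 1"
      if "\<forall>k\<in>{0..3}. 0 \<le> \<mu> k \<and> \<mu> k \<le> 1" for \<mu> :: "nat \<Rightarrow> real"
    proof -
      have "0 \<le> \<mu> l" "\<mu> l \<le> 1" "0 \<le> \<mu> m" "\<mu> m \<le> 1" "0 \<le> \<mu> n" "\<mu> n \<le> 1" using that lmn(1-3) by blast+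
      then show ?thesis by (intro conjI ratio_le_one; simp)
    qed
    from F consider "F = Phi_l l m n" "j = l \<or> j = m" | "F = Phi_l l m n" "j = n" | "F = Phi_n l m n" "j = l" | "F = Phi_n l m n" "j = n"
      by blast
    then show ?thesis
    proof cases
      case 1
      define k where "k = (if j = l then m else l)"
      have jk: "j = l \<and> k = m \<or> j = m \<and> k = l" using 1(2) by (auto simp: k_def)
      show ?thesis
      proof (rule exI[where x="\<lambda>\<mu>. \<mu> k * (1 + ?R \<mu>) * ?R \<mu> * ?Q \<mu>"], intro conjI allI impI ballI)
        fix \<mu> :: "nat \<Rightarrow> real" assume "\<forall>k\<in>{0..3}. 0 \<le> \<mu> k"
        then show "F \<mu> = \<mu> j * (\<mu> k * (1 + ?R \<mu>) * ?R \<mu> * ?Q \<mu>)"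
          using Phi_l_factor(1)[of \<mu> l m n] lmn jk 1(1) by auto
      next
        fix \<mu> :: "nat \<Rightarrow> real" assume "\<forall>k\<in>{0..3}. 0 \<le> \<mu> k \<and> \<mu> k \<le> 1"
        note b = bd[OF this]
        have "\<bar>\<mu> k * ?R \<mu> * ?Q \<mu>\<bar> \<le> 1" "\<bar>\<mu> k * ?R \<mu> * ?R \<mu> * ?Q \<mu>\<bar> \<le> 1" using b jk by (intro abs_mult_le_one; auto)+
        moreover have "\<mu> k * (1 + ?R \<mu>) * ?R \<mu> * ?Q \<mu> = \<mu> k * ?R \<mu> * ?Q \<mu> + \<mu> k * ?R \<mu> * ?R \<mu> * ?Q \<mu>" by algebra
        ultimately show "\<bar>\<mu> k * (1 + ?R \<mu>) * ?R \<mu> * ?Q \<mu>\<bar> \<le> 5" by linarith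
      next
        fix p assume "p \<in> all_pairs"
        then show "bounded_symbol all_pairs p (\<lambda>x. bary v k x * (1 + bary v n x / (bary v n x + bary v l x)) *
          (bary v n x / (bary v n x + bary v l x)) * (bary v m x / (bary v n x + bary v m x)))"
          using ap lmn jk by (intro S) auto
      qed
    next
      case 2
      show ?thesis
      proof (rule exI[where x="\<lambda>\<mu>. \<mu> m * (1 + ?R \<mu>) * ?P \<mu> * ?Q \<mu>"], intro conjI allI impI ballI)
        fix \<mu> :: "nat \<Rightarrow> real" assume "\<forall>k\<in>{0..3}. 0 \<le> \<mu> k"
        then show "F \<mu> = \<mu> j * (\<mu> m * (1 + ?R \<mu>) * ?P \<mu> * ?Q \<mu>)"
          unfolding 2 by (intro Phi_l_factor) (use lmn in auto)
      next
        fix \<mu> :: "nat \<Rightarrow> real" assume "\<forall>k\<in>{0..3}. 0 \<le> \<mu> k \<and> \<mu> k \<le> 1"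
        note b = bd[OF this]
        have "\<bar>\<mu> m * ?P \<mu> * ?Q \<mu>\<bar> \<le> 1" "\<bar>\<mu> m * ?R \<mu> * ?P \<mu> * ?Q \<mu>\<bar> \<le> 1" using b by (intro abs_mult_le_one; simp)+
        moreover have "\<mu> m * (1 + ?R \<mu>) * ?P \<mu> * ?Q \<mu> = \<mu> m * ?P \<mu> * ?Q \<mu> + \<mu> m * ?R \<mu> * ?P \<mu> * ?Q \<mu>" by algebra
        ultimately show "\<bar>\<mu> m * (1 + ?R \<mu>) * ?P \<mu> * ?Q \<mu>\<bar> \<le> 5" by linarith
      next
        fix p assume "p \<in> all_pairs"
        then show "bounded_symbol all_pairs p (\<lambda>x. bary v m x * (1 + bary v n x / (bary v n x + bary v l x)) *
          (bary v l x / (bary v n x + bary v l x)) * (bary v m x / (bary v n x + bary v m x)))"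
          using ap lmn by (intro S) auto
      qed
    next
      case 3
      show ?thesis
      proof (rule exI[where x="\<lambda>\<mu>. ?P \<mu> * ?P \<mu> * ?Q \<mu> * ?Q \<mu> * \<mu> m - ?P \<mu> * ?R \<mu> * \<mu> n * ?Q \<mu> * ?Q \<mu> - \<mu> m"], intro conjI allI impI ballI)
        fix \<mu> :: "nat \<Rightarrow> real" assume "\<forall>k\<in>{0..3}. 0 \<le> \<mu> k"
        then show "F \<mu> = \<mu> j * (?P \<mu> * ?P \<mu> * ?Q \<mu> * ?Q \<mu> * \<mu> m - ?P \<mu> * ?R \<mu> * \<mu> n * ?Q \<mu> * ?Q \<mu> - \<mu> m)"
          unfolding 3 by (intro Phi_n_factor) (use lmn in auto)
      next
        fix \<mu> :: "nat \<Rightarrow> real" assume "\<forall>k\<in>{0..3}. 0 \<le> \<mu> k \<and> \<mu> k \<le> 1"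
        note b = bd[OF this]
        have "\<bar>?P \<mu> * ?P \<mu> * ?Q \<mu> * ?Q \<mu> * \<mu> m\<bar> \<le> 1" "\<bar>?P \<mu> * ?R \<mu> * \<mu> n * ?Q \<mu> * ?Q \<mu>\<bar> \<le> 1"
          using b by (intro abs_mult_le_one; simp)+
        then show "\<bar>?P \<mu> * ?P \<mu> * ?Q \<mu> * ?Q \<mu> * \<mu> m - ?P \<mu> * ?R \<mu> * \<mu> n * ?Q \<mu> * ?Q \<mu> - \<mu> m\<bar> \<le> 5"
          by (rule three_abs) (use b in blast)
      next
        fix p assume "p \<in> all_pairs"
        then show "bounded_symbol all_pairs p (\<lambda>x. (bary v l x / (bary v n x + bary v l x)) * (bary v l x / (bary v n x + bary v l x)) *
           (bary v m x / (bary v n x + bary v m x)) * (bary v m x / (bary v n x + bary v m x)) * bary v m x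
          - (bary v l x / (bary v n x + bary v l x)) * (bary v n x / (bary v n x + bary v l x)) * bary v n x *
           (bary v m x / (bary v n x + bary v m x)) * (bary v m x / (bary v n x + bary v m x)) - bary v m x)"
          using ap lmn by (intro S) auto
      qed
    next
      case 4
      show ?thesis
      proof (rule exI[where x="\<lambda>\<mu>. 0 - (1 + ?P \<mu> * ?Q \<mu>) * (\<mu> m * ?P \<mu> + \<mu> l * ?P \<mu> * ?Q \<mu>) - ?P \<mu> * ?P \<mu> * ?Q \<mu> * ?Q \<mu> * \<mu> n"], intro conjI allI impI ballI)
        fix \<mu> :: "nat \<Rightarrow> real" assume "\<forall>k\<in>{0..3}. 0 \<le> \<mu> k"
        then show "F \<mu> = \<mu> j * (0 - (1 + ?P \<mu> * ?Q \<mu>) * (\<mu> m * ?P \<mu> + \<mu> l * ?P \<mu> * ?Q \<mu>) - ?P \<mu> * ?P \<mu> * ?Q \<mu> * ?Q \<mu> * \<mu> n)"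
          unfolding 4 by (intro Phi_n_factor) (use lmn in auto)
      next
        fix \<mu> :: "nat \<Rightarrow> real" assume "\<forall>k\<in>{0..3}. 0 \<le> \<mu> k \<and> \<mu> k \<le> 1"
        note b = bd[OF this]
        have "\<bar>\<mu> m * ?P \<mu>\<bar> \<le> 1" "\<bar>\<mu> l * ?P \<mu> * ?Q \<mu>\<bar> \<le> 1" "\<bar>?P \<mu> * ?Q \<mu> * (\<mu> m * ?P \<mu>)\<bar> \<le> 1"
          "\<bar>?P \<mu> * ?Q \<mu> * (\<mu> l * ?P \<mu> * ?Q \<mu>)\<bar> \<le> 1" "\<bar>?P \<mu> * ?P \<mu> * ?Q \<mu> * ?Q \<mu> * \<mu> n\<bar> \<le> 1"
          using b by (intro abs_mult_le_one; simp)+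
        moreover have "(1 + ?P \<mu> * ?Q \<mu>) * (\<mu> m * ?P \<mu> + \<mu> l * ?P \<mu> * ?Q \<mu>) =
          \<mu> m * ?P \<mu> + \<mu> l * ?P \<mu> * ?Q \<mu> + ?P \<mu> * ?Q \<mu> * (\<mu> m * ?P \<mu>) + ?P \<mu> * ?Q \<mu> * (\<mu> l * ?P \<mu> * ?Q \<mu>)" by algebra
        ultimately show "\<bar>0 - (1 + ?P \<mu> * ?Q \<mu>) * (\<mu> m * ?P \<mu> + \<mu> l * ?P \<mu> * ?Q \<mu>) - ?P \<mu> * ?P \<mu> * ?Q \<mu> * ?Q \<mu> * \<mu> n\<bar> \<le> 5"
          by linarith
      next
        fix p assume "p \<in> all_pairs"
        then show "bounded_symbol all_pairs p (\<lambda>x. 0 - (1 + (bary v l x / (bary v n x + bary v l x)) * (bary v m x / (bary v n x + bary v m x)))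
           * (bary v m x * (bary v l x / (bary v n x + bary v l x)) + bary v l x * (bary v l x / (bary v n x + bary v l x)) * (bary v m x / (bary v n x + bary v m x)))
          - (bary v l x / (bary v n x + bary v l x)) * (bary v l x / (bary v n x + bary v l x)) *
           (bary v m x / (bary v n x + bary v m x)) * (bary v m x / (bary v n x + bary v m x)) * bary v n x)"
          using ap lmn by (intro S) auto
      qed
    qed
  qed
  obtain l m n where lmn: "{l, m, n} = {0..3} - {i}" "l \<noteq> m" "n \<noteq> l" "n \<noteq> m" and F': "F = Phi_l l m n \<or> F = Phi_n l m n"
    using F by (rule PhisE)
  have "l \<in> {l, m, n}" "m \<in> {l, m, n}" "n \<in> {l, m, n}" by auto
  then have in3: "l \<in> {0..3}" "m \<in> {0..3}" "n \<in> {0..3}" unfolding lmn(1) by blast+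
  have "j = l \<or> j = m \<or> j = n" using j unfolding lmn(1)[symmetric] by blast
  moreover have "Phi_n l m n = Phi_n m l n" by (auto simp: Phi_n_def mult_ac)
  ultimately consider "j = l \<or> j = n" | "F = Phi_l l m n" "j = m" | "F = Phi_n m l n" "j = m"
    using F' by argo
  then show ?thesis
  proof cases
    case 1 show ?thesis by (rule *[OF in3 lmn(2-4)]) (use 1 F' in blast)
  next
    case 2 show ?thesis by (rule *[OF in3 lmn(2-4)]) (use 2 in blast)
  next
    case 3 show ?thesis by (rule *[OF in3(2,1,3) lmn(2)[symmetric] lmn(4,3)]) (use 3 in blast)
  qed
qed

end

section \<open>Quadratics, spans of face functions, and lifts\<close>

lemma lin_span_mono_closed:
  assumes "f \<in> lin_span B" "B \<subseteq> lin_span C" shows "f \<in> lin_span C"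
  using assms(1)
proof (rule lin_span_induct)
  show "(\<lambda>x. c * b x + g x) \<in> lin_span C" if "b \<in> B" "g \<in> lin_span C" for b c g
    using that assms(2) by (intro lin_span_add lin_span_scale) auto
qed (rule lin_span_zero)

lemma lin_span_mult:
  assumes f: "f \<in> lin_span B" and g: "g \<in> lin_span B'"
    and BC: "\<And>b b'. b \<in> B \<Longrightarrow> b' \<in> B' \<Longrightarrow> (\<lambda>x. b x * b' x) \<in> lin_span C"
  shows "(\<lambda>x. f x * g x) \<in> lin_span C"
  using f
proof (rule lin_span_induct)
  show "(\<lambda>x. 0 * g x) \<in> lin_span C" using lin_span_zero by simp
  fix b c h assume b: "b \<in> B" and h: "(\<lambda>x. h x * g x) \<in> lin_span C"
  have "(\<lambda>x. b x * g x) \<in> lin_span C"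
    using g
  proof (rule lin_span_induct)
    show "(\<lambda>x. b x * 0) \<in> lin_span C" using lin_span_zero by simp
    fix b' d k assume b': "b' \<in> B'" and k: "(\<lambda>x. b x * k x) \<in> lin_span C"
    have "(\<lambda>x. d * (b x * b' x) + b x * k x) \<in> lin_span C"
      by (intro lin_span_add lin_span_scale BC b b' k)
    then show "(\<lambda>x. b x * (d * b' x + k x)) \<in> lin_span C" by (simp add: algebra_simps)
  qed
  then have "(\<lambda>x. c * (b x * g x) + h x * g x) \<in> lin_span C"
    by (intro lin_span_add lin_span_scale h)
  then show "(\<lambda>x. (c * b x + h x) * g x) \<in> lin_span C" by (simp add: algebra_simps)
qed

lemma lin_span_sum:
  assumes "finite A" "\<And>k. k \<in> A \<Longrightarrow> f k \<in> lin_span B"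
  shows "(\<lambda>x. \<Sum>k\<in>A. f k x) \<in> lin_span B"
  using assms
proof (induction A rule: finite_induct)
  case empty then show ?case using lin_span_zero by simp
next
  case (insert a A) then show ?case using lin_span_add[of "f a" B "\<lambda>x. \<Sum>k\<in>A. f k x"] by simp
qed

lemma monomial_in_polys:
  fixes a :: "3 \<Rightarrow> nat"
  assumes "(\<Sum>i\<in>UNIV. a i) \<le> k" shows "(\<lambda>x. \<Prod>i\<in>UNIV. (x $ i) ^ a i) \<in> polys k"
  unfolding polys_def by (rule lin_span_base) (use assms in blast)

lemma polys_mult: "p \<in> polys j \<Longrightarrow> q \<in> polys k \<Longrightarrow> (\<lambda>x. p x * q x) \<in> polys (j + k)"
  unfolding polys_def
proof (erule lin_span_mult, assumption, goal_cases)
  case (1 b b')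
  then obtain a a' where a: "b = (\<lambda>x. \<Prod>i\<in>UNIV. (x $ i) ^ a i)" "(\<Sum>i\<in>UNIV. a i) \<le> j"
    "b' = (\<lambda>x. \<Prod>i\<in>UNIV. (x $ i) ^ a' i)" "(\<Sum>i\<in>UNIV. a' i) \<le> k"
    unfolding mem_Collect_eq by (elim exE conjE)
  have "(\<lambda>x. \<Prod>i\<in>UNIV. (x $ i) ^ (a i + a' i)) \<in> polys (j + k)"
    by (rule monomial_in_polys) (use a in \<open>simp add: sum.distrib\<close>)
  then show ?case unfolding polys_def a(1,3) by (simp add: power_add prod.distrib)
qed

lemma polys_add: "p \<in> polys k \<Longrightarrow> q \<in> polys k \<Longrightarrow> (\<lambda>x. p x + q x) \<in> polys k"
  and polys_scale: "p \<in> polys k \<Longrightarrow> (\<lambda>x. c * p x) \<in> polys k"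
  unfolding polys_def by (rule lin_span_add lin_span_scale; assumption)+

lemma polys_const: "(\<lambda>x. c) \<in> polys k"
  using polys_scale[OF monomial_in_polys[of "\<lambda>_. 0" k], of c] by simp

lemma polys_component: "(\<lambda>x. x $ i) \<in> polys 1"
proof -
  have "(\<lambda>x. \<Prod>j\<in>UNIV. (x $ j) ^ (if j = i then 1 else 0)) \<in> polys 1"
    by (rule monomial_in_polys) simp
  moreover have "(\<Prod>j\<in>UNIV. (x $ j) ^ (if j = i then 1 else 0)) = x $ i" for x :: point
    by (simp add: if_distrib cong: if_cong)
  ultimately show ?thesis by simp
qed

lemma prod_UNIV_3: "prod f (UNIV :: 3 set) = f 1 * (f 2 * (f 3 :: real))"
  unfolding UNIV_3 by simp

lemma three_exponents:
  assumes "a + b + c \<le> (2::nat)"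
  obtains "a = 0" "b = 0" "c = 0" | "a = 1" "b = 0" "c = 0" | "a = 0" "b = 1" "c = 0" | "a = 0" "b = 0" "c = 1"
    | "a = 2" "b = 0" "c = 0" | "a = 0" "b = 2" "c = 0" | "a = 0" "b = 0" "c = 2"
    | "a = 1" "b = 1" "c = 0" | "a = 1" "b = 0" "c = 1" | "a = 0" "b = 1" "c = 1"
proof -
  have "a = 0 \<or> a = 1 \<or> a = 2" "b = 0 \<or> b = 1 \<or> b = 2" "c = 0 \<or> c = 1 \<or> c = 2" using assms by linarith+
  then show ?thesis by (elim disjE; hypsubst) (use assms that in simp_all)
qed

context tetrahedron
begin

definition bary_quadratics :: "(point \<Rightarrow> real) set" where
  "bary_quadratics = lin_span {(\<lambda>x. bary v j x * bary v k x) | j k. j \<in> {0..3} \<and> k \<in> {0..3}}"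

lemma bary_polys1: assumes "k \<in> {0..3}" shows "bary v k \<in> polys 1"
proof -
  have "(\<lambda>x. bary v k 0 + (\<Sum>i\<in>UNIV. gl k $ i * x $ i)) \<in> polys 1"
    by (intro polys_add polys_const)
       (use polys_component in \<open>auto simp: polys_def intro!: lin_span_sum lin_span_scale\<close>)
  moreover have "bary v k = (\<lambda>x. bary v k 0 + (\<Sum>i\<in>UNIV. gl k $ i * x $ i))"
    by (rule ext) (subst bary_linear[OF assms], simp add: inner_vec_def)
  ultimately show ?thesis by simp
qed

lemma bary_product_polys2: "j \<in> {0..3} \<Longrightarrow> k \<in> {0..3} \<Longrightarrow> (\<lambda>x. bary v j x * bary v k x) \<in> polys 2"
  using polys_mult[OF bary_polys1 bary_polys1, of j k] by (simp add: numeral_2_eq_2)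

lemma bary_polys2: "j \<in> {0..3} \<Longrightarrow> bary v j \<in> polys 2"
  using polys_mult[OF bary_polys1 polys_const[of 1 1]] by (simp add: numeral_2_eq_2)

text \<open>The constant 1 and the Cartesian coordinates are linear combinations of the \<open>\<lambda>\<^sub>k\<close>, so that monomials of
  degree at most 2 are quadratic forms in the \<open>\<lambda>\<^sub>k\<close>.\<close>

lemma polys2_subset: "polys 2 \<subseteq> bary_quadratics"
proof
  let ?L = "lin_span (bary v ` {0..3})"
  have mult: "(\<lambda>x. f x * g x) \<in> bary_quadratics" if "f \<in> ?L" "g \<in> ?L" for f g
    unfolding bary_quadratics_def by (rule lin_span_mult[OF that lin_span_base]) blast
  have L: "(\<lambda>x. \<Sum>k\<in>{0..3}. c k * bary v k x) \<in> ?L" for c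
    by (intro lin_span_sum lin_span_scale lin_span_base) auto
  have one: "(\<lambda>x. 1) \<in> ?L" using L[of "\<lambda>_. 1"] by (simp add: bary_sum)
  have comp: "(\<lambda>x. x $ i) \<in> ?L" for i
  proof -
    have "x $ i = (\<Sum>k\<in>{0..3}. (v k $ i) * bary v k x)" for x
    proof -
      have "(\<Sum>k\<in>{0..3}. bary v k x *\<^sub>R v k) $ i = (\<Sum>k\<in>{0..3}. (v k $ i) * bary v k x)"
        unfolding sum_component by (rule sum.cong) simp_all
      then show ?thesis unfolding bary_point .
    qed
    then have "(\<lambda>x. x $ i) = (\<lambda>x. \<Sum>k\<in>{0..3}. (v k $ i) * bary v k x)" by (rule ext)
    then show ?thesis using L[of "\<lambda>k. v k $ i"] by argo
  qed
  fix p assume "p \<in> polys 2"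
  then show "p \<in> bary_quadratics" unfolding bary_quadratics_def polys_def
  proof (rule lin_span_mono_closed, intro subsetI)
    fix b :: "point \<Rightarrow> real" assume "b \<in> {(\<lambda>x. \<Prod>i\<in>UNIV. (x $ i) ^ a i) | a :: 3 \<Rightarrow> nat. (\<Sum>i\<in>UNIV. a i) \<le> 2}"
    then obtain a :: "3 \<Rightarrow> nat" where a: "b = (\<lambda>x. \<Prod>i\<in>UNIV. (x $ i) ^ a i)" "(\<Sum>i\<in>UNIV. a i) \<le> 2"
      unfolding mem_Collect_eq by (elim exE conjE)
    have b: "b = (\<lambda>x. (x $ 1) ^ a 1 * ((x $ 2) ^ a 2 * (x $ 3) ^ a 3))" 
      unfolding a(1) prod_UNIV_3 by (rule refl)
    have s: "a 1 + a 2 + a 3 \<le> 2" using a(2) unfolding sum_3 .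
    note m = mult[OF one one] mult[OF comp one] mult[OF comp comp]
    have "b \<in> bary_quadratics"
      by (rule three_exponents[OF s]) (use m in \<open>simp_all add: b power2_eq_square\<close>)
    then show "b \<in> lin_span {(\<lambda>x. bary v j x * bary v k x) | j k. j \<in> {0..3} \<and> k \<in> {0..3}}"
      unfolding bary_quadratics_def .
  qed
qed

lemma bary_bounds: "x \<in> T \<Longrightarrow> k \<in> {0..3} \<Longrightarrow> 0 \<le> bary v k x \<and> bary v k x \<le> 1"
  using tet_iff bary_le_one by blast

lemma continuous_if_bounded_by_bary:
  fixes f :: "point \<Rightarrow> real"
  assumes x: "x \<in> T" and j: "j \<in> {0..3}" "bary v j x = 0" and bd: "\<And>y. y \<in> T \<Longrightarrow> \<bar>f y\<bar> \<le> C * bary v j y"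
  shows "(f \<longlongrightarrow> f x) (at x within T)"
proof -
  have "f x = 0" using bd[OF x] j by simp
  moreover have "(f \<longlongrightarrow> 0) (at x within T)"
  proof (rule Lim_null_comparison)
    show "\<forall>\<^sub>F y in at x within T. norm (f y) \<le> C * bary v j y"
      using bd by (simp add: eventually_at_filter)
    have "(bary v j \<longlongrightarrow> 0) (at x within T)"
      using bary_continuous[OF j(1), of T] x j(2) by (auto simp: continuous_on_def)
    then show "((\<lambda>y. C * bary v j y) \<longlongrightarrow> 0) (at x within T)" by (rule tendsto_mult_right_zero)
  qed
  ultimately show ?thesis by simp
qed

lemma Phi_indices:
  assumes "{l, m, n} = {0..3} - {i}"
  shows "l \<in> {0..3}" "m \<in> {0..3}" "n \<in> {0..3}" "l \<noteq> i" "m \<noteq> i" "n \<noteq> i"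
  using assms by blast+

lemma Phi_bound:
  assumes F: "F \<in> Phis i" and j: "j \<in> {0..3} - {i}" and x: "x \<in> T"
  shows "\<bar>F (\<lambda>k. bary v k x)\<bar> \<le> 5 * bary v j x"
proof -
  obtain h where h: "\<And>\<mu>. (\<forall>k\<in>{0..3}. 0 \<le> \<mu> k) \<Longrightarrow> F \<mu> = \<mu> j * h \<mu>"
    "\<And>\<mu>. (\<forall>k\<in>{0..3}. 0 \<le> \<mu> k \<and> \<mu> k \<le> 1) \<Longrightarrow> \<bar>h \<mu>\<bar> \<le> 5"
    using Phi_factor[OF F j] by auto
  have j0: "0 \<le> bary v j x" using bary_bounds[OF x] j by blast
  have "\<bar>F (\<lambda>k. bary v k x)\<bar> = bary v j x * \<bar>h (\<lambda>k. bary v k x)\<bar>"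
    using h(1)[of "\<lambda>k. bary v k x"] bary_bounds[OF x] j0 by (simp add: abs_mult)
  also have "\<dots> \<le> bary v j x * 5"
    using h(2)[of "\<lambda>k. bary v k x"] bary_bounds[OF x] j0 by (intro mult_left_mono) auto
  finally show ?thesis by simp
qed

text \<open>At a point where one of the three coordinates vanishes, the function is bounded by that coordinate;
  elsewhere no denominator vanishes.\<close>

lemma Phi_continuous:
  assumes F: "F \<in> Phis i"
  shows "continuous_on T (\<lambda>x. F (\<lambda>k. bary v k x))"
  unfolding continuous_on_def
proof
  fix x assume x: "x \<in> T"
  show "((\<lambda>x. F (\<lambda>k. bary v k x)) \<longlongrightarrow> F (\<lambda>k. bary v k x)) (at x within T)"
  proof (cases "\<exists>j\<in>{0..3} - {i}. bary v j x = 0")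
    case True
    then obtain j where j: "j \<in> {0..3} - {i}" "bary v j x = 0" by blast
    show ?thesis
      by (rule continuous_if_bounded_by_bary[OF x _ j(2)]) (use j Phi_bound[OF F j(1)] in auto)
  next
    case False
    obtain l m n where lmn: "{l, m, n} = {0..3} - {i}" and F': "F = Phi_l l m n \<or> F = Phi_n l m n"
      using F by (rule PhisE)
    note idx = Phi_indices[OF lmn]
    have pos: "0 < bary v k x" if "k \<in> {0..3}" "k \<noteq> i" for k
      using that False bary_bounds[OF x that(1)] by fastforce
    have t: "(bary v k \<longlongrightarrow> bary v k x) (at x within T)" if "k \<in> {0..3}" for k
      using bary_continuous[OF that, of T] x by (auto simp: continuous_on_def)
    have ne: "bary v n x + bary v l x \<noteq> 0" "bary v n x + bary v m x \<noteq> 0"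
      using pos[OF idx(1,4)] pos[OF idx(2,5)] pos[OF idx(3,6)] by linarith+
    show ?thesis
      using F'
    proof
      assume "F = Phi_l l m n"
      then show ?thesis unfolding Phi_l_def using ne by (auto intro!: tendsto_intros t idx)
    next
      assume "F = Phi_n l m n"
      then show ?thesis unfolding Phi_n_def using ne by (auto intro!: tendsto_intros t idx)
    qed
  qed
qed

lemma Phi_space_induct:
  assumes \<phi>: "\<phi> \<in> Phi_space v i" and "P (\<lambda>x. 0)"
    and step: "\<And>F c g. F \<in> Phis i \<Longrightarrow> P g \<Longrightarrow> P (\<lambda>x. c * F (\<lambda>j. bary v j x) + g x)"
  shows "P \<phi>"
  using \<phi> unfolding Phi_space_def
proof (rule lin_span_induct[where P=P])
  fix b c g assume "b \<in> (\<lambda>F x. F (\<lambda>j. bary v j x)) ` Phis i" "P g"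
  then show "P (\<lambda>x. c * b x + g x)" using step by auto
qed (rule assms(2))

lemma Phi_space_continuous: "\<phi> \<in> Phi_space v i \<Longrightarrow> continuous_on T \<phi>"
proof (erule Phi_space_induct[where P="continuous_on T"])
  show "continuous_on T (\<lambda>x. c * F (\<lambda>j. bary v j x) + g x)" if "F \<in> Phis i" "continuous_on T g" for F c g
    by (intro continuous_intros Phi_continuous[OF that(1)] that(2))
qed simp

lemma Phi_space_vanish:
  assumes "\<phi> \<in> Phi_space v i" and j: "j \<in> {0..3} - {i}" and x: "x \<in> T" "bary v j x = 0"
  shows "\<phi> x = 0"
  by (rule Phi_space_induct[where P="\<lambda>\<phi>. \<phi> x = 0", OF assms(1)])
    (use Phi_bound[OF _ j x(1)] x(2) in force)+

lemma Phi_homogeneous: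
  assumes F: "F \<in> Phis i" and s: "s > 0" and eq: "\<And>j. j \<in> {0..3} - {i} \<Longrightarrow> \<mu>' j = s * \<mu> j"
  shows "F \<mu>' = s\<^sup>2 * F \<mu>"
proof -
  obtain l m n where lmn: "{l, m, n} = {0..3} - {i}" and F': "F = Phi_l l m n \<or> F = Phi_n l m n"
    using F by (rule PhisE)
  have e: "\<mu>' l = s * \<mu> l" "\<mu>' m = s * \<mu> m" "\<mu>' n = s * \<mu> n" using eq lmn by blast+
  have d: "s * a + s * b = s * (a + b)" "2 * (s * a) + s * b = s * (2 * a + b)" for a b by (simp_all add: algebra_simps)
  have c1: "s * a * (s * b) * (s * c)\<^sup>2 * (s * d) / ((s * f)\<^sup>2 * (s * g)) = s\<^sup>2 * (a * b * c\<^sup>2 * d / (f\<^sup>2 * g))" for a b c d f g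
  proof -
    have "s * a * (s * b) * (s * c)\<^sup>2 * (s * d) = (s\<^sup>2 * s) * (s\<^sup>2 * (a * b * c\<^sup>2 * d))"
      by (simp add: power2_eq_square)
    moreover have "(s * f)\<^sup>2 * (s * g) = (s\<^sup>2 * s) * (f\<^sup>2 * g)" by (simp add: power2_eq_square)
    moreover have "s\<^sup>2 * s \<noteq> 0" using s by simp
    note mult_divide_mult_cancel_left[OF this, of "s\<^sup>2 * (a * b * c\<^sup>2 * d)" "f\<^sup>2 * g"]
    ultimately show ?thesis by (simp only: times_divide_eq_right)
  qed
  have c2: "(s * a)\<^sup>2 * (s * b)\<^sup>2 * (s * a * (s * b) - (s * c)\<^sup>2) / ((s * f)\<^sup>2 * (s * g)\<^sup>2) - s * a * (s * b)
      = s\<^sup>2 * (a\<^sup>2 * b\<^sup>2 * (a * b - c\<^sup>2) / (f\<^sup>2 * g\<^sup>2) - a * b)" for a b c f g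
  proof -
    have "(s * a)\<^sup>2 * (s * b)\<^sup>2 * (s * a * (s * b) - (s * c)\<^sup>2) = (s\<^sup>2 * s\<^sup>2) * (s\<^sup>2 * (a\<^sup>2 * b\<^sup>2 * (a * b - c\<^sup>2)))"
      by (simp add: power2_eq_square algebra_simps)
    moreover have "(s * f)\<^sup>2 * (s * g)\<^sup>2 = (s\<^sup>2 * s\<^sup>2) * (f\<^sup>2 * g\<^sup>2)" by (simp add: power2_eq_square)
    moreover have "s\<^sup>2 * s\<^sup>2 \<noteq> 0" using s by simp
    note mult_divide_mult_cancel_left[OF this, of "s\<^sup>2 * (a\<^sup>2 * b\<^sup>2 * (a * b - c\<^sup>2))" "f\<^sup>2 * g\<^sup>2"]
    ultimately have "(s * a)\<^sup>2 * (s * b)\<^sup>2 * (s * a * (s * b) - (s * c)\<^sup>2) / ((s * f)\<^sup>2 * (s * g)\<^sup>2)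
        = s\<^sup>2 * (a\<^sup>2 * b\<^sup>2 * (a * b - c\<^sup>2)) / (f\<^sup>2 * g\<^sup>2)"
      by (simp only:)
    then show ?thesis by (simp add: power2_eq_square algebra_simps)
  qed
  show ?thesis using F'
  proof
    assume "F = Phi_l l m n"
    then show ?thesis unfolding Phi_l_def by (simp only: e d c1)
  next
    assume "F = Phi_n l m n"
    then show ?thesis unfolding Phi_n_def by (simp only: e d c2)
  qed
qed

lemma Phi_space_homogeneous:
  assumes \<phi>: "\<phi> \<in> Phi_space v i" and s: "s > 0" and eq: "\<And>j. j \<in> {0..3} - {i} \<Longrightarrow> bary v j y = s * bary v j x"
  shows "\<phi> y = s\<^sup>2 * \<phi> x"
proof (rule Phi_space_induct[where P="\<lambda>\<phi>. \<phi> y = s\<^sup>2 * \<phi> x", OF \<phi>])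
  fix F c g assume F: "F \<in> Phis i" and g: "g y = s\<^sup>2 * g x"
  have "F (\<lambda>j. bary v j y) = s\<^sup>2 * F (\<lambda>j. bary v j x)" by (rule Phi_homogeneous[OF F s eq])
  then show "c * F (\<lambda>j. bary v j y) + g y = s\<^sup>2 * (c * F (\<lambda>j. bary v j x) + g x)"
    using g by (simp add: algebra_simps)
qed simp

lemma Phi_space_add: "\<phi> \<in> Phi_space v i \<Longrightarrow> \<psi> \<in> Phi_space v i \<Longrightarrow> (\<lambda>x. \<phi> x + \<psi> x) \<in> Phi_space v i"
  and Phi_space_scale: "\<phi> \<in> Phi_space v i \<Longrightarrow> (\<lambda>x. c * \<phi> x) \<in> Phi_space v i"
  and Phi_space_zero: "(\<lambda>x. 0) \<in> Phi_space v i"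
  unfolding Phi_space_def by (rule lin_span_add lin_span_scale lin_span_zero; assumption?)+

text \<open>The ray from the vertex \<open>v i\<close> through \<open>x\<close> meets the face in a point whose coordinates are those of \<open>x\<close>
  up to a common factor. The face functions are homogeneous, and they vanish at \<open>v i\<close> itself.\<close>

lemma Phi_space_determined_on_face:
  assumes \<phi>: "\<phi> \<in> Phi_space v i" and i: "i \<in> {0..3}" and z: "\<And>x. x \<in> face v i \<Longrightarrow> \<phi> x = 0" and x: "x \<in> T"
  shows "\<phi> x = 0"
proof (cases "bary v i x = 1")
  case True
  have sum: "(\<Sum>k\<in>{0..3} - {i}. bary v k x) = 0"
    using bary_sum[of x] sum.remove[of "{0..3}" i "\<lambda>k. bary v k x"] i True by simp
  define j where "j = (if i = 0 then 1 else 0 :: nat)"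
  have j: "j \<in> {0..3} - {i}" by (auto simp: j_def)
  have "bary v j x = 0" using sum sum_nonneg_eq_0_iff[of "{0..3} - {i}" "\<lambda>k. bary v k x"] bary_bounds[OF x] j by auto
  then show ?thesis using Phi_space_vanish[OF \<phi> j x] by simp
next
  case False
  define s where "s = 1 - bary v i x"
  have s: "s > 0" using False bary_bounds[OF x i] by (simp add: s_def)
  define u where "u = (\<lambda>k. if k = i then 0 else bary v k x / s)"
  have sum: "(\<Sum>k\<in>{0..3} - {i}. bary v k x) = s"
    using bary_sum[of x] sum.remove[of "{0..3}" i "\<lambda>k. bary v k x"] i by (simp add: s_def)
  have "(\<Sum>k\<in>{0..3}. u k) = (\<Sum>k\<in>{0..3} - {i}. bary v k x) / s"
    using sum.remove[of "{0..3}" i u] i by (simp add: u_def sum_divide_distrib)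
  then have u1: "(\<Sum>k\<in>{0..3}. u k) = 1" using sum s by simp
  define y where "y = (\<Sum>k\<in>{0..3}. u k *\<^sub>R v k)"
  have b: "bary v k y = u k" if "k \<in> {0..3}" for k
    by (rule bary_eqI[OF u1 _ that]) (simp add: y_def)
  have "y \<in> face v i"
    using i s bary_bounds[OF x] by (auto simp: face_def tet_iff b u_def)
  moreover have "\<phi> x = s\<^sup>2 * \<phi> y"
    by (rule Phi_space_homogeneous[OF \<phi> s]) (use b s in \<open>auto simp: u_def\<close>)
  ultimately show ?thesis using z by simp
qed

lemma bsym_prod:
  assumes "p \<in> all_pairs" "finite A" "\<And>k. k \<in> A \<Longrightarrow> bounded_symbol all_pairs p (f k)"
  shows "bounded_symbol all_pairs p (\<lambda>x. \<Prod>k\<in>A. f k x)"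
  using assms(2,3)
proof (induction A rule: finite_induct)
  case empty then show ?case using bsym_const[OF order_refl assms(1)] by simp
next
  case (insert a A)
  then show ?case using bsym_mult[OF order_refl assms(1), of "f a" "\<lambda>x. \<Prod>k\<in>A. f k x"] by simp
qed

text \<open>The product of \<open>\<lambda>\<^sub>i\<close> and \<open>\<lambda>\<^sub>j / (\<lambda>\<^sub>i + \<lambda>\<^sub>j)\<close> is symmetric in \<open>i\<close> and \<open>j\<close>, hence divisible by \<open>\<lambda>\<^sub>j\<close> as well as
  by \<open>\<lambda>\<^sub>i\<close>.\<close>

lemma Theta_factor:
  assumes i: "i \<in> {0..3}" and j: "j \<in> {0..3}"
  shows "\<exists>h. (\<forall>p\<in>all_pairs. bounded_symbol all_pairs p h) \<and> (\<forall>x\<in>I. bary v i x * Theta v i x = bary v j x * h x \<and> \<bar>h x\<bar> \<le> 1)"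
proof -
  let ?r = "\<lambda>k x. bary v k x / (bary v i x + bary v k x)"
  have pos: "0 < bary v k x" if "x \<in> I" "k \<in> {0..3}" for k x using that interior_iff by blast
  have pr: "\<bar>\<Prod>k\<in>A. ?r k x\<bar> \<le> 1" if "x \<in> I" "A \<subseteq> {0..3}" for A x
    unfolding abs_prod
  proof (rule prod_le_1)
    fix k assume "k \<in> A"
    then have "0 \<le> bary v k x" "0 \<le> bary v i x" using pos[OF that(1)] that(2) i less_imp_le by blast+
    then show "0 \<le> \<bar>?r k x\<bar> \<and> \<bar>?r k x\<bar> \<le> 1" using ratio_le_one(2) by simp
  qed
  have S: "bounded_symbol all_pairs p (\<lambda>x. \<Prod>k\<in>A. ?r k x)" if "p \<in> all_pairs" "A \<subseteq> {0..3} - {i}" for A p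
  proof (rule bsym_prod[OF that(1)])
    show "finite A" using that(2) finite_subset by blast
    fix k assume "k \<in> A"
    then have "(k, i) \<in> all_pairs" using that(2) i by (auto simp: all_pairs_def)
    then show "bounded_symbol all_pairs p (?r k)" by (intro bsym_ratio(2)[OF order_refl that(1)] disjI1)
  qed
  show ?thesis
  proof (cases "j = i")
    case True
    show ?thesis
      by (rule exI[where x="Theta v i"])
        (use True S[of _ "{0..3} - {i}"] pr[of _ "{0..3} - {i}"] in \<open>simp add: Theta_def[abs_def]\<close>)
  next
    case False
    let ?A = "{0..3} - {i} - {j}"
    let ?h = "\<lambda>x. bary v i x / (bary v i x + bary v j x) * (\<Prod>k\<in>?A. ?r k x)"
    have ij: "(i, j) \<in> all_pairs" using i j False by (auto simp: all_pairs_def)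
    show ?thesis
    proof (rule exI[where x="?h"], intro conjI ballI)
      show "bounded_symbol all_pairs p ?h" if "p \<in> all_pairs" for p
        by (intro bsym_mult[OF order_refl that] bsym_ratio(1)[OF order_refl that] S that) (use ij in auto)
      fix x assume x: "x \<in> I"
      have "Theta v i x = ?r j x * (\<Prod>k\<in>?A. ?r k x)"
        unfolding Theta_def by (rule prod.remove) (use j False in auto)
      then show "bary v i x * Theta v i x = bary v j x * ?h x" by simp
      have "0 \<le> bary v i x" "0 \<le> bary v j x" using pos[OF x] i j less_imp_le by blast+
      then show "\<bar>?h x\<bar> \<le> 1" by (intro abs_mult_le_one pr x ratio_le_one(1)) auto
    qed
  qed
qed

definition lift :: "nat \<Rightarrow> (point \<Rightarrow> real) \<Rightarrow> point \<Rightarrow> real" where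
  "lift i \<phi> x = bary v i x * Theta v i x * \<phi> x"

text \<open>One coordinate of a given pair is split off \<open>\<lambda>\<^sub>i \<Theta>\<^sub>i\<close>, which all four coordinates divide, the other one
  off the face function, which is divisible by all of them but \<open>\<lambda>\<^sub>i\<close>.\<close>

lemma C2_lift:
  assumes \<phi>: "\<phi> \<in> Phi_space v i" and i: "i \<in> {0..3}"
  shows "C2_bounded I (lift i \<phi>)"
proof (rule Phi_space_induct[where P="\<lambda>\<phi>. C2_bounded I (lift i \<phi>)", OF \<phi>])
  show "C2_bounded I (lift i (\<lambda>x. 0))" using C2_const[of 0] by (simp add: lift_def[abs_def])
next
  fix F c g assume F: "F \<in> Phis i" and g: "C2_bounded I (lift i g)"
  have "C2_bounded I (lift i (\<lambda>x. F (\<lambda>j. bary v j x)))"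
  proof (rule C2_bounded_if_pairs_divide[OF order_refl])
    have "(0, 1) \<in> all_pairs" by (simp add: all_pairs_def)
    then show "all_pairs \<noteq> {}" by blast
    fix a b assume ab: "(a, b) \<in> all_pairs"
    define c d where "c = (if b = i then b else a)" and "d = (if b = i then a else b)"
    have cd: "c \<in> {0..3}" "d \<in> {0..3} - {i}" using ab by (auto simp: c_def d_def all_pairs_def)
    have e: "bary v a x * bary v b x = bary v c x * bary v d x" for x by (simp add: c_def d_def)
    obtain h where h: "\<And>p. p \<in> all_pairs \<Longrightarrow> bounded_symbol all_pairs p h"
      "\<And>x. x \<in> I \<Longrightarrow> bary v i x * Theta v i x = bary v c x * h x" using Theta_factor[OF i cd(1)] by blast
    obtain k where k1: "\<And>\<mu>. (\<forall>k\<in>{0..3}. 0 \<le> \<mu> k) \<Longrightarrow> F \<mu> = \<mu> d * k \<mu>"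
      and k2: "\<And>p. p \<in> all_pairs \<Longrightarrow> bounded_symbol all_pairs p (\<lambda>x. k (\<lambda>j. bary v j x))"
      using Phi_factor[OF F cd(2)] by blast
    have "bounded_symbol all_pairs (a, b) (\<lambda>x. h x * k (\<lambda>j. bary v j x))"
      by (intro bsym_mult[OF order_refl ab] h k2 ab)
    moreover have "lift i (\<lambda>x. F (\<lambda>j. bary v j x)) x = bary v a x * bary v b x * (h x * k (\<lambda>j. bary v j x))" if "x \<in> I" for x
    proof -
      have "F (\<lambda>j. bary v j x) = bary v d x * k (\<lambda>j. bary v j x)"
        by (rule k1) (use bary_bounds[OF I_subset[OF that]] in auto)
      then show ?thesis unfolding e lift_def h(2)[OF that] by simp
    qed
    ultimately show "\<exists>h. bounded_symbol all_pairs (a, b) h \<and>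
        (\<forall>x\<in>I. lift i (\<lambda>x. F (\<lambda>j. bary v j x)) x = bary v a x * bary v b x * h x)" by blast
  qed
  from symbol_add[OF C2_bounded_scale[OF this, of c] g]
  show "C2_bounded I (lift i (\<lambda>x. c * F (\<lambda>j. bary v j x) + g x))"
    by (simp add: lift_def[abs_def] algebra_simps)
qed

text \<open>On the other faces the lift vanishes to second order; on its own face its gradient is the
  lifted function in the direction of \<open>\<nabla>\<lambda>\<^sub>i\<close>, because there \<open>\<Theta>\<^sub>i = 1\<close>.\<close>

lemma lift_other_face:
  assumes \<phi>: "\<phi> \<in> Phi_space v i" and i: "i \<in> {0..3}" and j: "j \<in> {0..3} - {i}" and x: "x \<in> T" "bary v j x = 0"
  shows "val (lift i \<phi>) x = 0" "grd (lift i \<phi>) x = 0"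
proof -
  have jj: "j \<in> {0..3}" using j by blast
  obtain h where h: "\<And>x. x \<in> I \<Longrightarrow> bary v i x * Theta v i x = bary v j x * h x" "\<And>x. x \<in> I \<Longrightarrow> \<bar>h x\<bar> \<le> 1"
    using Theta_factor[OF i jj] by blast
  have "(\<phi> \<longlongrightarrow> \<phi> x) (at x within T)"
    using Phi_space_continuous[OF \<phi>] x(1) by (auto simp: continuous_on_def)
  then have "(\<phi> \<longlongrightarrow> 0) (at x within I)"
    unfolding Phi_space_vanish[OF \<phi> j x] using interior_subset by (rule tendsto_within_subset)
  then have "((\<lambda>y. norm (\<phi> y)) \<longlongrightarrow> 0) (at x within I)" by (rule tendsto_norm_zero)
  then have K: "((\<lambda>y. h y * \<phi> y) \<longlongrightarrow> 0) (at x within I)"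
  proof (rule Lim_null_comparison[rotated])
    show "\<forall>\<^sub>F y in at x within I. norm (h y * \<phi> y) \<le> norm (\<phi> y)"
      unfolding eventually_at_filter
      using h(2) by (intro always_eventually) (auto simp: abs_mult intro!: mult_left_le_one_le)
  qed
  have eq: "lift i \<phi> y = bary v j y * (h y * \<phi> y)" if "y \<in> I" for y
    using h(1)[OF that] by (simp add: lift_def)
  show "val (lift i \<phi>) x = 0" "grd (lift i \<phi>) x = 0"
    using C2_grd_at_face[OF C2_lift[OF \<phi> i] jj x eq K] by simp_all
qed

lemma lift_own_face:
  assumes \<phi>: "\<phi> \<in> Phi_space v i" and i: "i \<in> {0..3}" and x: "x \<in> T" "bary v i x = 0"
  shows "val (lift i \<phi>) x = 0" "(\<And>j. j \<in> {0..3} - {i} \<Longrightarrow> bary v j x \<noteq> 0) \<Longrightarrow> grd (lift i \<phi>) x = \<phi> x *\<^sub>R gl i"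
proof -
  have eq: "lift i \<phi> y = bary v i y * (Theta v i y * \<phi> y)" for y by (simp add: lift_def)
  have p: "(\<phi> \<longlongrightarrow> \<phi> x) (at x within T)"
    using Phi_space_continuous[OF \<phi>] x(1) by (auto simp: continuous_on_def)
  have t: "(bary v k \<longlongrightarrow> bary v k x) (at x within T)" if "k \<in> {0..3}" for k
    using bary_continuous[OF that, of T] x by (auto simp: continuous_on_def)
  have g: "val (lift i \<phi>) x = 0 \<and> grd (lift i \<phi>) x = \<phi> x *\<^sub>R gl i" if ne: "\<And>j. j \<in> {0..3} - {i} \<Longrightarrow> bary v j x \<noteq> 0"
  proof -
    have "((\<lambda>y. \<Prod>j\<in>{0..3} - {i}. bary v j y / (bary v i y + bary v j y))
        \<longlongrightarrow> (\<Prod>j\<in>{0..3} - {i}. bary v j x / (bary v i x + bary v j x))) (at x within T)"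
      by (intro tendsto_prod tendsto_divide tendsto_add t i) (use ne x(2) in auto)
    moreover have "(\<Prod>j\<in>{0..3} - {i}. bary v j x / (bary v i x + bary v j x)) = 1"
      by (rule prod.neutral) (use ne x(2) in auto)
    ultimately have "(Theta v i \<longlongrightarrow> 1) (at x within T)" by (simp add: Theta_def[abs_def])
    then have "((\<lambda>y. Theta v i y * \<phi> y) \<longlongrightarrow> 1 * \<phi> x) (at x within T)" using p by (rule tendsto_mult)
    then have K: "((\<lambda>y. Theta v i y * \<phi> y) \<longlongrightarrow> 1 * \<phi> x) (at x within I)"
      using interior_subset by (rule tendsto_within_subset)
    show ?thesis using C2_grd_at_face[OF C2_lift[OF \<phi> i] i x eq K] by simp
  qed
  then show "(\<And>j. j \<in> {0..3} - {i} \<Longrightarrow> bary v j x \<noteq> 0) \<Longrightarrow> grd (lift i \<phi>) x = \<phi> x *\<^sub>R gl i" by blast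
  show "val (lift i \<phi>) x = 0"
  proof (cases "\<forall>j\<in>{0..3} - {i}. bary v j x \<noteq> 0")
    case True then show ?thesis using g by blast
  next
    case False
    then obtain j where "j \<in> {0..3} - {i}" "bary v j x = 0" by blast
    from lift_other_face(1)[OF \<phi> i this(1) x(1) this(2)] show ?thesis .
  qed
qed

end

section \<open>The edge-enriched space\<close>

text \<open>The edge bubbles in the coordinates of the face that contains their three vertices.\<close>

definition bubble :: "real \<Rightarrow> real \<Rightarrow> real \<Rightarrow> real" where
  "bubble p q r = r * p\<^sup>2 * q\<^sup>2 / ((r + p) * (r + q))"

text \<open>The twelve-dimensional space of traces on a face: quadratics, antisymmetric cubics and three bubbles.\<close>

definition trace_form :: "(nat \<Rightarrow> real) \<Rightarrow> real \<Rightarrow> real \<Rightarrow> real \<Rightarrow> real" where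
  "trace_form c p q r = c 0 * p\<^sup>2 + c 1 * q\<^sup>2 + c 2 * r\<^sup>2 + c 3 * (p * q) + c 4 * (p * r) + c 5 * (q * r)
     + c 6 * (p\<^sup>2 * q - q\<^sup>2 * p) + c 7 * (p\<^sup>2 * r - r\<^sup>2 * p) + c 8 * (q\<^sup>2 * r - r\<^sup>2 * q)
     + c 9 * bubble p q r + c 10 * bubble p r q + c 11 * bubble q r p"

lemma trace_form_step: "trace_form (\<lambda>k. a * c k + d k) p q r = a * trace_form c p q r + trace_form d p q r"
  by (simp add: trace_form_def algebra_simps)

lemma trace_form_unit:
  fixes s :: real
  shows "trace_form (\<lambda>_. 0) p q r = 0"
  "trace_form (\<lambda>k. if k = 0 then s else 0) p q r = s * p\<^sup>2" "trace_form (\<lambda>k. if k = 1 then s else 0) p q r = s * q\<^sup>2"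
  "trace_form (\<lambda>k. if k = 2 then s else 0) p q r = s * r\<^sup>2" "trace_form (\<lambda>k. if k = 3 then s else 0) p q r = s * (p * q)"
  "trace_form (\<lambda>k. if k = 4 then s else 0) p q r = s * (p * r)" "trace_form (\<lambda>k. if k = 5 then s else 0) p q r = s * (q * r)"
  "trace_form (\<lambda>k. if k = 6 then s else 0) p q r = s * (p\<^sup>2 * q - q\<^sup>2 * p)"
  "trace_form (\<lambda>k. if k = 7 then s else 0) p q r = s * (p\<^sup>2 * r - r\<^sup>2 * p)"
  "trace_form (\<lambda>k. if k = 8 then s else 0) p q r = s * (q\<^sup>2 * r - r\<^sup>2 * q)"
  "trace_form (\<lambda>k. if k = 9 then s else 0) p q r = s * bubble p q r"
  "trace_form (\<lambda>k. if k = 10 then s else 0) p q r = s * bubble p r q"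
  "trace_form (\<lambda>k. if k = 11 then s else 0) p q r = s * bubble q r p"
  by (simp_all add: trace_form_def)

lemma bubble_commute: "bubble p q r = bubble q p r"
  by (simp add: bubble_def mult_ac)

lemma bubble_gradient_coefficient:
  fixes p q r :: real
  assumes "r + p \<noteq> 0" "r + q \<noteq> 0"
  shows "p\<^sup>2 / (r + p) * (q\<^sup>2 / (r + q)) - r * (p\<^sup>2 / (r + p)\<^sup>2) * (q\<^sup>2 / (r + q)) - r * (p\<^sup>2 / (r + p)) * (q\<^sup>2 / (r + q)\<^sup>2)
    = p\<^sup>2 * q\<^sup>2 * (p * q - r\<^sup>2) / ((r + p)\<^sup>2 * (r + q)\<^sup>2)"
proof -
  define s t where "s = r + p" and "t = r + q"
  have "p * q - r\<^sup>2 = s * t - r * t - r * s" by (simp add: s_def t_def power2_eq_square algebra_simps)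
  then show ?thesis
    using assms unfolding s_def[symmetric] t_def[symmetric] by (simp add: power2_eq_square divide_simps) (simp add: algebra_simps)
qed

context tetrahedron
begin

definition on_edge :: "nat \<Rightarrow> nat \<Rightarrow> point \<Rightarrow> bool" where
  "on_edge a b x \<longleftrightarrow> x \<in> T \<and> (\<forall>k\<in>{0..3} - {a, b}. bary v k x = 0)"

definition edge_quadratic :: "nat \<Rightarrow> nat \<Rightarrow> (point \<Rightarrow> point) \<Rightarrow> bool" where
  "edge_quadratic a b G \<longleftrightarrow> (\<exists>A B C. \<forall>x. on_edge a b x \<longrightarrow>
     G x = (bary v a x)\<^sup>2 *\<^sub>R A + (bary v a x * bary v b x) *\<^sub>R B + (bary v b x)\<^sup>2 *\<^sub>R C)"

lemma edge_quadraticI: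
  assumes "\<And>x. on_edge a b x \<Longrightarrow> G x = (bary v a x)\<^sup>2 *\<^sub>R A + (bary v a x * bary v b x) *\<^sub>R B + (bary v b x)\<^sup>2 *\<^sub>R C"
  shows "edge_quadratic a b G"
  unfolding edge_quadratic_def by (intro exI allI impI) (rule assms)

lemma edge_quadratic_step:
  assumes "edge_quadratic a b G" "edge_quadratic a b H"
  shows "edge_quadratic a b (\<lambda>x. c *\<^sub>R G x + H x)"
proof -
  obtain A B C where 1: "\<And>x. on_edge a b x \<Longrightarrow> G x = (bary v a x)\<^sup>2 *\<^sub>R A + (bary v a x * bary v b x) *\<^sub>R B + (bary v b x)\<^sup>2 *\<^sub>R C"
    using assms(1) unfolding edge_quadratic_def by blast
  obtain A' B' C' where 2: "\<And>x. on_edge a b x \<Longrightarrow> H x = (bary v a x)\<^sup>2 *\<^sub>R A' + (bary v a x * bary v b x) *\<^sub>R B' + (bary v b x)\<^sup>2 *\<^sub>R C'"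
    using assms(2) unfolding edge_quadratic_def by blast
  show ?thesis
    by (rule edge_quadraticI[where A="c *\<^sub>R A + A'" and B="c *\<^sub>R B + B'" and C="c *\<^sub>R C + C'"])
      (simp add: 1 2 algebra_simps)
qed

lemma edge_quadratic_cong:
  assumes "edge_quadratic a b G" "\<And>x. on_edge a b x \<Longrightarrow> H x = G x"
  shows "edge_quadratic a b H"
  using assms unfolding edge_quadratic_def by simp

lemma on_edge_sum:
  assumes "on_edge a b x" "a \<in> {0..3}" "b \<in> {0..3}" "a \<noteq> b"
  shows "bary v a x + bary v b x = 1"
proof -
  have "(\<Sum>k\<in>{0..3}. bary v k x) = (\<Sum>k\<in>{a, b}. bary v k x)"
    by (rule sum.mono_neutral_right) (use assms in \<open>auto simp: on_edge_def\<close>)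
  then show ?thesis using assms(4) bary_sum[of x] by simp
qed

lemma edge_quadratic_product:
  assumes "j \<in> {0..3}" "k \<in> {0..3}"
  shows "edge_quadratic a b (\<lambda>x. (bary v j x * bary v k x) *\<^sub>R g)"
proof (cases "j \<in> {a, b} \<and> k \<in> {a, b}")
  case False
  then have "j \<in> {0..3} - {a, b} \<or> k \<in> {0..3} - {a, b}" using assms by blast
  then show ?thesis
    by (intro edge_quadraticI[where A=0 and B=0 and C=0]) (auto simp: on_edge_def)
next
  case True
  then consider "j = a" "k = a" | "j = b" "k = b" | "j = a \<and> k = b \<or> j = b \<and> k = a" by blast
  then show ?thesis
  proof cases
    case 1 then show ?thesis by (intro edge_quadraticI[where A=g and B=0 and C=0]) (simp add: power2_eq_square)
  next
    case 2 then show ?thesis by (intro edge_quadraticI[where A=0 and B=0 and C=g]) (simp add: power2_eq_square)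
  next
    case 3 then show ?thesis by (intro edge_quadraticI[where A=0 and B=g and C=0]) (auto simp: mult.commute)
  qed
qed

lemma edge_quadratic_linear:
  assumes j: "j \<in> {0..3}" and ab: "a \<in> {0..3}" "b \<in> {0..3}" "a \<noteq> b"
  shows "edge_quadratic a b (\<lambda>x. bary v j x *\<^sub>R g)"
proof (rule edge_quadratic_cong)
  show "edge_quadratic a b (\<lambda>x. 1 *\<^sub>R ((bary v j x * bary v a x) *\<^sub>R g) + (bary v j x * bary v b x) *\<^sub>R g)"
    by (intro edge_quadratic_step edge_quadratic_product j ab)
  fix x assume "on_edge a b x"
  then have "bary v a x + bary v b x = 1" using ab by (rule on_edge_sum)
  then have "bary v j x = bary v j x * bary v a x + bary v j x * bary v b x"
    by (metis distrib_left mult.right_neutral)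
  then show "bary v j x *\<^sub>R g = 1 *\<^sub>R ((bary v j x * bary v a x) *\<^sub>R g) + (bary v j x * bary v b x) *\<^sub>R g"
    by (metis scaleR_add_left scaleR_one)
qed

definition normal_trace :: "nat \<Rightarrow> (point \<Rightarrow> point) \<Rightarrow> bool" where
  "normal_trace i G \<longleftrightarrow> (\<exists>p\<in>polys 2. \<exists>\<phi>\<in>Phi_space v i. \<forall>x\<in>face v i. G x \<bullet> outer_normal v i = p x + \<phi> x)"

definition face_trace :: "nat \<Rightarrow> nat \<Rightarrow> nat \<Rightarrow> nat \<Rightarrow> (point \<Rightarrow> real) \<Rightarrow> bool" where
  "face_trace i l m n f \<longleftrightarrow> (\<exists>c. \<forall>x\<in>face v i. f x = trace_form c (bary v l x) (bary v m x) (bary v n x))"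

text \<open>The properties of a function on which conformity rests. They are preserved by linear combinations, so
  it suffices to verify them for a spanning set of \<open>Z3e\<close>.\<close>

definition element_like :: "(point \<Rightarrow> real) \<Rightarrow> bool" where
  "element_like z \<longleftrightarrow> C2_bounded I z \<and> (\<forall>i\<in>{0..3}. normal_trace i (grd z)) \<and>
     (\<forall>a\<in>{0..3}. \<forall>b\<in>{0..3}. a \<noteq> b \<longrightarrow> edge_quadratic a b (grd z)) \<and>
     (\<forall>i l m n. {i, l, m, n} = {0..3} \<longrightarrow> face_trace i l m n (val z))"

lemma normal_trace_step:
  assumes "normal_trace i G" "normal_trace i H" "\<And>x. x \<in> face v i \<Longrightarrow> K x = c *\<^sub>R G x + H x"
  shows "normal_trace i K"
proof -
  obtain p \<phi> where 1: "p \<in> polys 2" "\<phi> \<in> Phi_space v i" "\<forall>x\<in>face v i. G x \<bullet> outer_normal v i = p x + \<phi> x"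
    using assms(1) unfolding normal_trace_def by (elim bexE)
  obtain q \<psi> where 2: "q \<in> polys 2" "\<psi> \<in> Phi_space v i" "\<forall>x\<in>face v i. H x \<bullet> outer_normal v i = q x + \<psi> x"
    using assms(2) unfolding normal_trace_def by (elim bexE)
  show ?thesis unfolding normal_trace_def
  proof (intro bexI ballI)
    show "K x \<bullet> outer_normal v i = (c * p x + q x) + (c * \<phi> x + \<psi> x)" if "x \<in> face v i" for x
      using bspec[OF 1(3) that] bspec[OF 2(3) that] by (simp add: assms(3)[OF that] inner_add_left algebra_simps)
    show "(\<lambda>x. c * \<phi> x + \<psi> x) \<in> Phi_space v i" by (intro Phi_space_add Phi_space_scale 1 2)
    show "(\<lambda>x. c * p x + q x) \<in> polys 2" by (intro polys_add polys_scale 1 2)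
  qed
qed

lemma face_subset: "x \<in> face v i \<Longrightarrow> x \<in> T" by (simp add: face_def)

lemma element_likeD:
  assumes "element_like z"
  shows "C2_bounded I z" "\<And>i. i \<in> {0..3} \<Longrightarrow> normal_trace i (grd z)"
    "\<And>a b. a \<in> {0..3} \<Longrightarrow> b \<in> {0..3} \<Longrightarrow> a \<noteq> b \<Longrightarrow> edge_quadratic a b (grd z)"
    "\<And>i l m n. {i, l, m, n} = {0..3} \<Longrightarrow> face_trace i l m n (val z)"
  using assms unfolding element_like_def by simp_all

lemma element_like_step:
  assumes f: "element_like f" and g: "element_like g" shows "element_like (\<lambda>x. c * f x + g x)"
proof -
  note C = element_likeD(1)[OF f] element_likeD(1)[OF g]
  have Cf: "C2_bounded I (\<lambda>x. c * f x)" using C(1) by (rule C2_bounded_scale)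
  have G: "grd (\<lambda>x. c * f x + g x) x = c *\<^sub>R grd f x + grd g x" if "x \<in> T" for x
    using C2_grd_add[OF Cf C(2) that] C2_grd_scale[OF C(1) that] by simp
  have V: "val (\<lambda>x. c * f x + g x) x = c * val f x + val g x" if "x \<in> T" for x
    using C2_val_add[OF Cf C(2) that] C2_val_scale[OF C(1) that] by simp
  show ?thesis unfolding element_like_def
  proof (intro conjI ballI allI impI)
    show "C2_bounded I (\<lambda>x. c * f x + g x)" using Cf C(2) by (rule symbol_add)
  next
    fix i :: nat assume i: "i \<in> {0..3}"
    show "normal_trace i (grd (\<lambda>x. c * f x + g x))"
      by (rule normal_trace_step[OF element_likeD(2)[OF f i] element_likeD(2)[OF g i] G[OF face_subset]])
  next
    fix a b :: nat assume ab: "a \<in> {0..3}" "b \<in> {0..3}" "a \<noteq> b"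
    have "edge_quadratic a b (\<lambda>x. c *\<^sub>R grd f x + grd g x)"
      by (intro edge_quadratic_step element_likeD(3) f g ab)
    then show "edge_quadratic a b (grd (\<lambda>x. c * f x + g x))"
      by (rule edge_quadratic_cong) (simp add: G on_edge_def)
  next
    fix i l m n :: nat assume e: "{i, l, m, n} = {0..3}"
    obtain d e where "\<forall>x\<in>face v i. val f x = trace_form d (bary v l x) (bary v m x) (bary v n x)"
      "\<forall>x\<in>face v i. val g x = trace_form e (bary v l x) (bary v m x) (bary v n x)"
      using element_likeD(4)[OF f e] element_likeD(4)[OF g e] unfolding face_trace_def by (elim exE)
    then show "face_trace i l m n (val (\<lambda>x. c * f x + g x))"
      unfolding face_trace_def by (intro exI[of _ "\<lambda>k. c * d k + e k"]) (simp add: V face_subset trace_form_step)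
  qed
qed

lemma val_eq: "continuous_on T f \<Longrightarrow> x \<in> T \<Longrightarrow> val f x = f x"
  by (rule cont_ext_eqI) auto

lemma grd_eq: "continuous_on T G \<Longrightarrow> (\<And>x. x \<in> I \<Longrightarrow> GDERIV f x :> G x) \<Longrightarrow> x \<in> T \<Longrightarrow> grd f x = G x"
  by (rule cont_ext_eqI) (auto intro: grad_eqI)

lemma other_index_zero:
  assumes "{i, l, m, n} = {0..3}" "j \<in> {0..3}"
  shows "j = i \<or> j = l \<or> j = m \<or> j = n"
  using assms by blast

lemma face_zero: "x \<in> face v i \<Longrightarrow> bary v i x = 0" by (simp add: face_def)

lemma normal_trace_quadratic:
  assumes "p \<in> polys 2" "\<And>x. x \<in> face v i \<Longrightarrow> G x \<bullet> outer_normal v i = p x"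
  shows "normal_trace i G"
  unfolding normal_trace_def
  by (rule bexI[OF _ assms(1)], rule bexI[OF _ Phi_space_zero]) (simp add: assms(2))

lemma element_like_product:
  assumes j: "j \<in> {0..3}" and k: "k \<in> {0..3}"
  shows "element_like (\<lambda>x. bary v j x * bary v k x)"
proof -
  have G: "grd (\<lambda>x. bary v j x * bary v k x) x = bary v j x *\<^sub>R gl k + bary v k x *\<^sub>R gl j" if "x \<in> T" for x
    by (rule grd_eq[OF _ _ that]) (intro continuous_intros bary_continuous j k, intro GDERIV_mult bary_GDERIV j k)
  have V: "val (\<lambda>x. bary v j x * bary v k x) x = bary v j x * bary v k x" if "x \<in> T" for x
    by (rule val_eq[OF _ that]) (intro continuous_intros bary_continuous j k)
  show ?thesis unfolding element_like_def
  proof (intro conjI ballI allI impI)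
    show "C2_bounded I (\<lambda>x. bary v j x * bary v k x)" by (intro C2_bounded_mult C2_bary j k)
  next
    fix i :: nat assume "i \<in> {0..3}"
    show "normal_trace i (grd (\<lambda>x. bary v j x * bary v k x))"
    proof (rule normal_trace_quadratic)
      show "(\<lambda>x. (gl k \<bullet> outer_normal v i) * bary v j x + (gl j \<bullet> outer_normal v i) * bary v k x) \<in> polys 2"
        by (intro polys_add polys_scale bary_polys2 j k)
    qed (simp add: G face_subset inner_add_left mult.commute)
  next
    fix a b :: nat assume ab: "a \<in> {0..3}" "b \<in> {0..3}" "a \<noteq> b"
    show "edge_quadratic a b (grd (\<lambda>x. bary v j x * bary v k x))"
    proof (rule edge_quadratic_cong)
      show "edge_quadratic a b (\<lambda>x. 1 *\<^sub>R (bary v j x *\<^sub>R gl k) + bary v k x *\<^sub>R gl j)"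
        by (intro edge_quadratic_step edge_quadratic_linear j k ab)
    qed (simp add: G on_edge_def)
  next
    fix i l m n :: nat assume e: "{i, l, m, n} = {0..3}"
    let ?u = "\<lambda>s k. if k = (s::nat) then 1 else (0::real)"
    have "\<exists>c. \<forall>x\<in>face v i. bary v j x * bary v k x = trace_form c (bary v l x) (bary v m x) (bary v n x)"
      using other_index_zero[OF e j] other_index_zero[OF e k]
    proof (elim disjE)
    qed (rule exI[where x="\<lambda>_. 0"] exI[where x="?u 0"] exI[where x="?u 1"] exI[where x="?u 2"] exI[where x="?u 3"] exI[where x="?u 4"] exI[where x="?u 5"],
         simp add: trace_form_unit face_zero power2_eq_square mult.commute del: One_nat_def; fail)+
    then show "face_trace i l m n (val (\<lambda>x. bary v j x * bary v k x))"
      unfolding face_trace_def by (simp add: V face_subset)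
  qed
qed

lemma element_like_zero: "element_like (\<lambda>x. 0)"
  using element_like_step[OF element_like_product[of 0 0] element_like_product[of 0 0], of "-1"] by simp

lemma element_like_cubic:
  assumes i: "i \<in> {0..3}" and j: "j \<in> {0..3}"
  shows "element_like (\<lambda>x. (bary v i x)\<^sup>2 * bary v j x - (bary v j x)\<^sup>2 * bary v i x)"
proof -
  let ?f = "\<lambda>x. (bary v i x)\<^sup>2 * bary v j x - (bary v j x)\<^sup>2 * bary v i x"
  let ?G = "\<lambda>x. 2 *\<^sub>R ((bary v i x * bary v j x) *\<^sub>R (gl i - gl j)) +
      (1 *\<^sub>R ((bary v i x * bary v i x) *\<^sub>R gl j) + (bary v j x * bary v j x) *\<^sub>R (- gl i))"
  have D: "GDERIV ?f x :> ?G x" for x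
  proof -
    have "GDERIV (\<lambda>x. (bary v i x * bary v i x) * bary v j x - (bary v j x * bary v j x) * bary v i x) x :>
      ((bary v i x * bary v i x) *\<^sub>R gl j + bary v j x *\<^sub>R (bary v i x *\<^sub>R gl i + bary v i x *\<^sub>R gl i))
      - ((bary v j x * bary v j x) *\<^sub>R gl i + bary v i x *\<^sub>R (bary v j x *\<^sub>R gl j + bary v j x *\<^sub>R gl j))"
      by (intro GDERIV_diff GDERIV_mult bary_GDERIV i j)
    then have "GDERIV ?f x :> ((bary v i x * bary v i x) *\<^sub>R gl j + bary v j x *\<^sub>R (bary v i x *\<^sub>R gl i + bary v i x *\<^sub>R gl i))
      - ((bary v j x * bary v j x) *\<^sub>R gl i + bary v i x *\<^sub>R (bary v j x *\<^sub>R gl j + bary v j x *\<^sub>R gl j))"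
      by (simp only: power2_eq_square)
    then show ?thesis by (rule GDERIV_subst) (simp add: vec_eq_iff algebra_simps)
  qed
  have G: "grd ?f x = ?G x" if "x \<in> T" for x
    by (rule grd_eq[OF _ D that]) (intro continuous_intros bary_continuous i j)
  have V: "val ?f x = ?f x" if "x \<in> T" for x
    by (rule val_eq[OF _ that]) (intro continuous_intros bary_continuous i j)
  show ?thesis unfolding element_like_def
  proof (intro conjI ballI allI impI)
    have "C2_bounded I (\<lambda>x. bary v i x * bary v i x * bary v j x + (-1) * (bary v j x * bary v j x * bary v i x))"
      by (intro symbol_add C2_bounded_scale C2_bounded_mult C2_bary i j)
    then show "C2_bounded I ?f" by (simp add: power2_eq_square)
  next
    fix k :: nat assume "k \<in> {0..3}"
    let ?\<nu> = "outer_normal v k"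
    show "normal_trace k (grd ?f)"
    proof (rule normal_trace_quadratic)
      show "(\<lambda>x. (2 * ((gl i - gl j) \<bullet> ?\<nu>)) * (bary v i x * bary v j x) + ((gl j \<bullet> ?\<nu>) * (bary v i x * bary v i x) + (- (gl i \<bullet> ?\<nu>)) * (bary v j x * bary v j x))) \<in> polys 2"
        by (intro polys_add polys_scale bary_product_polys2 i j)
    qed (simp add: G face_subset inner_add_left inner_diff_left)
  next
    fix a b :: nat assume ab: "a \<in> {0..3}" "b \<in> {0..3}" "a \<noteq> b"
    show "edge_quadratic a b (grd ?f)"
    proof (rule edge_quadratic_cong)
      show "edge_quadratic a b ?G"
        by (intro edge_quadratic_step edge_quadratic_product i j)
    qed (simp add: G on_edge_def)
  next
    fix k l m n :: nat assume e: "{k, l, m, n} = {0..3}"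
    let ?u = "\<lambda>s a k. if k = (s::nat) then a else (0::real)"
    have "\<exists>c. \<forall>x\<in>face v k. ?f x = trace_form c (bary v l x) (bary v m x) (bary v n x)"
      using other_index_zero[OF e i] other_index_zero[OF e j]
    proof (elim disjE)
    qed (rule exI[where x="\<lambda>_. 0"] exI[where x="?u 6 1"] exI[where x="?u 6 (-1)"] exI[where x="?u 7 1"] exI[where x="?u 7 (-1)"] exI[where x="?u 8 1"] exI[where x="?u 8 (-1)"],
         simp add: trace_form_unit face_zero del: One_nat_def; fail)+
    then show "face_trace k l m n (val ?f)"
      unfolding face_trace_def by (simp add: V face_subset)
  qed
qed

lemma bary_square_quotient_derivative:
  assumes l: "l \<in> {0..3}" and n: "n \<in> {0..3}" and ne: "bary v n x + bary v l x \<noteq> 0"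
  shows "((\<lambda>x. (bary v l x)\<^sup>2 / (bary v n x + bary v l x)) has_derivative
    (\<lambda>h. bary v l x * (2 * bary v n x + bary v l x) / (bary v n x + bary v l x)\<^sup>2 * (gl l \<bullet> h)
       - (bary v l x)\<^sup>2 / (bary v n x + bary v l x)\<^sup>2 * (gl n \<bullet> h))) (at x)"
proof -
  have id: "((p * a + a * p) * s - p * p * (c + a)) / (s * s) = p * (2 * r + p) / s\<^sup>2 * a - p\<^sup>2 / s\<^sup>2 * c"
    if "s = r + p" for p r s a c :: real
  proof -
    have "(p * a + a * p) * s - p * p * (c + a) = p * (2 * r + p) * a - p * p * c"
      using that by (simp add: algebra_simps)
    then show ?thesis by (simp add: power2_eq_square diff_divide_distrib)
  qed
  have "((\<lambda>x. bary v l x * bary v l x / (bary v n x + bary v l x)) has_derivative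
    (\<lambda>h. ((bary v l x * (gl l \<bullet> h) + (gl l \<bullet> h) * bary v l x) * (bary v n x + bary v l x)
       - bary v l x * bary v l x * (gl n \<bullet> h + gl l \<bullet> h)) / ((bary v n x + bary v l x) * (bary v n x + bary v l x)))) (at x)"
    by (intro has_derivative_divide' has_derivative_mult has_derivative_add bary_has_derivative l n ne)
  then show ?thesis unfolding id[OF refl] power2_eq_square[of "bary v l _"] .
qed

text \<open>Up to the quadratic \<open>\<lambda>\<^sub>l \<lambda>\<^sub>m\<close>, the coefficients of this gradient are the face functions; this is their origin.\<close>

lemma edge_bubble_GDERIV:
  assumes idx: "l \<in> {0..3}" "m \<in> {0..3}" "n \<in> {0..3}" and x: "x \<in> I"
  defines "\<mu> \<equiv> \<lambda>k. bary v k x"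
  shows "GDERIV (edge_bubble v l m n) x :> Phi_l l m n \<mu> *\<^sub>R gl l + Phi_m l m n \<mu> *\<^sub>R gl m + (Phi_n l m n \<mu> + \<mu> l * \<mu> m) *\<^sub>R gl n"
proof -
  have pos: "0 < \<mu> k" if "k \<in> {0..3}" for k using x that interior_iff unfolding \<mu>_def by blast
  have ne: "\<mu> n + \<mu> l \<noteq> 0" "\<mu> n + \<mu> m \<noteq> 0" using pos[OF idx(1)] pos[OF idx(2)] pos[OF idx(3)] by linarith+
  let ?w = "\<lambda>l x. (bary v l x)\<^sup>2 / (bary v n x + bary v l x)"
  define A where "A = (\<lambda>l. \<mu> l * (2 * \<mu> n + \<mu> l) / (\<mu> n + \<mu> l)\<^sup>2)"
  define B where "B = (\<lambda>l. (\<mu> l)\<^sup>2 / (\<mu> n + \<mu> l)\<^sup>2)"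
  define w where "w = (\<lambda>l. (\<mu> l)\<^sup>2 / (\<mu> n + \<mu> l))"
  have "((\<lambda>x. bary v n x * (?w l x * ?w m x)) has_derivative
      (\<lambda>h. \<mu> n * (w l * (A m * (gl m \<bullet> h) - B m * (gl n \<bullet> h)) + (A l * (gl l \<bullet> h) - B l * (gl n \<bullet> h)) * w m)
        + (gl n \<bullet> h) * (w l * w m))) (at x)"
    unfolding A_def B_def w_def \<mu>_def
    by (intro has_derivative_mult bary_has_derivative bary_square_quotient_derivative idx ne[unfolded \<mu>_def])
  moreover have "(\<lambda>x. bary v n x * (?w l x * ?w m x)) = edge_bubble v l m n"
    by (auto simp: edge_bubble_def mult_ac)
  moreover have "\<mu> n * (w l * (A m * b - B m * c) + (A l * a - B l * c) * w m) + c * (w l * w m)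
     = Phi_l l m n \<mu> * a + Phi_m l m n \<mu> * b + (Phi_n l m n \<mu> + \<mu> l * \<mu> m) * c" for a b c
  proof -
    have 1: "\<mu> n * A l * w m = Phi_l l m n \<mu>" by (simp add: A_def w_def Phi_l_def mult_ac)
    have 2: "\<mu> n * w l * A m = Phi_m l m n \<mu>" by (simp add: A_def w_def Phi_m_def mult_ac)
    have 3: "w l * w m - \<mu> n * B l * w m - \<mu> n * w l * B m = Phi_n l m n \<mu> + \<mu> l * \<mu> m"
      using bubble_gradient_coefficient[OF ne] by (simp add: B_def w_def Phi_n_def)
    show ?thesis unfolding 1[symmetric] 2[symmetric] 3[symmetric] by (simp add: algebra_simps)
  qed
  ultimately have "(edge_bubble v l m n has_derivative (\<lambda>h. Phi_l l m n \<mu> * (gl l \<bullet> h) + Phi_m l m n \<mu> * (gl m \<bullet> h)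
      + (Phi_n l m n \<mu> + \<mu> l * \<mu> m) * (gl n \<bullet> h))) (at x)" by simp
  then show ?thesis by (simp add: gderiv_def inner_add_right inner_commute)
qed

lemma edge_bubble_continuous:
  assumes idx: "l \<in> {0..3}" "m \<in> {0..3}" "n \<in> {0..3}"
  shows "continuous_on T (edge_bubble v l m n)"
  unfolding continuous_on_def
proof
  fix x assume x: "x \<in> T"
  have bd: "\<bar>edge_bubble v l m n y\<bar> \<le> 1 * bary v j y" if y: "y \<in> T" and j: "j = l \<or> j = m \<or> j = n" for y j
  proof -
    note b = bary_bounds[OF y idx(1)] bary_bounds[OF y idx(2)] bary_bounds[OF y idx(3)]
    define R where "R = bary v l y / (bary v n y + bary v l y) * (bary v m y / (bary v n y + bary v m y))"
    have R: "\<bar>R\<bar> \<le> 1" unfolding R_def by (intro abs_mult_le_one ratio_le_one) (use b in auto)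
    have E: "edge_bubble v l m n y = bary v n y * bary v l y * bary v m y * R"
      by (simp add: edge_bubble_def R_def power2_eq_square)
    have *: "\<bar>bary v j y * S\<bar> \<le> 1 * bary v j y" if "\<bar>S\<bar> \<le> 1" for S
      using that b j mult_left_mono[of "\<bar>S\<bar>" 1 "bary v j y"] by (auto simp: abs_mult)
    from j show ?thesis
    proof (elim disjE)
      assume j: "j = l"
      have "\<bar>bary v n y * bary v m y * R\<bar> \<le> 1" by (intro abs_mult_le_one R) (use b in simp_all)
      from *[OF this] show ?thesis unfolding E j by (simp only: mult_ac)
    next
      assume j: "j = m"
      have "\<bar>bary v n y * bary v l y * R\<bar> \<le> 1" by (intro abs_mult_le_one R) (use b in simp_all)
      from *[OF this] show ?thesis unfolding E j by (simp only: mult_ac)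
    next
      assume j: "j = n"
      have "\<bar>bary v l y * bary v m y * R\<bar> \<le> 1" by (intro abs_mult_le_one R) (use b in simp_all)
      from *[OF this] show ?thesis unfolding E j by (simp only: mult_ac)
    qed
  qed
  show "(edge_bubble v l m n \<longlongrightarrow> edge_bubble v l m n x) (at x within T)"
  proof (cases "\<exists>j. (j = l \<or> j = m \<or> j = n) \<and> bary v j x = 0")
    case True
    then obtain j where j: "j = l \<or> j = m \<or> j = n" "bary v j x = 0" by blast
    show ?thesis by (rule continuous_if_bounded_by_bary[OF x _ j(2) bd[OF _ j(1)]]) (use j idx in auto)
  next
    case False
    then have "bary v n x + bary v l x \<noteq> 0" "bary v n x + bary v m x \<noteq> 0"
      using bary_bounds[OF x idx(1)] bary_bounds[OF x idx(2)] bary_bounds[OF x idx(3)] by force+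
    moreover have "(bary v k \<longlongrightarrow> bary v k x) (at x within T)" if "k \<in> {0..3}" for k
      using bary_continuous[OF that, of T] x by (auto simp: continuous_on_def)
    ultimately show ?thesis unfolding edge_bubble_def[abs_def] using idx by (auto intro!: tendsto_intros)
  qed
qed

text \<open>Each face function vanishes as soon as one of its three coordinates does. So the gradient reduces to the
  quadratic \<open>\<lambda>\<^sub>l \<lambda>\<^sub>m \<nabla>\<lambda>\<^sub>n\<close> on all edges and on all faces but the one opposite to \<open>v i\<close>, where the normal
  derivative differs from a quadratic by an element of \<open>Q_edge\<close>.\<close>

lemma element_like_edge_bubble:
  assumes i0: "{i, l, m, n} = {0..3}" and lm: "l < m"
  shows "element_like (edge_bubble v l m n)"
proof -
  have card: "card {i, l, m, n} = 4" using i0 by simp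
  then have d: "i \<noteq> l" "i \<noteq> m" "i \<noteq> n" "l \<noteq> n" "m \<noteq> n"
    by (auto simp: card_insert_if split: if_splits)
  have idx: "i \<in> {0..3}" "l \<in> {0..3}" "m \<in> {0..3}" "n \<in> {0..3}" using i0 by blast+
  have J: "{l, m, n} = {0..3} - {i}" using i0 d by blast
  have Ph: "Phi_l l m n \<in> Phis i" "Phi_m l m n \<in> Phis i" "Phi_n l m n \<in> Phis i"
    unfolding Phis_def using J lm d by auto
  let ?E = "edge_bubble v l m n"
  let ?\<mu> = "\<lambda>x k. bary v k x"
  let ?G = "\<lambda>x. Phi_l l m n (?\<mu> x) *\<^sub>R gl l + Phi_m l m n (?\<mu> x) *\<^sub>R gl m + (Phi_n l m n (?\<mu> x) + bary v l x * bary v m x) *\<^sub>R gl n"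
  have G: "grd ?E x = ?G x" if "x \<in> T" for x
    by (rule grd_eq[OF _ edge_bubble_GDERIV[OF idx(2-4)] that])
      (intro continuous_intros Phi_continuous[OF Ph(1)] Phi_continuous[OF Ph(2)] Phi_continuous[OF Ph(3)] bary_continuous idx)
  have V: "val ?E x = ?E x" if "x \<in> T" for x
    by (rule val_eq[OF edge_bubble_continuous[OF idx(2-4)] that])
  have Gz: "grd ?E x = (bary v l x * bary v m x) *\<^sub>R gl n" if x: "x \<in> T" and j: "j \<in> {l, m, n}" "bary v j x = 0" for x j
  proof -
    have "F (?\<mu> x) = 0" if "F \<in> Phis i" for F
      using Phi_bound[OF that _ x, of j] j J by auto
    then have z: "Phi_l l m n (?\<mu> x) = 0" "Phi_m l m n (?\<mu> x) = 0" "Phi_n l m n (?\<mu> x) = 0" using Ph by blast+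
    show ?thesis unfolding G[OF x] z by simp
  qed
  have lam: "(\<lambda>x. (gl n \<bullet> outer_normal v k) * (bary v l x * bary v m x)) \<in> polys 2" for k
    by (intro polys_scale bary_product_polys2 idx)
  show ?thesis unfolding element_like_def
  proof (intro conjI ballI allI impI)
    show "C2_bounded I ?E" by (rule C2_edge_bubble) (use idx d in auto)
  next
    fix k :: nat assume k: "k \<in> {0..3}"
    let ?\<nu> = "outer_normal v k"
    show "normal_trace k (grd ?E)"
    proof (cases "k = i")
      case True
      have P: "(\<lambda>x. F (?\<mu> x)) \<in> Phi_space v k" if "F \<in> Phis i" for F
        unfolding Phi_space_def using that True by (intro lin_span_base) auto
      show ?thesis unfolding normal_trace_def
      proof (rule bexI[OF _ lam[of k]], rule bexI, rule ballI)
        show "(\<lambda>x. (gl l \<bullet> ?\<nu>) * Phi_l l m n (?\<mu> x) + ((gl m \<bullet> ?\<nu>) * Phi_m l m n (?\<mu> x) + (gl n \<bullet> ?\<nu>) * Phi_n l m n (?\<mu> x))) \<in> Phi_space v k"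
          by (intro Phi_space_add Phi_space_scale P Ph)
        fix x assume "x \<in> face v k"
        then show "grd ?E x \<bullet> ?\<nu> = (gl n \<bullet> ?\<nu>) * (bary v l x * bary v m x) +
          ((gl l \<bullet> ?\<nu>) * Phi_l l m n (?\<mu> x) + ((gl m \<bullet> ?\<nu>) * Phi_m l m n (?\<mu> x) + (gl n \<bullet> ?\<nu>) * Phi_n l m n (?\<mu> x)))"
          using G[OF face_subset] by (simp add: inner_add_left algebra_simps)
      qed
    next
      case False
      then have "k \<in> {l, m, n}" using J k by blast
      then show ?thesis
        by (intro normal_trace_quadratic[OF lam[of k]]) (simp add: Gz[OF face_subset, of _ k k] face_zero)
    qed
  next
    fix a b :: nat assume ab: "a \<in> {0..3}" "b \<in> {0..3}" "a \<noteq> b"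
    obtain j where j: "j \<in> {l, m, n}" "j \<noteq> a" "j \<noteq> b" using lm d by (metis insertI1 insertI2 less_irrefl)
    show "edge_quadratic a b (grd ?E)"
    proof (rule edge_quadratic_cong[OF edge_quadratic_product[OF idx(2,3), of a b "gl n"]])
      fix x assume e: "on_edge a b x"
      have "j \<in> {0..3} - {a, b}" using j J by blast
      then have "bary v j x = 0" using e unfolding on_edge_def by blast
      then show "grd ?E x = (bary v l x * bary v m x) *\<^sub>R gl n" using Gz j(1) e unfolding on_edge_def by blast
    qed
  next
    fix k a b c :: nat assume e: "{k, a, b, c} = {0..3}"
    let ?u = "\<lambda>s k. if k = (s::nat) then 1 else (0::real)"
    have b: "edge_bubble v l m n x = bubble (bary v l x) (bary v m x) (bary v n x)" for l m n x
      by (simp add: edge_bubble_def bubble_def)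
    have card: "card {k, a, b, c} = 4" using e by simp
    then have dd: "k \<noteq> a" "k \<noteq> b" "k \<noteq> c" "a \<noteq> b" "a \<noteq> c" "b \<noteq> c"
      by (auto simp: card_insert_if split: if_splits)
    have bz: "bubble 0 q r = 0" "bubble q 0 r = 0" "bubble q r 0 = 0" for q r by (simp_all add: bubble_def)
    have "\<exists>d. \<forall>x\<in>face v k. ?E x = trace_form d (bary v a x) (bary v b x) (bary v c x)"
    proof (cases "k = i")
      case False
      then have "k = l \<or> k = m \<or> k = n" using i0 e by blast
      then show ?thesis
        by (intro exI[where x="\<lambda>_. 0"]) (auto simp: trace_form_unit b face_zero bz)
    next
      case True
      have "{a, b, c} = {0..3} - {k}" using e dd by blast
      then have "{a, b, c} = {l, m, n}" using J True by simp
      then consider "{l, m} = {a, b}" "n = c" | "{l, m} = {a, c}" "n = b" | "{l, m} = {b, c}" "n = a"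
        using lm d dd by (metis (no_types, opaque_lifting) insertE insertI1 insert_commute singletonD less_irrefl)
      then show ?thesis
      proof cases
        case 1
        then show ?thesis by (intro exI[where x="?u 9"]) (auto simp: trace_form_unit b doubleton_eq_iff bubble_commute)
      next
        case 2
        then show ?thesis by (intro exI[where x="?u 10"]) (auto simp: trace_form_unit b doubleton_eq_iff bubble_commute)
      next
        case 3
        then show ?thesis by (intro exI[where x="?u 11"]) (auto simp: trace_form_unit b doubleton_eq_iff bubble_commute)
      qed
    qed
    then show "face_trace k a b c (val ?E)"
      unfolding face_trace_def by (simp add: V face_subset)
  qed
qed

lemma element_like_lin_span:
  assumes "f \<in> lin_span B" "\<And>b. b \<in> B \<Longrightarrow> element_like b" shows "element_like f"
  by (rule lin_span_induct[where P=element_like, OF assms(1) element_like_zero]) (use element_like_step assms(2) in blast)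

lemma element_like_Z3e:
  assumes "z \<in> Z3e v" shows "element_like z"
proof -
  have add: "element_like (\<lambda>x. f x + g x)" if "element_like f" "element_like g" for f g using element_like_step[OF that, of 1] by simp
  obtain y s where z: "z = (\<lambda>x. y x + s x)" and y: "y \<in> Z30 v"
    and s: "s \<in> lin_span {edge_bubble v l m n | l m n. l < m \<and> m \<le> 3 \<and> n \<in> {0..3} - {l, m}}"
    using assms unfolding Z3e_def mem_Collect_eq by (elim exE conjE)
  obtain p t where y': "y = (\<lambda>x. p x + t x)" and p: "p \<in> polys 2"
    and t: "t \<in> lin_span {(\<lambda>x. (bary v i x)\<^sup>2 * bary v j x - (bary v j x)\<^sup>2 * bary v i x) | i j. i < j \<and> j \<le> 3}"
    using y unfolding Z30_def mem_Collect_eq by (elim exE conjE)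
  have "element_like p" using p polys2_subset unfolding bary_quadratics_def
    by (intro element_like_lin_span[of p "{(\<lambda>x. bary v j x * bary v k x) | j k. j \<in> {0..3} \<and> k \<in> {0..3}}"]) (auto intro: element_like_product)
  moreover have "element_like t" by (rule element_like_lin_span[OF t]) (auto intro!: element_like_cubic)
  moreover have "element_like s"
  proof (rule element_like_lin_span[OF s])
    fix b assume "b \<in> {edge_bubble v l m n | l m n. l < m \<and> m \<le> 3 \<and> n \<in> {0..3} - {l, m}}"
    then obtain l m n where b: "b = edge_bubble v l m n" "l < m" "m \<le> 3" "n \<in> {0..3} - {l, m}"
      unfolding mem_Collect_eq by (elim exE conjE)
    have "card ({0..3} - {l, m, n}) = 1" using b by (subst card_Diff_subset) auto
    then obtain i where "{0..3} - {l, m, n} = {i}" by (rule card_1_singletonE)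
    moreover have "{l, m, n} \<subseteq> {0..3}" using b by auto
    ultimately have "{i, l, m, n} = {0..3}" by blast
    then show "element_like b" unfolding b(1) using b(2) by (rule element_like_edge_bubble)
  qed
  ultimately show ?thesis unfolding z y' by (intro add)
qed

end

section \<open>The local singular space\<close>

text \<open>The bubbles vanish on the edges. The remaining coefficients are found from the values at the vertices,
  at the midpoints and, for the antisymmetric cubics, at one more point of each edge.\<close>

lemma trace_form_zero_on_edges:
  assumes "\<And>p q. 0 \<le> p \<Longrightarrow> 0 \<le> q \<Longrightarrow> p + q = 1 \<Longrightarrow> trace_form c p q 0 = 0"
    and "\<And>p r. 0 \<le> p \<Longrightarrow> 0 \<le> r \<Longrightarrow> p + r = 1 \<Longrightarrow> trace_form c p 0 r = 0"
    and "\<And>q r. 0 \<le> q \<Longrightarrow> 0 \<le> r \<Longrightarrow> q + r = 1 \<Longrightarrow> trace_form c 0 q r = 0"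
  shows "k \<le> 8 \<Longrightarrow> c k = 0"
proof -
  have b: "bubble 0 q r = 0" "bubble q 0 r = 0" "bubble q r 0 = 0" for q r by (simp_all add: bubble_def)
  note t = trace_form_def b
  have c0: "c 0 = 0" and c1: "c 1 = 0" using assms(1)[of 1 0] assms(1)[of 0 1] by (simp_all add: t)
  have c2: "c 2 = 0" using assms(2)[of 0 1] by (simp add: t)
  have c3: "c 3 = 0" using assms(1)[of "1/2" "1/2"] by (simp add: t c0 c1 del: One_nat_def)
  have c4: "c 4 = 0" using assms(2)[of "1/2" "1/2"] by (simp add: t c0 c2 del: One_nat_def)
  have c5: "c 5 = 0" using assms(3)[of "1/2" "1/2"] by (simp add: t c1 c2 del: One_nat_def)
  have c6: "c 6 = 0" using assms(1)[of "1/3" "2/3"] by (simp add: t c0 c1 c3 power2_eq_square del: One_nat_def)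
  have c7: "c 7 = 0" using assms(2)[of "1/3" "2/3"] by (simp add: t c0 c2 c4 power2_eq_square del: One_nat_def)
  have c8: "c 8 = 0" using assms(3)[of "1/3" "2/3"] by (simp add: t c1 c2 c5 power2_eq_square del: One_nat_def)
  assume "k \<le> 8"
  then have "k = 0 \<or> k = 1 \<or> k = 2 \<or> k = 3 \<or> k = 4 \<or> k = 5 \<or> k = 6 \<or> k = 7 \<or> k = 8" by linarith
  then show "c k = 0" using c0 c1 c2 c3 c4 c5 c6 c7 c8 by metis
qed

context tetrahedron
begin

lemma point_with_bary:
  assumes "(\<Sum>k\<in>{0..3}. u k) = 1"
  obtains x where "\<forall>k\<in>{0..3}. bary v k x = u k"
  by (rule that[of "\<Sum>k\<in>{0..3}. u k *\<^sub>R v k"], rule ballI, rule bary_eqI[OF assms refl])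

lemma distinct_indices:
  assumes "{i, l, m, n} = {0..3::nat}"
  shows "i \<noteq> l" "i \<noteq> m" "i \<noteq> n" "l \<noteq> m" "l \<noteq> n" "m \<noteq> n"
    "i \<in> {0..3}" "l \<in> {0..3}" "m \<in> {0..3}" "n \<in> {0..3}"
proof -
  have card: "card {i, l, m, n} = 4" using assms by simp
  then show "i \<noteq> l" "i \<noteq> m" "i \<noteq> n" "l \<noteq> m" "l \<noteq> n" "m \<noteq> n"
    by (auto simp: card_insert_if split: if_splits)
  show "i \<in> {0..3}" "l \<in> {0..3}" "m \<in> {0..3}" "n \<in> {0..3}" using assms by blast+
qed

lemma face_point:
  assumes e: "{i, l, m, n} = {0..3}" and pqr: "0 \<le> p" "0 \<le> q" "0 \<le> r" "p + q + r = 1"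
  obtains x where "x \<in> face v i" "bary v l x = p" "bary v m x = q" "bary v n x = r"
proof -
  note d = distinct_indices[OF e]
  define u where "u = (\<lambda>k. if k = l then p else if k = m then q else if k = n then r else 0)"
  have "(\<Sum>k\<in>{0..3}. u k) = 1" unfolding sum_four[OF e] using d pqr by (simp add: u_def)
  then obtain x where x': "\<forall>k\<in>{0..3}. bary v k x = u k" by (rule point_with_bary)
  have x: "bary v k x = u k" if "k \<in> {0..3}" for k using x' that by blast
  have "x \<in> face v i" using d pqr by (auto simp: face_def tet_iff x u_def)
  then show ?thesis using that[of x] d by (simp add: x u_def)
qed

lemma face_sum:
  assumes e: "{i, l, m, n} = {0..3}" and x: "x \<in> face v i"
  shows "bary v l x + bary v m x + bary v n x = 1" "0 \<le> bary v l x" "0 \<le> bary v m x" "0 \<le> bary v n x"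
proof -
  show "bary v l x + bary v m x + bary v n x = 1"
    using bary_sum[of x] unfolding sum_four[OF e] face_zero[OF x] by simp
  show "0 \<le> bary v l x" "0 \<le> bary v m x" "0 \<le> bary v n x"
    using bary_bounds[OF face_subset[OF x]] distinct_indices[OF e] by blast+
qed

lemma quadratic_face_form:
  assumes p: "p \<in> polys 2" and e: "{i, l, m, n} = {0..3}"
  obtains c where "\<forall>k\<ge>6. c k = 0"
    "\<forall>x\<in>face v i. p x = trace_form c (bary v l x) (bary v m x) (bary v n x)"
proof -
  have "\<exists>c. (\<forall>k\<ge>6. c k = 0) \<and> (\<forall>x\<in>face v i. p x = trace_form c (bary v l x) (bary v m x) (bary v n x))"
  proof (rule lin_span_induct[where P="\<lambda>p. \<exists>c. (\<forall>k\<ge>6. c k = 0) \<and> (\<forall>x\<in>face v i. p x = trace_form c (bary v l x) (bary v m x) (bary v n x))"])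
    show "p \<in> lin_span {(\<lambda>x. bary v j x * bary v k x) | j k. j \<in> {0..3} \<and> k \<in> {0..3}}"
      using p polys2_subset unfolding bary_quadratics_def by blast
    show "\<exists>c. (\<forall>k\<ge>6. c k = 0) \<and> (\<forall>x\<in>face v i. 0 = trace_form c (bary v l x) (bary v m x) (bary v n x))"
      by (rule exI[where x="\<lambda>_. 0"]) (simp add: trace_form_unit)
    fix b g and a :: real
    assume "b \<in> {(\<lambda>x. bary v j x * bary v k x) | j k. j \<in> {0..3} \<and> k \<in> {0..3}}"
    then obtain j k where b: "b = (\<lambda>x. bary v j x * bary v k x)" and j: "j \<in> {0..3}" and k: "k \<in> {0..3}"
      unfolding mem_Collect_eq by (elim exE conjE)
    assume "\<exists>c. (\<forall>k\<ge>6. c k = 0) \<and> (\<forall>x\<in>face v i. g x = trace_form c (bary v l x) (bary v m x) (bary v n x))"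
    then obtain d where d: "\<forall>k\<ge>6. d k = 0" "\<forall>x\<in>face v i. g x = trace_form d (bary v l x) (bary v m x) (bary v n x)"
      by (elim exE conjE)
    let ?u = "\<lambda>s k. if k = (s::nat) then 1 else (0::real)"
    have "\<exists>c. (\<forall>k\<ge>6. c k = 0) \<and> (\<forall>x\<in>face v i. b x = trace_form c (bary v l x) (bary v m x) (bary v n x))"
      unfolding b using other_index_zero[OF e j] other_index_zero[OF e k]
    proof (elim disjE)
    qed (rule exI[where x="\<lambda>_. 0"] exI[where x="?u 0"] exI[where x="?u 1"] exI[where x="?u 2"] exI[where x="?u 3"] exI[where x="?u 4"] exI[where x="?u 5"],
         simp add: trace_form_unit face_zero power2_eq_square mult.commute del: One_nat_def; fail)+
    then obtain c where c: "\<forall>k\<ge>6. c k = 0" "\<forall>x\<in>face v i. b x = trace_form c (bary v l x) (bary v m x) (bary v n x)"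
      by (elim exE conjE)
    show "\<exists>c. (\<forall>k\<ge>6. c k = 0) \<and> (\<forall>x\<in>face v i. a * b x + g x = trace_form c (bary v l x) (bary v m x) (bary v n x))"
      by (rule exI[where x="\<lambda>k. a * c k + d k"]) (simp only: trace_form_step c d, simp add: c d)
  qed
  then obtain c where c: "\<forall>k\<ge>6. c k = 0" "\<forall>x\<in>face v i. p x = trace_form c (bary v l x) (bary v m x) (bary v n x)"
    by (elim exE conjE)
  show ?thesis by (rule that[of c]) (rule c)+
qed

lemma trace_form_only_quadratic: "(\<And>k. 6 \<le> k \<Longrightarrow> c k = 0) \<Longrightarrow> (\<And>k. k \<le> 8 \<Longrightarrow> c k = 0) \<Longrightarrow> trace_form c p q r = 0"
  by (simp add: trace_form_def)

lemma quadratic_zero_on_edges: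
  assumes c: "\<And>k. 6 \<le> k \<Longrightarrow> c k = 0" and e: "{i, l, m, n} = {0..3}"
    and z: "\<And>x. x \<in> face v i \<Longrightarrow> bary v l x = 0 \<or> bary v m x = 0 \<or> bary v n x = 0 \<Longrightarrow>
       trace_form c (bary v l x) (bary v m x) (bary v n x) = 0"
  shows "trace_form c p q r = 0"
proof (rule trace_form_only_quadratic[OF c])
  have *: "trace_form c p q r = 0" if h: "0 \<le> p" "0 \<le> q" "0 \<le> r" "p + q + r = 1" "p = 0 \<or> q = 0 \<or> r = 0" for p q r
  proof -
    obtain x where x: "x \<in> face v i" "bary v l x = p" "bary v m x = q" "bary v n x = r"
      by (rule face_point[OF e h(1-4)])
    show ?thesis using z[OF x(1)] h(5) unfolding x(2-4) by simp
  qed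
  show "c k = 0" if "k \<le> 8" for k
    by (rule trace_form_zero_on_edges[OF _ _ _ that]) (rule *; simp)+
qed

lemma other_indices:
  assumes "i \<in> {0..3}" obtains l m n where "{i, l, m, n} = {0..3::nat}"
proof -
  have "card ({0..3} - {i}) = 3" using assms by simp
  then obtain l m n where "{0..3} - {i} = {l, m, n}" unfolding card_3_iff by (elim exE conjE)
  then have "{i, l, m, n} = {0..3}" using assms by blast
  then show ?thesis by (rule that)
qed

text \<open>The functions in \<open>Q_edge\<close> vanish on the edges of the face, a nonzero quadratic does not;
  so the decomposition of the normal derivative is unique.\<close>

lemma q_part_eq:
  assumes i: "i \<in> {0..3}" and p: "p \<in> polys 2" and \<phi>: "\<phi> \<in> Phi_space v i"
    and z: "\<And>x. x \<in> face v i \<Longrightarrow> grd z x \<bullet> outer_normal v i = p x + \<phi> x"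
  shows "q_part v i z = restrict \<phi> (face v i)"
  unfolding q_part_def
proof (rule the_equality)
  show "restrict \<phi> (face v i) \<in> Q_edge v i \<and>
     (\<exists>p\<in>face_polys 2 v i. \<forall>x\<in>face v i. normal_deriv v i z x = p x + restrict \<phi> (face v i) x)"
  proof (intro conjI bexI ballI)
    show "restrict \<phi> (face v i) \<in> Q_edge v i" unfolding Q_edge_def using \<phi> by (rule imageI)
    show "restrict p (face v i) \<in> face_polys 2 v i" unfolding face_polys_def using p by (rule imageI)
    show "normal_deriv v i z x = restrict p (face v i) x + restrict \<phi> (face v i) x" if "x \<in> face v i" for x
      using z[OF that] that by (simp add: normal_deriv_def)
  qed
next
  fix q
  assume q: "q \<in> Q_edge v i \<and> (\<exists>p\<in>face_polys 2 v i. \<forall>x\<in>face v i. normal_deriv v i z x = p x + q x)"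
  then obtain \<psi> where \<psi>: "\<psi> \<in> Phi_space v i" "q = restrict \<psi> (face v i)" unfolding Q_edge_def by blast
  obtain p' where p': "p' \<in> polys 2" and eq: "\<forall>x\<in>face v i. normal_deriv v i z x = restrict p' (face v i) x + q x"
    using q unfolding face_polys_def by blast
  obtain l m n where e: "{i, l, m, n} = {0..3}" using i by (rule other_indices)
  note d = distinct_indices[OF e]
  have diff: "p x - p' x = \<psi> x - \<phi> x" if "x \<in> face v i" for x
    using bspec[OF eq that] z[OF that] that by (simp add: normal_deriv_def \<psi>(2))
  have "(\<lambda>x. p x + (-1) * p' x) \<in> polys 2" by (intro polys_add polys_scale p p')
  then obtain c where c': "\<forall>k\<ge>6. c k = 0"
    "\<forall>x\<in>face v i. p x + (-1) * p' x = trace_form c (bary v l x) (bary v m x) (bary v n x)"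
    by (rule quadratic_face_form[OF _ e])
  have c: "\<And>k. 6 \<le> k \<Longrightarrow> c k = 0"
    "\<And>x. x \<in> face v i \<Longrightarrow> p x + (-1) * p' x = trace_form c (bary v l x) (bary v m x) (bary v n x)"
    using c' by blast+
  have ze: "trace_form c (bary v l x) (bary v m x) (bary v n x) = 0"
    if x: "x \<in> face v i" and z: "bary v l x = 0 \<or> bary v m x = 0 \<or> bary v n x = 0" for x
  proof -
    obtain j where j: "j \<in> {0..3} - {i}" "bary v j x = 0" using z d by blast
    have "\<phi> x = 0" "\<psi> x = 0"
      using Phi_space_vanish[OF \<phi> j(1) face_subset[OF x] j(2)] Phi_space_vanish[OF \<psi>(1) j(1) face_subset[OF x] j(2)] by simp_all
    then show ?thesis using diff[OF x] c(2)[OF x] by simp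
  qed
  have "trace_form c p q r = 0" for p q r using c(1) e ze by (rule quadratic_zero_on_edges)
  then have "\<psi> x = \<phi> x" if "x \<in> face v i" for x using diff[OF that] c(2)[OF that] by simp
  then show "q = restrict \<phi> (face v i)" unfolding \<psi>(2) by (rule restrict_ext)
qed

lemma bary_ext_eq:
  assumes i: "i \<in> {0..3}" and \<phi>: "\<phi> \<in> Phi_space v i" and x: "x \<in> T"
  shows "bary_ext v i (restrict \<phi> (face v i)) x = \<phi> x"
proof -
  have "bary_ext v i (restrict \<phi> (face v i)) = restrict \<phi> T"
    unfolding bary_ext_def
  proof (rule the_equality)
    show "restrict \<phi> T \<in> (\<lambda>g. restrict g T) ` Phi_space v i \<and> (\<forall>x\<in>face v i. restrict \<phi> T x = restrict \<phi> (face v i) x)"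
      using \<phi> by (auto simp: face_subset)
  next
    fix q assume q: "q \<in> (\<lambda>g. restrict g T) ` Phi_space v i \<and> (\<forall>x\<in>face v i. q x = restrict \<phi> (face v i) x)"
    then obtain \<psi> where \<psi>: "\<psi> \<in> Phi_space v i" "q = restrict \<psi> T" by blast
    have d: "(\<lambda>x. \<psi> x + (-1) * \<phi> x) \<in> Phi_space v i" by (intro Phi_space_add Phi_space_scale \<psi>(1) \<phi>)
    have "\<psi> x + (-1) * \<phi> x = 0" if "x \<in> T" for x
      by (rule Phi_space_determined_on_face[OF d i _ that]) (use q in \<open>simp add: \<psi>(2) face_subset\<close>)
    then show "q = restrict \<phi> T" unfolding \<psi>(2) by (intro restrict_ext) simp
  qed
  then show ?thesis using x by simp
qed

lemma C2_sum:
  assumes "finite A" "\<And>i. i \<in> A \<Longrightarrow> C2_bounded I (f i)"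
  shows "C2_bounded I (\<lambda>x. \<Sum>i\<in>A. c i * f i x)"
    "\<And>x. x \<in> T \<Longrightarrow> val (\<lambda>x. \<Sum>i\<in>A. c i * f i x) x = (\<Sum>i\<in>A. c i * val (f i) x)"
    "\<And>x. x \<in> T \<Longrightarrow> grd (\<lambda>x. \<Sum>i\<in>A. c i * f i x) x = (\<Sum>i\<in>A. c i *\<^sub>R grd (f i) x)"
proof -
  have "C2_bounded I (\<lambda>x. \<Sum>i\<in>A. c i * f i x) \<and> (\<forall>x\<in>T. val (\<lambda>x. \<Sum>i\<in>A. c i * f i x) x = (\<Sum>i\<in>A. c i * val (f i) x)
     \<and> grd (\<lambda>x. \<Sum>i\<in>A. c i * f i x) x = (\<Sum>i\<in>A. c i *\<^sub>R grd (f i) x))"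
    using assms
  proof (induction A rule: finite_induct)
    case empty
    show ?case
      using C2_const[of 0] C2_val_scale[OF C2_const[of 0], of _ 0] C2_grd_scale[OF C2_const[of 0], of _ 0] by simp
  next
    case (insert a A)
    have f: "C2_bounded I (f a)" using insert.prems by simp
    have IH: "C2_bounded I (\<lambda>x. \<Sum>i\<in>A. c i * f i x)"
       "\<And>x. x \<in> T \<Longrightarrow> val (\<lambda>x. \<Sum>i\<in>A. c i * f i x) x = (\<Sum>i\<in>A. c i * val (f i) x)"
       "\<And>x. x \<in> T \<Longrightarrow> grd (\<lambda>x. \<Sum>i\<in>A. c i * f i x) x = (\<Sum>i\<in>A. c i *\<^sub>R grd (f i) x)"
      using insert.IH insert.prems by simp_all
    note cf = C2_bounded_scale[OF f, of "c a"]
    show ?case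
      using insert.hyps symbol_add[OF cf IH(1)] C2_val_add[OF cf IH(1)] C2_grd_add[OF cf IH(1)]
      by (simp add: IH C2_val_scale[OF f] C2_grd_scale[OF f])
  qed
  then show "C2_bounded I (\<lambda>x. \<Sum>i\<in>A. c i * f i x)"
    "\<And>x. x \<in> T \<Longrightarrow> val (\<lambda>x. \<Sum>i\<in>A. c i * f i x) x = (\<Sum>i\<in>A. c i * val (f i) x)"
    "\<And>x. x \<in> T \<Longrightarrow> grd (\<lambda>x. \<Sum>i\<in>A. c i * f i x) x = (\<Sum>i\<in>A. c i *\<^sub>R grd (f i) x)" by simp_all
qed

lemma C2_cong:
  assumes f: "C2_bounded I f" and eq: "\<And>x. x \<in> I \<Longrightarrow> g x = f x"
  shows "C2_bounded I g" "\<And>x. x \<in> T \<Longrightarrow> val g x = val f x" "\<And>x. x \<in> T \<Longrightarrow> grd g x = grd f x"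
proof -
  show "C2_bounded I g" by (rule symbol_cong[OF f]) (simp_all add: eq)
  show "val g x = val f x" if "x \<in> T" for x
    by (rule cont_ext_eqI[OF C2_val_continuous[OF f] _ that]) (simp add: eq C2_val_interior[OF f])
  show "grd g x = grd f x" if "x \<in> T" for x
  proof (rule cont_ext_eqI[OF C2_grd_continuous[OF f] _ that], rule grad_eqI)
    fix y assume y: "y \<in> I"
    show "GDERIV g y :> grd f y"
      unfolding gderiv_def
      by (rule has_derivative_transform_within_open[OF C2_GDERIV[OF f y, unfolded gderiv_def] open_interior y])
        (simp add: eq)
  qed
qed

lemma polys2_continuous: "p \<in> polys 2 \<Longrightarrow> continuous_on T p"
proof -
  assume "p \<in> polys 2"
  then have "p \<in> lin_span {(\<lambda>x. bary v j x * bary v k x) | j k. j \<in> {0..3} \<and> k \<in> {0..3}}"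
    using polys2_subset unfolding bary_quadratics_def by blast
  then show "continuous_on T p"
  proof (rule lin_span_induct)
    fix b g :: "point \<Rightarrow> real" and c :: real assume "b \<in> {(\<lambda>x. bary v j x * bary v k x) | j k. j \<in> {0..3} \<and> k \<in> {0..3}}" and g: "continuous_on T g"
    then obtain j k where b: "b = (\<lambda>x. bary v j x * bary v k x)" and j: "j \<in> {0..3}" and k: "k \<in> {0..3}"
      unfolding mem_Collect_eq by (elim exE conjE)
    show "continuous_on T (\<lambda>x. c * b x + g x)" unfolding b by (intro continuous_intros bary_continuous j k g)
  qed simp
qed

lemma zero_on_face_if_zero_inside_face:
  fixes f :: "point \<Rightarrow> real"
  assumes i: "i \<in> {0..3}" and f: "continuous_on T f"
    and z: "\<And>x. x \<in> face v i \<Longrightarrow> (\<And>j. j \<in> {0..3} - {i} \<Longrightarrow> bary v j x \<noteq> 0) \<Longrightarrow> f x = 0"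
    and x: "x \<in> face v i"
  shows "f x = 0"
proof -
  obtain l m n where e: "{i, l, m, n} = {0..3}" using i by (rule other_indices)
  obtain b where b: "b \<in> face v i" "bary v l b = 1/3" "bary v m b = 1/3" "bary v n b = 1/3"
    by (rule face_point[OF e, of "1/3" "1/3" "1/3"]) auto
  let ?p = "\<lambda>t. x + t *\<^sub>R (b - x)"
  have nb: "at (0::real) within {0..1} \<noteq> bot" by (simp add: trivial_limit_within islimpt_Icc)
  have bp: "bary v k (?p t) = (1 - t) * bary v k x + t * bary v k b" if "k \<in> {0..3}" for k t
    unfolding bary_line[OF that] bary_diff[OF that, symmetric] by (simp add: algebra_simps)
  have pT: "?p t \<in> T" if "t \<in> {0..1}" for t
    unfolding tet_iff
  proof
    fix k :: nat assume k: "k \<in> {0..3}"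
    have "0 \<le> (1 - t) * bary v k x" "0 \<le> t * bary v k b"
      using bary_bounds[OF face_subset[OF x] k] bary_bounds[OF face_subset[OF b(1)] k] that by auto
    then show "0 \<le> bary v k (?p t)" by (simp add: bp[OF k])
  qed
  have "f (?p t) = 0" if t: "t \<in> {0..1}" "t \<noteq> 0" for t
  proof (rule z)
    show "?p t \<in> face v i" using pT[OF t(1)] bp[OF i, of t] face_zero[OF x] face_zero[OF b(1)] by (simp add: face_def)
    fix j assume j: "j \<in> {0..3} - {i}"
    then have jb: "bary v j b = 1/3" using b e by blast
    moreover have "0 \<le> (1 - t) * bary v j x" using bary_bounds[OF face_subset[OF x], of j] j t by auto
    moreover have "bary v j (?p t) = (1 - t) * bary v j x + t * (1/3)" using bp[of j t] j unfolding jb by blast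
    ultimately have "t / 3 \<le> bary v j (?p t)" by simp
    then show "bary v j (?p t) \<noteq> 0" using t by auto
  qed
  then have "((\<lambda>t. f (?p t)) \<longlongrightarrow> 0) (at 0 within {0..1})"
    by (intro tendsto_eventually) (simp add: eventually_at_filter)
  moreover have "((\<lambda>t. f (?p t)) \<longlongrightarrow> f (?p 0)) (at 0 within {0..1})"
  proof -
    have "continuous_on {0..1} (\<lambda>t. f (?p t))"
      by (rule continuous_on_compose2[OF f]) (use pT in \<open>auto intro!: continuous_intros\<close>)
    then have "\<forall>s\<in>{0..1}. ((\<lambda>t. f (?p t)) \<longlongrightarrow> f (?p s)) (at s within {0..1})" unfolding continuous_on_def .
    from bspec[OF this, of 0] show ?thesis by simp
  qed
  ultimately show ?thesis using tendsto_unique[OF nb] by fastforce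
qed

lemma gl_outer_normal: "i \<in> {0..3} \<Longrightarrow> gl i \<bullet> outer_normal v i = dcoef v i i"
  using grad_eqI[OF bary_GDERIV, of i] by (simp add: dcoef_def)

text \<open>On face \<open>i\<close> the gradient of the lift number \<open>i\<close> cancels the part of the normal derivative in \<open>Q_edge\<close>, and
  the other lifts contribute nothing to first order; values on faces and gradients on edges are those of the
  uncorrected function. The cancellation is computed in the relative interior of the face, where \<open>\<Theta>\<^sub>i\<close> has no
  vanishing denominators, and extended by continuity.\<close>

lemma Z3sing_local:
  assumes "w \<in> Z3sing v"
  shows "C2_bounded I w"
    and "\<And>a b. a \<in> {0..3} \<Longrightarrow> b \<in> {0..3} \<Longrightarrow> a \<noteq> b \<Longrightarrow> edge_quadratic a b (grd w)"
    and "\<And>i l m n. {i, l, m, n} = {0..3} \<Longrightarrow> face_trace i l m n (val w)"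
    and "\<And>i. i \<in> {0..3} \<Longrightarrow> \<exists>p\<in>polys 2. \<forall>x\<in>face v i. grd w x \<bullet> outer_normal v i = p x"
proof -
  obtain z where z: "z \<in> Z3e v" "w = R_op v z" using assms unfolding Z3sing_def by blast
  have nz: "element_like z" using z(1) by (rule element_like_Z3e)
  have "\<forall>i\<in>{0..3}. \<exists>p \<phi>. p \<in> polys 2 \<and> \<phi> \<in> Phi_space v i \<and> (\<forall>x\<in>face v i. grd z x \<bullet> outer_normal v i = p x + \<phi> x)"
    using element_likeD(2)[OF nz] unfolding normal_trace_def by blast
  then obtain p where "\<forall>i\<in>{0..3}. \<exists>\<phi>. p i \<in> polys 2 \<and> \<phi> \<in> Phi_space v i \<and> (\<forall>x\<in>face v i. grd z x \<bullet> outer_normal v i = p i x + \<phi> x)"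
    by (rule bchoice[THEN exE])
  then obtain \<phi> where all: "\<forall>i\<in>{0..3}. p i \<in> polys 2 \<and> \<phi> i \<in> Phi_space v i \<and> (\<forall>x\<in>face v i. grd z x \<bullet> outer_normal v i = p i x + \<phi> i x)"
    by (rule bchoice[THEN exE])
  have p: "p i \<in> polys 2" and \<phi>: "\<phi> i \<in> Phi_space v i"
    and gz: "\<And>x. x \<in> face v i \<Longrightarrow> grd z x \<bullet> outer_normal v i = p i x + \<phi> i x" if "i \<in> {0..3}" for i
    using bspec[OF all that] by simp_all
  let ?c = "\<lambda>i. - 1 / dcoef v i i"
  let ?L = "\<lambda>x. \<Sum>i\<in>{0..3}. ?c i * lift i (\<phi> i) x"
  have L: "C2_bounded I (lift i (\<phi> i))" if "i \<in> {0..3}" for i by (rule C2_lift[OF \<phi>[OF that] that])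
  have CL: "C2_bounded I ?L"
    and VL: "\<And>x. x \<in> T \<Longrightarrow> val ?L x = (\<Sum>i\<in>{0..3}. ?c i * val (lift i (\<phi> i)) x)"
    and GL: "\<And>x. x \<in> T \<Longrightarrow> grd ?L x = (\<Sum>i\<in>{0..3}. ?c i *\<^sub>R grd (lift i (\<phi> i)) x)"
    by (rule C2_sum; use L in simp)+
  have weq: "w x = z x + ?L x" if x: "x \<in> I" for x
  proof -
    have "normal_lift v i (q_part v i z) x = - (?c i * lift i (\<phi> i) x)" if i: "i \<in> {0..3}" for i
    proof -
      have q: "q_part v i z = restrict (\<phi> i) (face v i)"
        by (rule q_part_eq[OF i p[OF i] \<phi>[OF i]]) (rule gz[OF i])
      show ?thesis
        unfolding q normal_lift_def bary_ext_eq[OF i \<phi>[OF i] I_subset[OF x]] by (simp add: lift_def)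
    qed
    then show ?thesis by (simp add: z(2) R_op_def sum_negf)
  qed
  note C2z = element_likeD(1)[OF nz]
  note C = symbol_add[OF C2z CL]
  have Cw: "C2_bounded I w" by (rule C2_cong(1)[OF C]) (rule weq)
  then show "C2_bounded I w" .
  have V: "val w x = val z x + (\<Sum>i\<in>{0..3}. ?c i * val (lift i (\<phi> i)) x)" if x: "x \<in> T" for x
  proof -
    have "val w x = val (\<lambda>x. z x + ?L x) x" by (rule C2_cong(2)[OF C _ x]) (rule weq)
    then show ?thesis using C2_val_add[OF C2z CL x] VL[OF x] by simp
  qed
  have G: "grd w x = grd z x + (\<Sum>i\<in>{0..3}. ?c i *\<^sub>R grd (lift i (\<phi> i)) x)" if x: "x \<in> T" for x
  proof -
    have "grd w x = grd (\<lambda>x. z x + ?L x) x" by (rule C2_cong(3)[OF C _ x]) (rule weq)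
    then show ?thesis using C2_grd_add[OF C2z CL x] GL[OF x] by simp
  qed
  show "edge_quadratic a b (grd w)" if ab: "a \<in> {0..3}" "b \<in> {0..3}" "a \<noteq> b" for a b
  proof (rule edge_quadratic_cong[OF element_likeD(3)[OF nz ab]])
    fix x assume x: "on_edge a b x"
    have xT: "x \<in> T" using x by (simp add: on_edge_def)
    have "grd (lift i (\<phi> i)) x = 0" if i: "i \<in> {0..3}" for i
    proof -
      have "\<not> {0..3::nat} \<subseteq> {a, b, i}"
        using card_mono[of "{a, b, i}" "{0..3::nat}"] card_insert_le_m1[of 3 "{b, i}" a] card_insert_le_m1[of 2 "{i}" b] by auto
      then obtain j where j: "j \<in> {0..3}" "j \<notin> {a, b, i}" by blast
      then have "bary v j x = 0" using x unfolding on_edge_def by blast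
      then show ?thesis using lift_other_face(2)[OF \<phi>[OF i] i _ xT] j by blast
    qed
    then show "grd w x = grd z x" using G[OF xT] by simp
  qed
  show "face_trace i l m n (val w)" if e: "{i, l, m, n} = {0..3}" for i l m n
  proof -
    have i: "i \<in> {0..3}" using e by blast
    have "val w x = val z x" if x: "x \<in> face v i" for x
    proof -
      have "val (lift j (\<phi> j)) x = 0" if j: "j \<in> {0..3}" for j
      proof (cases "j = i")
        case True
        then show ?thesis using lift_own_face(1)[OF \<phi>[OF j] j face_subset[OF x]] face_zero[OF x] by simp
      next
        case False
        then show ?thesis using lift_other_face(1)[OF \<phi>[OF j] j _ face_subset[OF x] face_zero[OF x]] i by simp
      qed
      then show ?thesis using V[OF face_subset[OF x]] by simp
    qed
    then show ?thesis using element_likeD(4)[OF nz e] unfolding face_trace_def by simp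
  qed
  show "\<exists>p\<in>polys 2. \<forall>x\<in>face v i. grd w x \<bullet> outer_normal v i = p x" if i: "i \<in> {0..3}" for i
  proof (rule bexI[OF _ p[OF i]], rule ballI)
    fix x assume x: "x \<in> face v i"
    let ?\<nu> = "outer_normal v i"
    have "grd w x \<bullet> ?\<nu> - p i x = 0"
    proof (rule zero_on_face_if_zero_inside_face[OF i _ _ x])
      show "continuous_on T (\<lambda>x. grd w x \<bullet> ?\<nu> - p i x)"
        by (intro continuous_intros C2_grd_continuous Cw polys2_continuous p i)
      fix y assume y: "y \<in> face v i" and ne: "\<And>j. j \<in> {0..3} - {i} \<Longrightarrow> bary v j y \<noteq> 0"
      have "(\<Sum>j\<in>{0..3}. ?c j *\<^sub>R grd (lift j (\<phi> j)) y) = (\<Sum>j\<in>{i}. ?c j *\<^sub>R grd (lift j (\<phi> j)) y)"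
      proof (rule sum.mono_neutral_right)
        show "\<forall>j\<in>{0..3} - {i}. ?c j *\<^sub>R grd (lift j (\<phi> j)) y = 0"
        proof
          fix j assume j: "j \<in> {0..3} - {i}"
          then have "grd (lift j (\<phi> j)) y = 0"
            using i by (intro lift_other_face(2)[OF \<phi> _ _ face_subset[OF y] face_zero[OF y]]) auto
          then show "?c j *\<^sub>R grd (lift j (\<phi> j)) y = 0" by simp
        qed
      qed (use i in auto)
      moreover have "grd (lift i (\<phi> i)) y = \<phi> i y *\<^sub>R gl i"
        by (rule lift_own_face(2)[OF \<phi>[OF i] i face_subset[OF y] face_zero[OF y] ne])
      ultimately have "grd w y = grd z y + ?c i *\<^sub>R (\<phi> i y *\<^sub>R gl i)" using G[OF face_subset[OF y]] by simp
      then show "grd w y \<bullet> ?\<nu> - p i y = 0"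
        using gz[OF i y] gl_outer_normal[OF i] dcoef_nonzero[OF i] by (simp add: inner_add_left inner_diff_left)
    qed
    then show "grd w x \<bullet> ?\<nu> = p i x" by simp
  qed
qed

end

section \<open>Agreement on a common edge\<close>

lemma orthogonal_to_frame_zero:
  fixes u \<tau> g0 g1 :: point
  assumes "independent {g0, g1}" "g0 \<noteq> g1" "\<tau> \<noteq> 0" "g0 \<bullet> \<tau> = 0" "g1 \<bullet> \<tau> = 0"
    and "u \<bullet> g0 = 0" "u \<bullet> g1 = 0" "u \<bullet> \<tau> = 0"
  shows "u = 0"
proof -
  have "\<tau> \<notin> span {g0, g1}"
  proof
    assume "\<tau> \<in> span {g0, g1}"
    then have "orthogonal \<tau> \<tau>"
      by (rule orthogonal_to_span) (use assms in \<open>auto simp: orthogonal_def inner_commute\<close>)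
    then show False using assms(3) by (simp add: orthogonal_self)
  qed
  then have ind: "independent {\<tau>, g0, g1}" using assms(1) by (rule independent_insertI)
  have "\<tau> \<noteq> g0" "\<tau> \<noteq> g1" using \<open>\<tau> \<notin> span {g0, g1}\<close> span_base[of _ "{g0, g1}"] by blast+
  then have "card {\<tau>, g0, g1} = 3" using assms(2) by simp
  then have "UNIV \<subseteq> span {\<tau>, g0, g1}" using ind by (intro card_ge_dim_independent) auto
  then have "orthogonal u u"
    by (intro orthogonal_to_span[of u "{\<tau>, g0, g1}"]) (use assms in \<open>auto simp: orthogonal_def inner_commute\<close>)
  then show ?thesis by (simp add: orthogonal_self)
qed

lemma edge_mid_segment: "edge_mid (closed_segment a b) = midpoint a b"
  unfolding edge_mid_def
proof (rule the_equality)
  show "\<exists>a' b'. closed_segment a b = closed_segment a' b' \<and> midpoint a b = midpoint a' b'"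
    by (intro exI conjI) (rule refl)+
next
  fix m assume "\<exists>a' b'. closed_segment a b = closed_segment a' b' \<and> m = midpoint a' b'"
  then obtain a' b' where "closed_segment a b = closed_segment a' b'" "m = midpoint a' b'" by (elim exE conjE)
  then show "m = midpoint a b" by (auto simp: closed_segment_eq doubleton_eq_iff midpoint_sym)
qed

lemma bubble_derivatives:
  "((\<lambda>t. bubble ((1 - t) / 2) ((1 - t) / 2) t) has_real_derivative 1/4) (at 0 within S)"
  "((\<lambda>t. bubble ((1 - t) / 2) t ((1 - t) / 2)) has_real_derivative 0) (at 0 within S)"
  unfolding bubble_def by (rule derivative_eq_intros refl | simp add: power2_eq_square)+

lemma quadratic_edge_derivative:
  "((\<lambda>t::real. a * (1 - t)\<^sup>2 + b * t\<^sup>2 + c * ((1 - t) * t) + d * ((1 - t)\<^sup>2 * t - t\<^sup>2 * (1 - t)))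
     has_real_derivative - 2 * a + c + d) (at 0 within S)"
  by (rule derivative_eq_intros refl | simp)+

locale tetrahedron_element = tetrahedron +
  fixes w :: "point \<Rightarrow> real"
  assumes w: "w \<in> Z3sing v"
begin

lemma C2: "C2_bounded I w" using w by (rule Z3sing_local(1))

lemma on_edge_point:
  assumes "on_edge a b x" "a \<in> {0..3}" "b \<in> {0..3}" "a \<noteq> b"
  shows "x = v a + bary v b x *\<^sub>R (v b - v a)" "0 \<le> bary v b x" "bary v b x \<le> 1"
proof -
  have "x = (\<Sum>k\<in>{0..3}. bary v k x *\<^sub>R v k)" by (simp only: bary_point)
  also have "\<dots> = (\<Sum>k\<in>{a, b}. bary v k x *\<^sub>R v k)"
    by (rule sum.mono_neutral_right) (use assms in \<open>auto simp: on_edge_def\<close>)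
  also have "\<dots> = bary v a x *\<^sub>R v a + bary v b x *\<^sub>R v b" using assms(4) by simp
  also have "bary v a x = 1 - bary v b x" using on_edge_sum[OF assms] by simp
  finally show "x = v a + bary v b x *\<^sub>R (v b - v a)" by (simp add: algebra_simps)
  show "0 \<le> bary v b x" "bary v b x \<le> 1" using bary_bounds[of x b] assms by (auto simp: on_edge_def)
qed

lemma bary_edge_point:
  assumes "a \<in> {0..3}" "b \<in> {0..3}" "a \<noteq> b" "k \<in> {0..3}"
  shows "bary v k (v a + t *\<^sub>R (v b - v a)) = (if k = a then 1 - t else if k = b then t else 0)"
  unfolding bary_line[OF assms(4)] bary_diff[OF assms(4), symmetric] using assms by (auto simp: bary_vertex)

lemma edge_point_on_edge:
  assumes "a \<in> {0..3}" "b \<in> {0..3}" "a \<noteq> b" "0 \<le> t" "t \<le> 1"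
  shows "on_edge a b (v a + t *\<^sub>R (v b - v a))"
  unfolding on_edge_def tet_iff using bary_edge_point[OF assms(1-3), of _ t] assms(4,5) by auto

lemma edge_values:
  assumes ab: "a \<in> {0..3}" "b \<in> {0..3}" "a \<noteq> b"
  obtains c0 c1 c2 c3 where "\<forall>t\<in>{0..1}. val w (v a + t *\<^sub>R (v b - v a)) =
    c0 * (1 - t)\<^sup>2 + c1 * t\<^sup>2 + c2 * ((1 - t) * t) + c3 * ((1 - t)\<^sup>2 * t - t\<^sup>2 * (1 - t))"
proof -
  have "card ({0..3} - {a, b}) = 2" using ab by (subst card_Diff_subset) auto
  then obtain i c where ic: "{0..3} - {a, b} = {i, c}" "i \<noteq> c" unfolding card_2_iff by (elim exE conjE)
  then have e: "{i, a, b, c} = {0..3}" using ab by blast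
  obtain d where d: "\<forall>x\<in>face v i. val w x = trace_form d (bary v a x) (bary v b x) (bary v c x)"
    using Z3sing_local(3)[OF w e] unfolding face_trace_def by (elim exE)
  note dis = distinct_indices[OF e]
  show ?thesis
  proof (rule that[of "d 0" "d 1" "d 3" "d 6"], rule ballI)
    fix t :: real assume t: "t \<in> {0..1}"
    let ?x = "v a + t *\<^sub>R (v b - v a)"
    note bp = bary_edge_point[OF ab, of _ t]
    have "?x \<in> face v i"
      using edge_point_on_edge[OF ab, of t] t bp[of i] dis by (simp add: face_def on_edge_def)
    then have "val w ?x = trace_form d (1 - t) t 0" using d bp dis by simp
    then show "val w ?x = d 0 * (1 - t)\<^sup>2 + d 1 * t\<^sup>2 + d 3 * ((1 - t) * t) + d 6 * ((1 - t)\<^sup>2 * t - t\<^sup>2 * (1 - t))"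
      by (simp add: trace_form_def bubble_def del: One_nat_def)
  qed
qed

lemma edge_gradients:
  assumes ab: "a \<in> {0..3}" "b \<in> {0..3}" "a \<noteq> b"
  obtains A B C where "\<forall>t\<in>{0..1}. grd w (v a + t *\<^sub>R (v b - v a)) = (1 - t)\<^sup>2 *\<^sub>R A + ((1 - t) * t) *\<^sub>R B + t\<^sup>2 *\<^sub>R C"
proof -
  obtain A B C where q: "\<forall>x. on_edge a b x \<longrightarrow>
     grd w x = (bary v a x)\<^sup>2 *\<^sub>R A + (bary v a x * bary v b x) *\<^sub>R B + (bary v b x)\<^sup>2 *\<^sub>R C"
    using Z3sing_local(2)[OF w ab] unfolding edge_quadratic_def by (elim exE)
  show ?thesis
  proof (rule that[of A B C], rule ballI)
    fix t :: real assume t: "t \<in> {0..1}"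
    show "grd w (v a + t *\<^sub>R (v b - v a)) = (1 - t)\<^sup>2 *\<^sub>R A + ((1 - t) * t) *\<^sub>R B + t\<^sup>2 *\<^sub>R C"
      using q[rule_format, OF edge_point_on_edge[OF ab, of t]] t bary_edge_point[OF ab, of a t] bary_edge_point[OF ab, of b t] ab
      by simp
  qed
qed

end

locale two_elements = E1: tetrahedron_element v w + E2: tetrahedron_element v' w' for v w v' w'
begin

definition jump :: "point \<Rightarrow> real" where "jump x = cont_ext (tet v) w x - cont_ext (tet v') w' x"
definition grad_jump :: "point \<Rightarrow> point" where
  "grad_jump x = cont_ext (tet v) (grad w) x - cont_ext (tet v') (grad w') x"

lemma jump_segment:
  assumes "x \<in> tet v" "y \<in> tet v" "x \<in> tet v'" "y \<in> tet v'"
  shows "((\<lambda>t. jump (x + t *\<^sub>R (y - x))) has_real_derivative grad_jump x \<bullet> (y - x)) (at 0 within {0..1})"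
  unfolding jump_def grad_jump_def inner_diff_left
  by (intro DERIV_diff E1.C2_segment[OF E1.C2] E2.C2_segment[OF E2.C2] assms)

lemma jump_derivative_eq:
  assumes xy: "x \<in> tet v" "y \<in> tet v" "x \<in> tet v'" "y \<in> tet v'"
    and eq: "\<And>t. t \<in> {0..1} \<Longrightarrow> jump (x + t *\<^sub>R (y - x)) = f t" and f: "(f has_real_derivative d) (at 0 within {0..1})"
  shows "grad_jump x \<bullet> (y - x) = d"
proof (rule E1.segment_derivative_unique)
  show "((\<lambda>t. jump (x + t *\<^sub>R (y - x))) has_real_derivative d) (at 0 within {0..1})"
    by (rule has_field_derivative_transform_within[OF f, of 1]) (auto simp: eq)
qed (rule jump_segment[OF xy])

end

text \<open>\<open>a\<close>, \<open>b\<close> and \<open>a'\<close>, \<open>b'\<close> are the labels of the same two vertices in the two tetrahedra.\<close>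

locale shared_edge = two_elements v w v' w' for v w v' w' +
  fixes a b a' b' :: nat and g0 g1 :: point
  assumes ab: "a \<in> {0..3}" "b \<in> {0..3}" "a \<noteq> b" and ab': "a' \<in> {0..3}" "b' \<in> {0..3}" "a' \<noteq> b'"
    and va: "v' a' = v a" and vb: "v' b' = v b"
    and vertex_data: "jump (v a) = 0" "grad_jump (v a) = 0" "jump (v b) = 0" "grad_jump (v b) = 0"
    and mid_data: "grad_jump (midpoint (v a) (v b)) \<bullet> g0 = 0" "grad_jump (midpoint (v a) (v b)) \<bullet> g1 = 0"
    and frame: "independent {g0, g1}" "g0 \<noteq> g1" "g0 \<bullet> (v b - v a) = 0" "g1 \<bullet> (v b - v a) = 0"
begin

lemma edge_in_both:
  assumes "0 \<le> t" "t \<le> 1"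
  shows "v a + t *\<^sub>R (v b - v a) \<in> tet v" "v a + t *\<^sub>R (v b - v a) \<in> tet v'"
  using E1.edge_point_on_edge[OF ab assms] E2.edge_point_on_edge[OF ab' assms]
  by (simp_all add: E1.on_edge_def E2.on_edge_def va vb)

lemma vertices_in_both: "v a \<in> tet v" "v a \<in> tet v'" "v b \<in> tet v" "v b \<in> tet v'"
  using edge_in_both[of 0] edge_in_both[of 1] by simp_all

text \<open>Hermite interpolation: a cubic is determined by its values and derivatives at two points.\<close>

lemma jump_on_edge:
  assumes t: "t \<in> {0..1}" shows "jump (v a + t *\<^sub>R (v b - v a)) = 0"
proof -
  obtain c0 c1 c2 c3 where c: "\<forall>t\<in>{0..1}. cont_ext (tet v) w (v a + t *\<^sub>R (v b - v a)) =
    c0 * (1 - t)\<^sup>2 + c1 * t\<^sup>2 + c2 * ((1 - t) * t) + c3 * ((1 - t)\<^sup>2 * t - t\<^sup>2 * (1 - t))"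
    using E1.edge_values[OF ab] .
  obtain d0 d1 d2 d3 where d: "\<forall>t\<in>{0..1}. cont_ext (tet v') w' (v' a' + t *\<^sub>R (v' b' - v' a')) =
    d0 * (1 - t)\<^sup>2 + d1 * t\<^sup>2 + d2 * ((1 - t) * t) + d3 * ((1 - t)\<^sup>2 * t - t\<^sup>2 * (1 - t))"
    using E2.edge_values[OF ab'] .
  define e0 e1 e2 e3 where "e0 = c0 - d0" and "e1 = c1 - d1" and "e2 = c2 - d2" and "e3 = c3 - d3"
  have J: "jump (v a + t *\<^sub>R (v b - v a)) =
     e0 * (1 - t)\<^sup>2 + e1 * t\<^sup>2 + e2 * ((1 - t) * t) + e3 * ((1 - t)\<^sup>2 * t - t\<^sup>2 * (1 - t))" if "t \<in> {0..1}" for t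
    using bspec[OF c that] bspec[OF d that] unfolding jump_def va vb e0_def e1_def e2_def e3_def
    by (simp add: left_diff_distrib)
  have e0: "e0 = 0" using J[of 0] vertex_data by simp
  have e1: "e1 = 0" using J[of 1] vertex_data by simp
  have "grad_jump (v a) \<bullet> (v b - v a) = - 2 * e0 + e2 + e3"
    by (rule jump_derivative_eq[OF vertices_in_both(1,3,2,4) J quadratic_edge_derivative])
  then have 1: "e2 + e3 = 0" using vertex_data e0 by simp
  have "grad_jump (v b) \<bullet> (v a - v b) = - 2 * e1 + e2 + (- e3)"
  proof (rule jump_derivative_eq[OF vertices_in_both(3,1,4,2) _ quadratic_edge_derivative[of e1 e0]])
    fix t :: real assume "t \<in> {0..1}"
    then have "1 - t \<in> {0..1}" by auto
    moreover have "v b + t *\<^sub>R (v a - v b) = v a + (1 - t) *\<^sub>R (v b - v a)" by (simp add: algebra_simps)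
    ultimately show "jump (v b + t *\<^sub>R (v a - v b)) =
      e1 * (1 - t)\<^sup>2 + e0 * t\<^sup>2 + e2 * ((1 - t) * t) + (- e3) * ((1 - t)\<^sup>2 * t - t\<^sup>2 * (1 - t))"
      using J[of "1 - t"] by (simp add: algebra_simps)
  qed
  then have 2: "e2 - e3 = 0" using vertex_data e1 by simp
  have "e2 = 0" "e3 = 0" using 1 2 by linarith+
  then show ?thesis using J[OF t] e0 e1 by simp
qed

text \<open>The jump of the gradient is quadratic along the edge and vanishes at both ends, so the midpoint
  decides. There two components are prescribed, and the tangential one is a derivative of the jump, which
  vanishes along the edge.\<close>

lemma grad_jump_on_edge:
  assumes t: "t \<in> {0..1}" shows "grad_jump (v a + t *\<^sub>R (v b - v a)) = 0"
proof -
  obtain A B C where c: "\<forall>t\<in>{0..1}. cont_ext (tet v) (grad w) (v a + t *\<^sub>R (v b - v a)) =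
      (1 - t)\<^sup>2 *\<^sub>R A + ((1 - t) * t) *\<^sub>R B + t\<^sup>2 *\<^sub>R C"
    using E1.edge_gradients[OF ab] .
  obtain A' B' C' where d: "\<forall>t\<in>{0..1}. cont_ext (tet v') (grad w') (v' a' + t *\<^sub>R (v' b' - v' a')) =
      (1 - t)\<^sup>2 *\<^sub>R A' + ((1 - t) * t) *\<^sub>R B' + t\<^sup>2 *\<^sub>R C'"
    using E2.edge_gradients[OF ab'] .
  have J: "grad_jump (v a + t *\<^sub>R (v b - v a)) = (1 - t)\<^sup>2 *\<^sub>R (A - A') + ((1 - t) * t) *\<^sub>R (B - B') + t\<^sup>2 *\<^sub>R (C - C')"
    if "t \<in> {0..1}" for t
    using bspec[OF c that] bspec[OF d that] unfolding grad_jump_def va vb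
    by (simp add: scaleR_diff_right)
  have A: "A - A' = 0" using J[of 0] vertex_data by simp
  have C: "C - C' = 0" using J[of 1] vertex_data by simp
  let ?m = "midpoint (v a) (v b)"
  have m: "?m = v a + (1/2) *\<^sub>R (v b - v a)" by (simp add: midpoint_def vec_eq_iff field_simps)
  have "grad_jump ?m \<bullet> (v b - ?m) = 0"
  proof (rule jump_derivative_eq)
    show "?m \<in> tet v" "?m \<in> tet v'" unfolding m by (rule edge_in_both; simp)+
    show "v b \<in> tet v" "v b \<in> tet v'" by (rule vertices_in_both)+
    show "((\<lambda>t. 0) has_real_derivative 0) (at 0 within {0..1})" by simp
    fix t :: real assume t: "t \<in> {0..1}"
    have "?m + t *\<^sub>R (v b - ?m) = v a + ((1 + t) / 2) *\<^sub>R (v b - v a)"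
      unfolding m by (simp add: vec_eq_iff field_simps)
    then show "jump (?m + t *\<^sub>R (v b - ?m)) = 0" using jump_on_edge[of "(1 + t) / 2"] t by simp
  qed
  moreover have "v b - ?m = (1/2) *\<^sub>R (v b - v a)" unfolding m by (simp add: vec_eq_iff field_simps)
  ultimately have "grad_jump ?m \<bullet> (v b - v a) = 0" by simp
  moreover have "v b - v a \<noteq> 0" using E1.inj ab by (auto dest: inj_onD)
  ultimately have "grad_jump ?m = 0"
    by (intro orthogonal_to_frame_zero[OF frame(1,2) _ frame(3,4) mid_data])
  then have "B - B' = 0" using J[of "1/2"] A C m by simp
  then show ?thesis using J[OF t] A C by simp
qed

lemma on_edge_zero:
  assumes "E1.on_edge a b x" shows "jump x = 0" "grad_jump x = 0"
  using E1.on_edge_point[OF assms ab] jump_on_edge[of "bary v b x"] grad_jump_on_edge[of "bary v b x"] by auto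

end

section \<open>Agreement on a common face\<close>

context two_elements
begin

context
  fixes i l m n i' l' m' n' :: nat
  assumes e: "{i, l, m, n} = {0..3}" and e': "{i', l', m', n'} = {0..3}"
    and vl: "v' l' = v l" and vm: "v' m' = v m" and vn: "v' n' = v n"
    and edges: "\<And>x. x \<in> face v i \<Longrightarrow> bary v l x = 0 \<or> bary v m x = 0 \<or> bary v n x = 0 \<Longrightarrow> jump x = 0 \<and> grad_jump x = 0"
begin

lemma face_transport:
  assumes x: "x \<in> face v i"
  shows "x \<in> face v' i'" "bary v' l' x = bary v l x" "bary v' m' x = bary v m x" "bary v' n' x = bary v n x"
proof -
  note d = E1.distinct_indices[OF e] and d' = E1.distinct_indices[OF e']
  define u where "u = (\<lambda>k. if k = l' then bary v l x else if k = m' then bary v m x else if k = n' then bary v n x else 0)"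
  have x0: "bary v i x = 0" using x by (rule E1.face_zero)
  have 1: "(\<Sum>k\<in>{0..3}. u k) = 1"
    unfolding sum_four[OF e'] using E1.face_sum(1)[OF e x] d' by (simp add: u_def)
  have 2: "(\<Sum>k\<in>{0..3}. u k *\<^sub>R v' k) = x"
  proof -
    have "bary v l x *\<^sub>R v l + (bary v m x *\<^sub>R v m + bary v n x *\<^sub>R v n) = x"
      using E1.bary_point[of x] unfolding sum_four[OF e] x0 by simp
    then show ?thesis unfolding sum_four[OF e'] using d' by (simp add: u_def vl vm vn)
  qed
  have b: "bary v' k x = u k" if "k \<in> {0..3}" for k by (rule E2.bary_eqI[OF 1 2 that])
  have "0 \<le> bary v k x" if "k \<in> {0..3}" for k using E1.bary_bounds[OF E1.face_subset[OF x] that] by blast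
  then show "x \<in> face v' i'"
    unfolding face_def mem_Collect_eq E2.tet_iff using d d' by (auto simp: b u_def)
  show "bary v' l' x = bary v l x" "bary v' m' x = bary v m x" "bary v' n' x = bary v n x"
    using d' by (simp_all add: b u_def)
qed

lemma face_in_both: "x \<in> face v i \<Longrightarrow> x \<in> tet v" "x \<in> face v i \<Longrightarrow> x \<in> tet v'"
  using E1.face_subset E2.face_subset face_transport(1) by blast+

lemma face_segment:
  assumes "x \<in> face v i" "y \<in> face v i" "t \<in> {0..1}"
  shows "x + t *\<^sub>R (y - x) \<in> face v i"
    "k \<in> {0..3} \<Longrightarrow> bary v k (x + t *\<^sub>R (y - x)) = (1 - t) * bary v k x + t * bary v k y"
proof -
  show b: "bary v k (x + t *\<^sub>R (y - x)) = (1 - t) * bary v k x + t * bary v k y" if "k \<in> {0..3}" for k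
    unfolding E1.bary_line[OF that] E1.bary_diff[OF that, symmetric] by (simp add: algebra_simps)
  have "0 \<le> (1 - t) * bary v k x + t * bary v k y" if "k \<in> {0..3}" for k
    using E1.bary_bounds[OF E1.face_subset[OF assms(1)] that] E1.bary_bounds[OF E1.face_subset[OF assms(2)] that] assms(3)
    by simp
  moreover have "bary v i (x + t *\<^sub>R (y - x)) = 0"
    unfolding b[OF E1.distinct_indices(7)[OF e]] using E1.face_zero[OF assms(1)] E1.face_zero[OF assms(2)] by simp
  ultimately show "x + t *\<^sub>R (y - x) \<in> face v i" using b by (auto simp: face_def E1.tet_iff)
qed

text \<open>Vanishing on the edges eliminates the polynomial part of the trace. At the midpoint of an edge the
  derivative towards the opposite vertex is \<open>1/4\<close> for the bubble of this edge and 0 for the two others, so the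
  coefficients of the bubbles vanish as well.\<close>

lemma jump_on_face:
  assumes x: "x \<in> face v i" shows "jump x = 0"
proof -
  note d = E1.distinct_indices[OF e]
  obtain c where c: "\<forall>x\<in>face v i. cont_ext (tet v) w x = trace_form c (bary v l x) (bary v m x) (bary v n x)"
    using E1.Z3sing_local(3)[OF E1.w e] unfolding E1.face_trace_def by (elim exE)
  obtain c' where c': "\<forall>x\<in>face v' i'. cont_ext (tet v') w' x = trace_form c' (bary v' l' x) (bary v' m' x) (bary v' n' x)"
    using E2.Z3sing_local(3)[OF E2.w e'] unfolding E2.face_trace_def by (elim exE)
  define f where "f = (\<lambda>k. (-1) * c' k + c k)"
  have J: "jump x = trace_form f (bary v l x) (bary v m x) (bary v n x)" if x: "x \<in> face v i" for x
    using bspec[OF c x] bspec[OF c' face_transport(1)[OF x]] face_transport(2-4)[OF x]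
    unfolding jump_def f_def trace_form_step by simp
  have ed: "trace_form f p q r = 0" if h: "0 \<le> p" "0 \<le> q" "0 \<le> r" "p + q + r = 1" "p = 0 \<or> q = 0 \<or> r = 0" for p q r
  proof -
    obtain y where y: "y \<in> face v i" "bary v l y = p" "bary v m y = q" "bary v n y = r" by (rule E1.face_point[OF e h(1-4)])
    show ?thesis using J[OF y(1)] edges[OF y(1)] h(5) unfolding y(2-4) by simp
  qed
  have f0: "f k = 0" if "k \<le> 8" for k
    by (rule trace_form_zero_on_edges[OF _ _ _ that]) (rule ed; simp)+
  have form: "trace_form f p q r = f 9 * bubble p q r + f 10 * bubble p r q + f 11 * bubble q r p" for p q r
    by (simp add: trace_form_def f0)
  \<comment> \<open>The jump has derivative \<open>D\<close> from a point of an edge towards any other point of the face.\<close>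
  have mid: "D = 0"
    if h: "0 \<le> p" "0 \<le> q" "0 \<le> r" "p + q + r = 1" "p = 0 \<or> q = 0 \<or> r = 0" "0 \<le> p'" "0 \<le> q'" "0 \<le> r'" "p' + q' + r' = 1"
      and D: "((\<lambda>t. trace_form f ((1 - t) * p + t * p') ((1 - t) * q + t * q') ((1 - t) * r + t * r')) has_real_derivative D) (at 0 within {0..1})"
    for p q r p' q' r' D
  proof -
    obtain y where y: "y \<in> face v i" "bary v l y = p" "bary v m y = q" "bary v n y = r" by (rule E1.face_point[OF e h(1-4)])
    obtain z where z: "z \<in> face v i" "bary v l z = p'" "bary v m z = q'" "bary v n z = r'" by (rule E1.face_point[OF e h(6-9)])
    have "grad_jump y \<bullet> (z - y) = D"
    proof (rule jump_derivative_eq[OF _ _ _ _ _ D])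
      fix t :: real assume t: "t \<in> {0..1}"
      show "jump (y + t *\<^sub>R (z - y)) = trace_form f ((1 - t) * p + t * p') ((1 - t) * q + t * q') ((1 - t) * r + t * r')"
        unfolding J[OF face_segment(1)[OF y(1) z(1) t]] face_segment(2)[OF y(1) z(1) t d(8)]
          face_segment(2)[OF y(1) z(1) t d(9)] face_segment(2)[OF y(1) z(1) t d(10)] y(2-4) z(2-4) ..
    qed (use y z face_in_both in auto)
    moreover have "grad_jump y = 0" using edges[OF y(1)] h(5) unfolding y(2-4) by simp
    ultimately show ?thesis by simp
  qed
  have bd1: "((\<lambda>t. bubble ((1 - t) * (1/2) + t * 0) ((1 - t) * (1/2) + t * 0) ((1 - t) * 0 + t * 1)) has_real_derivative 1/4) (at 0 within {0..1})"
   and bd2: "((\<lambda>t. bubble ((1 - t) * (1/2) + t * 0) ((1 - t) * 0 + t * 1) ((1 - t) * (1/2) + t * 0)) has_real_derivative 0) (at 0 within {0..1})"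
   and bd3: "((\<lambda>t. bubble ((1 - t) * 0 + t * 1) ((1 - t) * (1/2) + t * 0) ((1 - t) * (1/2) + t * 0)) has_real_derivative 0) (at 0 within {0..1})"
    using bubble_derivatives[of "{0..1}"] bubble_commute by simp_all
  have "f 9 * (1/4) + f 10 * 0 + f 11 * 0 = 0"
  proof (rule mid)
    show "((\<lambda>t. trace_form f ((1 - t) * (1/2) + t * 0) ((1 - t) * (1/2) + t * 0) ((1 - t) * 0 + t * 1))
      has_real_derivative f 9 * (1/4) + f 10 * 0 + f 11 * 0) (at 0 within {0..1})"
      unfolding form by (intro DERIV_add DERIV_cmult bd1 bd2 bd3)
  qed simp_all
  moreover have "f 9 * 0 + f 10 * (1/4) + f 11 * 0 = 0"
  proof (rule mid)
    show "((\<lambda>t. trace_form f ((1 - t) * (1/2) + t * 0) ((1 - t) * 0 + t * 1) ((1 - t) * (1/2) + t * 0))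
      has_real_derivative f 9 * 0 + f 10 * (1/4) + f 11 * 0) (at 0 within {0..1})"
      unfolding form by (intro DERIV_add DERIV_cmult bd1 bd2 bd3)
  qed simp_all
  moreover have "f 9 * 0 + f 10 * 0 + f 11 * (1/4) = 0"
  proof (rule mid)
    show "((\<lambda>t. trace_form f ((1 - t) * 0 + t * 1) ((1 - t) * (1/2) + t * 0) ((1 - t) * (1/2) + t * 0))
      has_real_derivative f 9 * 0 + f 10 * 0 + f 11 * (1/4)) (at 0 within {0..1})"
      unfolding form by (intro DERIV_add DERIV_cmult bd1 bd2 bd3)
  qed simp_all
  ultimately show ?thesis using J[OF x] unfolding form by simp
qed

text \<open>The tangential part is a derivative of the jump, and the normal component is a quadratic that vanishes
  on the edges.\<close>

lemma grad_jump_on_face: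
  assumes x: "x \<in> face v i" shows "grad_jump x = 0"
proof -
  note d = E1.distinct_indices[OF e] and d' = E1.distinct_indices[OF e']
  let ?g = "E1.gl i" and ?g' = "E2.gl i'"
  have tangential: "grad_jump y \<bullet> (v k - y) = 0" if y: "y \<in> face v i" and k: "k \<in> {l, m, n}" for y k
  proof (rule jump_derivative_eq)
    have vk: "v k \<in> face v i" using k d by (intro E1.vertex_in_face) auto
    show "y \<in> tet v" "v k \<in> tet v" "y \<in> tet v'" "v k \<in> tet v'" using y vk face_in_both by blast+
    show "((\<lambda>t. 0) has_real_derivative 0) (at 0 within {0..1})" by simp
    show "jump (y + t *\<^sub>R (v k - y)) = 0" if "t \<in> {0..1}" for t
      by (rule jump_on_face[OF face_segment(1)[OF y vk that]])
  qed
  have J: "{0..3} - {i} = {l, m, n}" "{0..3} - {i'} = {l', m', n'}" using e d e' d' by blast+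
  have normal: "grad_jump y = (grad_jump y \<bullet> (v i - v l)) *\<^sub>R ?g" if y: "y \<in> face v i" for y
  proof (rule E1.orthogonal_to_face[OF d(7)])
    show "l \<in> {0..3} - {i}" using J by blast
    fix k assume "k \<in> {0..3} - {i}"
    then show "grad_jump y \<bullet> (v k - v l) = 0"
      using tangential[OF y, of k] tangential[OF y, of l] J by (simp add: inner_diff_right)
  qed
  obtain \<kappa> where \<kappa>: "?g = \<kappa> *\<^sub>R ?g'"
  proof
    show "?g = (?g \<bullet> (v' i' - v' l')) *\<^sub>R ?g'"
    proof (rule E2.orthogonal_to_face[OF d'(7)])
      show "l' \<in> {0..3} - {i'}" using J by blast
      fix k assume "k \<in> {0..3} - {i'}"
      then have "v' k \<in> {v l, v m, v n}" using J(2) vl vm vn by auto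
      then obtain j where j: "j \<in> {l, m, n}" "v' k = v j" by blast
      have "?g \<bullet> (v j - v l) = bary v i (v j) - bary v i (v l)" by (rule E1.bary_diff[OF d(7), symmetric])
      also have "\<dots> = 0" using j d by (auto simp: E1.bary_vertex)
      finally show "?g \<bullet> (v' k - v' l') = 0" by (simp add: j(2) vl)
    qed
  qed
  have nrm: "G \<bullet> E1.gl i = - norm ?g * (G \<bullet> outer_normal v i)" "G \<bullet> E2.gl i' = - norm ?g' * (G \<bullet> outer_normal v' i')" for G
    using E1.gl_nonzero[OF d(7)] E2.gl_nonzero[OF d'(7)]
    by (simp_all add: E1.outer_normal_eq[OF d(7)] E2.outer_normal_eq[OF d'(7)])
  obtain p where p: "p \<in> polys 2" "\<forall>x\<in>face v i. cont_ext (tet v) (grad w) x \<bullet> outer_normal v i = p x"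
    using E1.Z3sing_local(4)[OF E1.w d(7)] by (elim bexE)
  obtain p' where p': "p' \<in> polys 2" "\<forall>x\<in>face v' i'. cont_ext (tet v') (grad w') x \<bullet> outer_normal v' i' = p' x"
    using E2.Z3sing_local(4)[OF E2.w d'(7)] by (elim bexE)
  have P: "(\<lambda>x. (- norm ?g) * p x + (\<kappa> * norm ?g') * p' x) \<in> polys 2"
    by (intro polys_add polys_scale p p')
  obtain c where c: "\<forall>k\<ge>6. c k = 0"
    "\<forall>x\<in>face v i. (- norm ?g) * p x + (\<kappa> * norm ?g') * p' x = trace_form c (bary v l x) (bary v m x) (bary v n x)"
    using P e by (rule E1.quadratic_face_form)
  have Q: "grad_jump y \<bullet> ?g = trace_form c (bary v l y) (bary v m y) (bary v n y)" if y: "y \<in> face v i" for y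
  proof -
    have "grad_jump y \<bullet> ?g = cont_ext (tet v) (grad w) y \<bullet> ?g - \<kappa> * (cont_ext (tet v') (grad w') y \<bullet> ?g')"
      unfolding grad_jump_def inner_diff_left by (subst (2) \<kappa>) simp
    also have "\<dots> = (- norm ?g) * p y + (\<kappa> * norm ?g') * p' y"
      unfolding nrm using bspec[OF p(2) y] bspec[OF p'(2) face_transport(1)[OF y]] by simp
    finally show ?thesis using bspec[OF c(2) y] by simp
  qed
  have "trace_form c p q r = 0" for p q r
  proof (rule E1.quadratic_zero_on_edges[OF _ e])
    show "c k = 0" if "6 \<le> k" for k using c(1) that by blast
    show "trace_form c (bary v l y) (bary v m y) (bary v n y) = 0"
      if "y \<in> face v i" "bary v l y = 0 \<or> bary v m y = 0 \<or> bary v n y = 0" for y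
      using Q[OF that(1)] edges[OF that] by simp
  qed
  then have "grad_jump x \<bullet> ?g = 0" using Q[OF x] by simp
  then have "(grad_jump x \<bullet> (v i - v l)) * (?g \<bullet> ?g) = 0" by (subst (asm) normal[OF x]) simp
  then have "grad_jump x \<bullet> (v i - v l) = 0" using E1.gl_nonzero[OF d(7)] by simp
  then show ?thesis using normal[OF x] by simp
qed

end

end

lemma vertex_subset_hull_zero:
  assumes "tetrahedron v" "k \<in> {0..3}" "A \<subseteq> {0..3}" "k \<notin> A" "x \<in> convex hull (v ` A)"
  shows "bary v k x = 0"
proof -
  interpret tetrahedron v by fact
  have "convex {x. bary v k x = 0}"
  proof (rule convexI)
    fix y z and s t :: real
    assume yz: "y \<in> {x. bary v k x = 0}" "z \<in> {x. bary v k x = 0}" and st: "s + t = 1"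
    show "s *\<^sub>R y + t *\<^sub>R z \<in> {x. bary v k x = 0}"
      using yz unfolding mem_Collect_eq bary_affine[OF st assms(2)] by simp
  qed
  moreover have "v ` A \<subseteq> {x. bary v k x = 0}" using assms(2-4) by (auto simp: bary_vertex)
  ultimately have "convex hull (v ` A) \<subseteq> {x. bary v k x = 0}" by (intro hull_minimal)
  then show ?thesis using assms(5) by blast
qed

lemma vertex_segment_edge_of:
  assumes "tetrahedron v" "a \<in> {0..3}" "b \<in> {0..3}" "v a \<noteq> v b"
  shows "closed_segment (v a) (v b) edge_of tet v"
proof -
  interpret tetrahedron v by fact
  have "convex hull {v a, v b} face_of convex hull (v ` {0..3})"
    unfolding face_of_convex_hull_affine_independent[OF indep]
    by (rule exI[of _ "{v a, v b}"]) (use assms in simp)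
  moreover have "aff_dim (convex hull {v a, v b}) = 1" unfolding aff_dim_convex_hull using assms(4) by (simp add: aff_dim_2)
  ultimately show ?thesis unfolding edge_of_def tet_def segment_convex_hull by blast
qed

text \<open>The common face is the hull of the common vertices. If there are three of them, the result for faces
  applies; otherwise every common point lies on a common edge or is a common vertex.\<close>

lemma elements_agree_on_intersection:
  assumes v: "tetrahedron v" and v': "tetrahedron v'" and w: "w \<in> Z3sing v" and w': "w' \<in> Z3sing v'"
    and F: "(tet v \<inter> tet v') face_of tet v" "(tet v \<inter> tet v') face_of tet v'" and ne: "tet v \<noteq> tet v'"
    and vertex: "\<And>p. p extreme_point_of tet v \<Longrightarrow> p extreme_point_of tet v' \<Longrightarrow>
      cont_ext (tet v) w p = cont_ext (tet v') w' p \<and> cont_ext (tet v) (grad w) p = cont_ext (tet v') (grad w') p"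
    and mid: "\<And>e. e edge_of tet v \<Longrightarrow> e edge_of tet v' \<Longrightarrow> \<exists>g0 g1. independent {g0, g1} \<and> g0 \<noteq> g1 \<and>
       g0 \<in> edge_perp e \<and> g1 \<in> edge_perp e \<and>
       cont_ext (tet v) (grad w) (edge_mid e) \<bullet> g0 = cont_ext (tet v') (grad w') (edge_mid e) \<bullet> g0 \<and>
       cont_ext (tet v) (grad w) (edge_mid e) \<bullet> g1 = cont_ext (tet v') (grad w') (edge_mid e) \<bullet> g1"
    and x: "x \<in> tet v" "x \<in> tet v'"
  shows "cont_ext (tet v) w x = cont_ext (tet v') w' x \<and> cont_ext (tet v) (grad w) x = cont_ext (tet v') (grad w') x"
proof -
  interpret two_elements v w v' w'
    using v v' w w' by (simp add: two_elements_def tetrahedron_element_def tetrahedron_element_axioms_def)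
  obtain c where c: "c \<subseteq> v ` {0..3}" "tet v \<inter> tet v' = convex hull c"
    using F(1) unfolding tet_def[of v] face_of_convex_hull_affine_independent[OF E1.indep] by (elim exE conjE)
  obtain c' where c': "c' \<subseteq> v' ` {0..3}" "tet v \<inter> tet v' = convex hull c'"
    using F(2) unfolding tet_def[of v'] face_of_convex_hull_affine_independent[OF E2.indep] by (elim exE conjE)
  have "\<not> affine_dependent c" "\<not> affine_dependent c'"
    using affine_independent_subset[OF E1.indep c(1)] affine_independent_subset[OF E2.indep c'(1)] by simp_all
  from extreme_point_of_convex_hull_affine_independent[OF this(1)] extreme_point_of_convex_hull_affine_independent[OF this(2)]
  have cc: "c = c'" using c(2) c'(2) by auto
  define A where "A = {k \<in> {0..3}. v k \<in> c}"
  have vA: "v ` A = c" using c(1) by (auto simp: A_def)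
  have A3: "A \<subseteq> {0..3}" by (auto simp: A_def)
  have partner: "\<exists>a'\<in>{0..3}. v' a' = v a" if "a \<in> A" for a
  proof -
    have "v a \<in> v' ` {0..3}" using that c'(1) cc by (auto simp: A_def)
    then show ?thesis by force
  qed
  have zero: "bary v k y = 0" if "k \<in> {0..3}" "k \<notin> A" "y \<in> tet v" "y \<in> tet v'" for k y
    by (rule vertex_subset_hull_zero[OF v that(1) A3 that(2)]) (use that(3,4) c(2) vA in blast)
  \<comment> \<open>Otherwise the two tetrahedra would coincide.\<close>
  have "A \<noteq> {0..3}"
  proof
    assume "A = {0..3}"
    then have 1: "c = v ` {0..3}" using vA by simp
    then have "card c' = card (v' ` {0..3})" using cc E1.card_vertices E2.card_vertices by simp
    then have "c' = v' ` {0..3}" using c'(1) by (intro card_subset_eq) auto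
    then show False using 1 cc ne by (simp add: tet_def)
  qed
  then obtain i where i: "i \<in> {0..3}" "i \<notin> A" using A3 by blast
  obtain l m n where e: "{i, l, m, n} = {0..3}" using i(1) by (rule E1.other_indices)
  note d = E1.distinct_indices[OF e]
  have vx: "jump (v a) = 0 \<and> grad_jump (v a) = 0" if a: "a \<in> A" for a
  proof -
    obtain a' where a': "a' \<in> {0..3}" "v' a' = v a" using partner[OF a] by blast
    have "v a \<in> v ` {0..3}" "v a \<in> v' ` {0..3}" using a A3 a' by force+
    then have "v a extreme_point_of tet v" "v a extreme_point_of tet v'"
      unfolding tet_def extreme_point_of_convex_hull_affine_independent[OF E1.indep]
        extreme_point_of_convex_hull_affine_independent[OF E2.indep] by simp_all
    from vertex[OF this] show ?thesis by (simp add: jump_def grad_jump_def)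
  qed
  have edge: "jump y = 0 \<and> grad_jump y = 0" if a: "a \<in> A" and b: "b \<in> A" and ab: "a \<noteq> b" and y: "E1.on_edge a b y" for a b y
  proof -
    have ab3: "a \<in> {0..3}" "b \<in> {0..3}" using a b A3 by auto
    obtain a' where a': "a' \<in> {0..3}" "v' a' = v a" using partner[OF a] by blast
    obtain b' where b': "b' \<in> {0..3}" "v' b' = v b" using partner[OF b] by blast
    have vab: "v a \<noteq> v b" using E1.inj ab ab3 by (auto dest: inj_onD)
    let ?e = "closed_segment (v a) (v b)"
    have e1: "?e edge_of tet v" by (rule vertex_segment_edge_of[OF v ab3 vab])
    have e2: "?e edge_of tet v'" using vertex_segment_edge_of[OF v' a'(1) b'(1)] vab a' b' by simp
    obtain g0 g1 where g: "independent {g0, g1}" "g0 \<noteq> g1" "g0 \<in> edge_perp ?e" "g1 \<in> edge_perp ?e"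
      "cont_ext (tet v) (grad w) (edge_mid ?e) \<bullet> g0 = cont_ext (tet v') (grad w') (edge_mid ?e) \<bullet> g0"
      "cont_ext (tet v) (grad w) (edge_mid ?e) \<bullet> g1 = cont_ext (tet v') (grad w') (edge_mid ?e) \<bullet> g1"
      using mid[OF e1 e2] by (elim exE conjE)
    have perp: "g \<bullet> (v b - v a) = 0" if "g \<in> edge_perp ?e" for g
      using that unfolding edge_perp_def orthogonal_def by (auto simp: inner_commute)
    interpret S: shared_edge v w v' w' a b a' b' g0 g1
    proof unfold_locales
      show "a' \<noteq> b'" using vab a' b' by auto
      show "grad_jump (midpoint (v a) (v b)) \<bullet> g0 = 0" "grad_jump (midpoint (v a) (v b)) \<bullet> g1 = 0"
        using g(5,6) by (simp_all add: grad_jump_def inner_diff_left edge_mid_segment)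
    qed (use ab3 ab a' b' vx[OF a] vx[OF b] g perp in auto)
    show ?thesis using S.on_edge_zero[OF y] by blast
  qed
  have edge': "jump x = 0 \<and> grad_jump x = 0" if y: "E1.on_edge a b x" and ab: "a \<in> {0..3}" "b \<in> {0..3}" "a \<noteq> b" for a b
  proof -
    have vin: "k \<in> A" if "x = v k" "k \<in> {0..3}" for k
      using zero[OF that(2) _ x] that E1.bary_vertex[of k k] by fastforce
    note pt = E1.on_edge_point(1)[OF y ab] and s = E1.on_edge_sum[OF y ab]
    show ?thesis
    proof (cases "a \<in> A \<and> b \<in> A")
      case True then show ?thesis using edge ab y by blast
    next
      case False
      then have "bary v a x = 0 \<or> bary v b x = 0" using zero[OF _ _ x] ab by blast
      then have "x = v a \<or> x = v b"
      proof
        assume "bary v a x = 0"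
        then have "bary v b x = 1" using s by simp
        then show ?thesis using pt by simp
      qed (use pt in simp)
      then show ?thesis using vin vx ab by blast
    qed
  qed
  have xf: "x \<in> face v i" using zero[OF i x] x by (simp add: face_def)
  have on: "E1.on_edge a b y" if "y \<in> face v i" "bary v c y = 0" "{a, b, c} = {l, m, n}" for a b c y
    unfolding E1.on_edge_def
  proof (intro conjI ballI)
    fix k assume k: "k \<in> {0..3} - {a, b}"
    then have "k = i \<or> k = c" using e that(3) by blast
    then show "bary v k y = 0" using that E1.face_zero by blast
  qed (rule E1.face_subset[OF that(1)])
  have sets: "{m, n, l} = {l, m, n}" "{l, n, m} = {l, m, n}" by blast+
  have "jump x = 0 \<and> grad_jump x = 0"
  proof (cases "l \<in> A \<and> m \<in> A \<and> n \<in> A")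
    case True
    obtain l' where l': "l' \<in> {0..3}" "v' l' = v l" using partner True by blast
    obtain m' where m': "m' \<in> {0..3}" "v' m' = v m" using partner True by blast
    obtain n' where n': "n' \<in> {0..3}" "v' n' = v n" using partner True by blast
    have "l' \<noteq> m'" "l' \<noteq> n'" "m' \<noteq> n'"
      using l' m' n' d E1.inj by (metis inj_onD)+
    then have "card ({0..3} - {l', m', n'}) = 1" using l' m' n' by (subst card_Diff_subset) auto
    then obtain i' where "{0..3} - {l', m', n'} = {i'}" by (rule card_1_singletonE)
    then have e': "{i', l', m', n'} = {0..3}" using l' m' n' by blast
    have ed: "jump y = 0 \<and> grad_jump y = 0" if "y \<in> face v i" "bary v l y = 0 \<or> bary v m y = 0 \<or> bary v n y = 0" for y
      using that(2)
    proof (elim disjE)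
      assume "bary v l y = 0"
      from edge[OF _ _ d(6) on[OF that(1) this sets(1)]] True show ?thesis by simp
    next
      assume "bary v m y = 0"
      from edge[OF _ _ d(5) on[OF that(1) this sets(2)]] True show ?thesis by simp
    next
      assume "bary v n y = 0"
      from edge[OF _ _ d(4) on[OF that(1) this refl]] True show ?thesis by simp
    qed
    show ?thesis
    proof
      show "jump x = 0" by (rule jump_on_face[OF e e' l'(2) m'(2) n'(2) _ xf]) (rule ed)
      show "grad_jump x = 0" by (rule grad_jump_on_face[OF e e' l'(2) m'(2) n'(2) _ xf]) (rule ed)
    qed
  next
    case False
    then have "bary v l x = 0 \<or> bary v m x = 0 \<or> bary v n x = 0" using zero[OF _ _ x] d by blast
    then show ?thesis
    proof (elim disjE)
      assume "bary v l x = 0"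
      from edge'[OF on[OF xf this sets(1)] d(9,10,6)] show ?thesis .
    next
      assume "bary v m x = 0"
      from edge'[OF on[OF xf this sets(2)] d(8,10,5)] show ?thesis .
    next
      assume "bary v n x = 0"
      from edge'[OF on[OF xf this refl] d(8,9,4)] show ?thesis .
    qed
  qed
  then show ?thesis by (simp add: jump_def grad_jump_def)
qed

section \<open>Gluing\<close>

lemma test_functions_iter_partial:
  "\<phi> \<in> test_functions \<Omega> \<Longrightarrow> iter_partial is \<phi> \<in> test_functions \<Omega>"
  by (induction "is") (simp_all add: iter_partial_def test_functions_partial)

lemma has_weak_partial_compose:
  assumes f: "has_weak_partial \<Omega> [i] f g" and g: "has_weak_partial \<Omega> [j] g h"
  shows "has_weak_partial \<Omega> [i, j] f h"
  unfolding has_weak_partial_def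
proof
  fix \<phi> assume \<phi>: "\<phi> \<in> test_functions \<Omega>"
  have "(LINT x|lebesgue_on \<Omega>. f x * iter_partial [i, j] \<phi> x)
      = (LINT x|lebesgue_on \<Omega>. f x * iter_partial [i] (partial_deriv j \<phi>) x)" by (simp add: iter_partial_def)
  also have "\<dots> = - (LINT x|lebesgue_on \<Omega>. g x * partial_deriv j \<phi> x)"
    using f test_functions_partial[OF \<phi>] unfolding has_weak_partial_def by simp
  also have "\<dots> = (LINT x|lebesgue_on \<Omega>. h x * \<phi> x)"
    using g \<phi> unfolding has_weak_partial_def by (simp add: iter_partial_def)
  finally show "(LINT x|lebesgue_on \<Omega>. f x * iter_partial [i, j] \<phi> x)
     = (- 1) ^ length [i, j] * (LINT x|lebesgue_on \<Omega>. h x * \<phi> x)" by simp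
qed

context piecewise_lipschitz
begin

lemma has_weak_partial_cong_AE:
  assumes h: "has_weak_partial \<Omega> is f g"
    and m: "f \<in> borel_measurable (lebesgue_on \<Omega>)" "f' \<in> borel_measurable (lebesgue_on \<Omega>)"
      "g \<in> borel_measurable (lebesgue_on \<Omega>)" "g' \<in> borel_measurable (lebesgue_on \<Omega>)"
    and f: "AE x in lebesgue_on \<Omega>. f x = f' x" and g: "AE x in lebesgue_on \<Omega>. g x = g' x"
  shows "has_weak_partial \<Omega> is f' g'"
  unfolding has_weak_partial_def
proof
  fix \<phi> assume \<phi>: "\<phi> \<in> test_functions \<Omega>"
  have mt: "\<psi> \<in> borel_measurable (lebesgue_on \<Omega>)" if "\<psi> \<in> test_functions \<Omega>" for \<psi>
    by (rule measurable_restrict_space1[OF test_function_measurable_bounded(1)[OF that]])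
  note mi = mt[OF test_functions_iter_partial[OF \<phi>]] and mp = mt[OF \<phi>]
  have "(LINT x|lebesgue_on \<Omega>. f' x * iter_partial is \<phi> x) = (LINT x|lebesgue_on \<Omega>. f x * iter_partial is \<phi> x)"
    by (rule integral_cong_AE[OF borel_measurable_times[OF m(2) mi] borel_measurable_times[OF m(1) mi]])
      (use f in eventually_elim, simp)
  also have "\<dots> = (- 1) ^ length is * (LINT x|lebesgue_on \<Omega>. g x * \<phi> x)"
    using h \<phi> unfolding has_weak_partial_def by blast
  also have "(LINT x|lebesgue_on \<Omega>. g x * \<phi> x) = (LINT x|lebesgue_on \<Omega>. g' x * \<phi> x)"
    by (rule integral_cong_AE[OF borel_measurable_times[OF m(3) mp] borel_measurable_times[OF m(4) mp]])
      (use g in eventually_elim, simp)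
  finally show "(LINT x|lebesgue_on \<Omega>. f' x * iter_partial is \<phi> x) = (- 1) ^ length is * (LINT x|lebesgue_on \<Omega>. g' x * \<phi> x)" .
qed

lemma AE_interiors:
  assumes "\<And>T x. T \<in> \<T> \<Longrightarrow> x \<in> interior T \<Longrightarrow> P x"
  shows "AE x in lebesgue_on \<Omega>. P x"
proof -
  have "AE x in lebesgue. x \<notin> \<Union>\<T> - (\<Union>T\<in>\<T>. interior T)"
    using negligible_skeleton unfolding negligible_iff_null_sets by (rule AE_not_in)
  then have "AE x in lebesgue. x \<in> \<Omega> \<longrightarrow> P x"
  proof eventually_elim
    case (elim x)
    show ?case
    proof
      assume "x \<in> \<Omega>"
      then have "x \<in> \<Union>\<T>" using cover by (rule subsetD[rotated])
      then obtain T where "T \<in> \<T>" "x \<in> interior T" using elim by auto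
      then show "P x" by (rule assms)
    qed
  qed
  moreover have "\<Omega> \<inter> space lebesgue \<in> sets lebesgue" using Omega_lebesgue by simp
  ultimately show ?thesis by (subst AE_restrict_space_iff)
qed

end

lemma tetrahedron_if_labelling: "is_labelling v T \<Longrightarrow> tetrahedron v \<and> tet v = T"
  unfolding is_labelling_def tetrahedron_def by simp

locale glued_elements =
  fixes \<T> :: "point set set" and vert :: "point set \<Rightarrow> nat \<Rightarrow> point" and w :: "point set \<Rightarrow> point \<Rightarrow> real"
  assumes label: "T \<in> \<T> \<Longrightarrow> is_labelling (vert T) T" and w: "T \<in> \<T> \<Longrightarrow> w T \<in> Z3sing (vert T)"
    and agree: "T \<in> \<T> \<Longrightarrow> T' \<in> \<T> \<Longrightarrow> x \<in> T \<Longrightarrow> x \<in> T' \<Longrightarrow>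
      cont_ext T (w T) x = cont_ext T' (w T') x \<and> cont_ext T (grad (w T)) x = cont_ext T' (grad (w T')) x"
    and finite: "finite \<T>"
begin

text \<open>Since the pieces agree on intersections, the choice is immaterial.\<close>

definition piece :: "point \<Rightarrow> point set" where "piece x = (SOME T. T \<in> \<T> \<and> x \<in> T)"
definition glued :: "point \<Rightarrow> real" where "glued x = cont_ext (piece x) (w (piece x)) x"
definition glued_grad :: "point \<Rightarrow> point" where "glued_grad x = cont_ext (piece x) (grad (w (piece x))) x"

lemma on_piece:
  assumes "T \<in> \<T>" "x \<in> T"
  shows "glued x = cont_ext T (w T) x" "glued_grad x = cont_ext T (grad (w T)) x"
proof -
  have "piece x \<in> \<T> \<and> x \<in> piece x" unfolding piece_def by (rule someI[of _ T]) (use assms in simp)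
  then show "glued x = cont_ext T (w T) x" "glued_grad x = cont_ext T (grad (w T)) x"
    using agree[of "piece x" T x] assms by (simp_all add: glued_def glued_grad_def)
qed

lemma element: "T \<in> \<T> \<Longrightarrow> tetrahedron_element (vert T) (w T) \<and> tet (vert T) = T"
  using tetrahedron_if_labelling[OF label] w
  by (simp add: tetrahedron_element_def tetrahedron_element_axioms_def)

lemma lipschitz_on_pieces:
  assumes T: "T \<in> \<T>"
  shows "\<exists>L. L-lipschitz_on T glued" "\<exists>L. L-lipschitz_on T (\<lambda>x. glued_grad x $ i)"
proof -
  interpret E: tetrahedron_element "vert T" "w T" using element[OF T] by blast
  have tet: "tet (vert T) = T" using element[OF T] by blast
  obtain L where L: "L-lipschitz_on T (cont_ext T (w T))" using E.C2_val_lipschitz[OF E.C2] unfolding tet by (elim exE)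
  obtain M where M: "M-lipschitz_on T (cont_ext T (grad (w T)))" using E.C2_grd_lipschitz[OF E.C2] unfolding tet by (elim exE)
  have "L-lipschitz_on T glued" by (rule lipschitz_on_transform[OF L]) (simp add: on_piece(1)[OF T])
  then show "\<exists>L. L-lipschitz_on T glued" by (rule exI)
  have "M-lipschitz_on T (\<lambda>x. glued_grad x $ i)"
  proof (rule lipschitz_onI)
    fix x y assume xy: "x \<in> T" "y \<in> T"
    have "dist (glued_grad x $ i) (glued_grad y $ i) \<le> dist (glued_grad x) (glued_grad y)" by (rule dist_vec_nth_le)
    also have "\<dots> \<le> M * dist x y" using lipschitz_onD[OF M xy] by (simp add: on_piece(2)[OF T] xy)
    finally show "dist (glued_grad x $ i) (glued_grad y $ i) \<le> M * dist x y" .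
  qed (rule lipschitz_on_nonneg[OF M])
  then show "\<exists>L. L-lipschitz_on T (\<lambda>x. glued_grad x $ i)" by (rule exI)
qed

lemma interior_derivatives:
  assumes T: "T \<in> \<T>" and x: "x \<in> interior T"
  shows "glued x = w T x" "GDERIV glued x :> glued_grad x" "(\<lambda>x. glued_grad x $ i) differentiable (at x)"
proof -
  interpret E: tetrahedron_element "vert T" "w T" using element[OF T] by blast
  have tet: "tet (vert T) = T" using element[OF T] by blast
  have yT: "y \<in> T" if "y \<in> interior T" for y using that interior_subset by blast
  have val: "glued y = w T y" if "y \<in> interior T" for y
    using E.C2_val_interior[OF E.C2, of y] that on_piece(1)[OF T yT[OF that]] unfolding tet by simp
  then show "glued x = w T x" using x by blast
  have "GDERIV (w T) x :> glued_grad x"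
    using E.C2_GDERIV[OF E.C2, of x] x on_piece(2)[OF T yT[OF x]] unfolding tet by simp
  then show "GDERIV glued x :> glued_grad x"
    unfolding gderiv_def by (rule has_derivative_transform_within_open[OF _ open_interior x]) (simp add: val)
  obtain D where D: "((\<lambda>y. cont_ext T (grad (w T)) y $ i) has_derivative D) (at x)"
    using E.C2_grd_differentiable[OF E.C2, of x i] x unfolding tet differentiable_def by (auto)
  have "((\<lambda>y. glued_grad y $ i) has_derivative D) (at x)"
    by (rule has_derivative_transform_within_open[OF D open_interior x]) (simp add: on_piece(2)[OF T yT])
  then show "(\<lambda>x. glued_grad x $ i) differentiable (at x)" by (rule differentiableI)
qed

lemma piecewise_lipschitz_glued:
  assumes "open \<Omega>" "\<Omega> \<subseteq> \<Union>\<T>"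
  shows "piecewise_lipschitz \<Omega> \<T> glued" "piecewise_lipschitz \<Omega> \<T> (\<lambda>x. glued_grad x $ i)"
proof -
  have geo: "compact T \<and> convex T" if "T \<in> \<T>" for T
    using tetrahedron.tet_compact[of "vert T"] tetrahedron.tet_convex[of "vert T"] tetrahedron_if_labelling[OF label[OF that]] by simp
  show "piecewise_lipschitz \<Omega> \<T> glued"
  proof (unfold_locales)
    show "glued differentiable (at x)" if "T \<in> \<T>" "x \<in> interior T" for T x
      using interior_derivatives(2)[OF that] unfolding gderiv_def by (rule differentiableI)
  qed (use geo finite assms lipschitz_on_pieces(1) in simp_all)
  show "piecewise_lipschitz \<Omega> \<T> (\<lambda>x. glued_grad x $ i)"
    by unfold_locales (use geo finite assms lipschitz_on_pieces(2) interior_derivatives(3) in simp_all)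
qed

text \<open>The first derivatives of the glued function are the components of \<open>glued_grad\<close>, which are piecewise
  Lipschitz themselves and therefore have bounded weak derivatives.\<close>

lemma glued_in_H2:
  assumes \<Omega>: "open \<Omega>" "\<Omega> \<subseteq> \<Union>\<T>" and z: "z \<in> L2 \<Omega>"
    and zw: "\<And>T. T \<in> \<T> \<Longrightarrow> AE x in lebesgue_on T. z x = w T x"
  shows "z \<in> sobolev_H 2 \<Omega>"
proof -
  interpret U: piecewise_lipschitz \<Omega> \<T> glued by (rule piecewise_lipschitz_glued(1)[OF \<Omega>])
  interpret V: piecewise_lipschitz \<Omega> \<T> "\<lambda>x. glued_grad x $ i" for i by (rule piecewise_lipschitz_glued(2)[OF \<Omega>])
  have zm: "z \<in> borel_measurable (lebesgue_on \<Omega>)" using z by (simp add: L2_def)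
  have pd: "U.pd i x = glued_grad x $ i" if "T \<in> \<T>" "x \<in> interior T" for T x i
  proof -
    have "frechet_derivative glued (at x) = (\<lambda>h. h \<bullet> glued_grad x)"
      using frechet_derivative_at[OF interior_derivatives(2)[OF that, unfolded gderiv_def]] by simp
    then show ?thesis using that by (auto simp: U.pd_def partial_deriv_def inner_axis')
  qed
  have Uz: "AE x in lebesgue_on \<Omega>. glued x = z x"
  proof -
    have "AE x in lebesgue. x \<in> T \<longrightarrow> z x = w T x" if T: "T \<in> \<T>" for T
    proof -
      have "T \<in> sets lebesgue" using U.comp[OF T] by (simp add: borel_closed compact_imp_closed sets_completionI_sets)
      then show ?thesis using zw[OF T] by (subst (asm) AE_restrict_space_iff) simp_all
    qed
    then have "AE x in lebesgue. \<forall>T\<in>\<T>. x \<in> T \<longrightarrow> z x = w T x" using finite by (intro AE_finite_allI)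
    then have 1: "AE x in lebesgue_on \<Omega>. \<forall>T\<in>\<T>. x \<in> T \<longrightarrow> z x = w T x"
      using U.Omega_lebesgue by (subst AE_restrict_space_iff) (auto elim: eventually_mono)
    have 2: "AE x in lebesgue_on \<Omega>. \<exists>T\<in>\<T>. x \<in> T \<and> glued x = w T x"
      by (rule U.AE_interiors) (use interior_derivatives(1) interior_subset in blast)
    show ?thesis using 1 2 by eventually_elim auto
  qed
  have first: "has_weak_partial \<Omega> [i] z (U.pd i)" for i
    by (rule U.has_weak_partial_cong_AE[OF U.weak_partial_U U.U_measurable zm U.pd_measurable_Omega U.pd_measurable_Omega Uz]) simp
  have "AE x in lebesgue_on \<Omega>. U.pd i x = glued_grad x $ i" for i by (rule U.AE_interiors) (rule pd)
  then have first': "has_weak_partial \<Omega> [i] z (\<lambda>x. glued_grad x $ i)" for i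
    by (intro U.has_weak_partial_cong_AE[OF first zm zm U.pd_measurable_Omega V.U_measurable]) simp_all
  have second: "has_weak_partial \<Omega> [i, j] z (V.pd i j)" for i j
    by (rule has_weak_partial_compose[OF first' V.weak_partial_U])
  have "\<exists>g\<in>L2 \<Omega>. has_weak_partial \<Omega> is z g" if "length is \<le> 2" for "is"
  proof -
    consider "is = []" | i where "is = [i]" | i j where "is = [i, j]"
      using \<open>length is \<le> 2\<close> by (cases "is" rule: list.exhaust; cases "tl is" rule: list.exhaust) (auto simp: Suc_le_eq numeral_2_eq_2)
    then show ?thesis
    proof cases
      case 1
      have "has_weak_partial \<Omega> [] z z" by (simp add: has_weak_partial_def iter_partial_def)
      then show ?thesis using 1 z by blast
    next
      case 2 then show ?thesis using first U.pd_L2 by blast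
    next
      case 3 then show ?thesis using second V.pd_L2 by blast
    qed
  qed
  then show ?thesis using z unfolding sobolev_H_def by simp
qed

end

theorem theorem3p14:
  fixes \<Omega> :: "point set" and \<T> :: "point set set"
    and vert :: "point set \<Rightarrow> nat \<Rightarrow> point" and \<gamma> :: "point set \<Rightarrow> nat \<Rightarrow> point"
  assumes "bounded \<Omega>" and "polyhedral_domain \<Omega>"
    and "conforming_triangulation \<T> \<Omega>"
    and "\<And>T. T \<in> \<T> \<Longrightarrow> is_labelling (vert T) T"
    and "\<And>T e. T \<in> \<T> \<Longrightarrow> e edge_of T \<Longrightarrow>
           \<gamma> e 0 \<in> edge_perp e \<and> \<gamma> e 1 \<in> edge_perp e \<and>
           \<gamma> e 0 \<noteq> \<gamma> e 1 \<and> independent {\<gamma> e 0, \<gamma> e 1}"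
  shows "Z3sing_global \<Omega> \<T> vert \<gamma> \<subseteq> sobolev_H 2 \<Omega>"
proof
  fix z assume "z \<in> Z3sing_global \<Omega> \<T> vert \<gamma>"
  then have zL2: "z \<in> L2 \<Omega>" and "\<exists>w.
     (\<forall>T\<in>\<T>. w T \<in> Z3sing (vert T) \<and> (AE x in lebesgue_on T. z x = w T x)) \<and>
     (\<forall>T\<in>\<T>. \<forall>T'\<in>\<T>. \<forall>p. p extreme_point_of T \<and> p extreme_point_of T' \<longrightarrow>
        cont_ext T (w T) p = cont_ext T' (w T') p \<and>
        cont_ext T (grad (w T)) p = cont_ext T' (grad (w T')) p) \<and>
     (\<forall>T\<in>\<T>. \<forall>T'\<in>\<T>. \<forall>e. e edge_of T \<and> e edge_of T' \<longrightarrow>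
        (\<forall>j\<in>{0, 1}. 4 * (cont_ext T (grad (w T)) (edge_mid e) \<bullet> \<gamma> e j)
                   = 4 * (cont_ext T' (grad (w T')) (edge_mid e) \<bullet> \<gamma> e j)))"
    unfolding Z3sing_global_def by simp_all
  then obtain w where
    local_w: "\<forall>T\<in>\<T>. w T \<in> Z3sing (vert T) \<and> (AE x in lebesgue_on T. z x = w T x)" and
    vertex: "\<forall>T\<in>\<T>. \<forall>T'\<in>\<T>. \<forall>p. p extreme_point_of T \<and> p extreme_point_of T' \<longrightarrow>
        cont_ext T (w T) p = cont_ext T' (w T') p \<and>
        cont_ext T (grad (w T)) p = cont_ext T' (grad (w T')) p" and
    edge: "\<forall>T\<in>\<T>. \<forall>T'\<in>\<T>. \<forall>e. e edge_of T \<and> e edge_of T' \<longrightarrow>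
        (\<forall>j\<in>{0, 1}. 4 * (cont_ext T (grad (w T)) (edge_mid e) \<bullet> \<gamma> e j)
                   = 4 * (cont_ext T' (grad (w T')) (edge_mid e) \<bullet> \<gamma> e j))"
    by (elim exE conjE)
  have tri: "triangulation \<T>" and cover: "\<Union>\<T> = closure \<Omega>"
    using assms(3) by (simp_all add: conforming_triangulation_def)
  have opn: "open \<Omega>" using assms(2) by (simp add: polyhedral_domain_def)
  interpret glued_elements \<T> vert w
  proof
    show "is_labelling (vert T) T" if "T \<in> \<T>" for T using that by (rule assms(4))
    show "w T \<in> Z3sing (vert T)" if "T \<in> \<T>" for T using bspec[OF local_w that] by (rule conjunct1)
    show "finite \<T>" using tri by (simp add: triangulation_def)
    fix T T' x assume T: "T \<in> \<T>" and T': "T' \<in> \<T>" and x: "x \<in> T" "x \<in> T'"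
    show "cont_ext T (w T) x = cont_ext T' (w T') x \<and> cont_ext T (grad (w T)) x = cont_ext T' (grad (w T')) x"
    proof (cases "T = T'")
      case False
      have lab: "tetrahedron (vert T)" "tet (vert T) = T" "tetrahedron (vert T')" "tet (vert T') = T'"
        using tetrahedron_if_labelling[OF assms(4)[OF T]] tetrahedron_if_labelling[OF assms(4)[OF T']] by simp_all
      have F: "(T \<inter> T') face_of T" "(T \<inter> T') face_of T'"
      proof -
        have all: "\<forall>T T'. T \<in> \<T> \<and> T' \<in> \<T> \<longrightarrow> (T \<inter> T') face_of T" using tri by (simp add: triangulation_def)
        show "(T \<inter> T') face_of T" using all T T' by simp
        show "(T \<inter> T') face_of T'" using all[rule_format, of T' T] T T' by (simp add: Int_commute)
      qed
      have mid: "\<exists>g0 g1. independent {g0, g1} \<and> g0 \<noteq> g1 \<and> g0 \<in> edge_perp e \<and> g1 \<in> edge_perp e \<and>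
         cont_ext T (grad (w T)) (edge_mid e) \<bullet> g0 = cont_ext T' (grad (w T')) (edge_mid e) \<bullet> g0 \<and>
         cont_ext T (grad (w T)) (edge_mid e) \<bullet> g1 = cont_ext T' (grad (w T')) (edge_mid e) \<bullet> g1"
        if e: "e edge_of T" "e edge_of T'" for e
      proof (intro exI conjI)
        have "\<forall>j\<in>{0, 1}. 4 * (cont_ext T (grad (w T)) (edge_mid e) \<bullet> \<gamma> e j)
                   = 4 * (cont_ext T' (grad (w T')) (edge_mid e) \<bullet> \<gamma> e j)"
          by (rule mp[OF spec[OF bspec[OF bspec[OF edge T] T']] conjI[OF e]])
        then show "cont_ext T (grad (w T)) (edge_mid e) \<bullet> \<gamma> e 0 = cont_ext T' (grad (w T')) (edge_mid e) \<bullet> \<gamma> e 0"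
          "cont_ext T (grad (w T)) (edge_mid e) \<bullet> \<gamma> e 1 = cont_ext T' (grad (w T')) (edge_mid e) \<bullet> \<gamma> e 1" by simp_all
      qed (use assms(5)[OF T e(1)] in simp_all)
      have vx: "cont_ext T (w T) p = cont_ext T' (w T') p \<and> cont_ext T (grad (w T)) p = cont_ext T' (grad (w T')) p"
        if "p extreme_point_of T" "p extreme_point_of T'" for p
        using vertex[rule_format, OF T T' conjI[OF that]] .
      have wT: "w T \<in> Z3sing (vert T)" "w T' \<in> Z3sing (vert T')"
        using conjunct1[OF bspec[OF local_w T]] conjunct1[OF bspec[OF local_w T']] by simp_all
      show ?thesis
        using elements_agree_on_intersection[OF lab(1,3) wT, unfolded lab(2,4), OF F False vx mid x] .
    qed simp
  qed
  show "z \<in> sobolev_H 2 \<Omega>"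
  proof (rule glued_in_H2[OF opn _ zL2])
    show "\<Omega> \<subseteq> \<Union>\<T>" unfolding cover by (rule closure_subset)
    show "AE x in lebesgue_on T. z x = w T x" if "T \<in> \<T>" for T
      using bspec[OF local_w that] by (rule conjunct2)
  qed
qed

end
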